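(* Let $\phi:G\times Q\to Q$ be a left action of a Lie group $G$ on a manifold $Q$, and let $\Phi:G\times T^*Q\to T^*Q$ be a symplectic action of $G$ on $(T^*Q,\omega_Q)$ whose projection on $Q$ is $\phi$, i.e. $\Phi_g^*\omega_Q=\omega_Q$ and $\pi_Q\circ\Phi_g=\phi_g\circ\pi_Q$ for all $g\in G$. Then there exists a differentiable map $A:G\times Q\to T^*Q$ such that: (1) $A$ is fibered on $Q$, i.e. $\pi_Q\circ A=pr_2$, where $pr_2:G\times Q\to Q$ is the projection on the second factor. (2) For each $g\in G$, the $1$-form $A(g):=A(g,\cdot)$ on $Q$ is closed. (3) $\Phi_g=(T^*\phi)_g\circ t_{A(g)}$ for all $g\in G$. In particular, $\Phi$ is an affine action (each $\Phi_g$ restricts to affine maps $T_q^*Q\to T^*_{\phi_g(q)}Q$ between fibers). Moreover, $\Phi$ is linear (each $\Phi_g$ restricts to linear maps between fibers) if and only if $\Phi$ is the cotangent lift $T^*\phi$ of $\phi$.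
   Context: $\pi_Q:T^*Q\to Q$ is the cotangent projection, $\theta_Q$ the Liouville $1$-form, $\omega_Q=-d\theta_Q$ the canonical symplectic form. Actions of Lie groups are smooth left actions; $\phi_g=\phi(g,\cdot)$. The cotangent lift $T^*\phi:G\times T^*Q\to T^*Q$ of $\phi$ is the action $(T^*\phi)_g(\alpha_q)=T^*_{\phi_g(q)}\phi_{g^{-1}}(\alpha_q)\in T^*_{\phi_g(q)}Q$ for $\alpha_q\in T_q^*Q$, i.e. $\alpha_q\mapsto\alpha_q\circ T_{\phi_g(q)}\phi_{g^{-1}}$. For a $1$-form $\alpha$ on $Q$, $t_\alpha:T^*Q\to T^*Q$ is the fiber translation $t_\alpha(\gamma_q)=\gamma_q+\alpha(q)$. *)

theory Defs
  imports "HOL-Analysis.Analysis" "HOL-Algebra.Group"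
begin

section \<open>Smooth maps between normed spaces\<close>

text \<open>Used only for open \<open>S\<close> and finite-dimensional \<open>'a\<close>, where asking for all iterated
  directional derivatives is the usual notion of a \<open>C\<^sup>k\<close> map.\<close>

primrec Ck_on :: "nat \<Rightarrow> 'a::real_normed_vector set \<Rightarrow> ('a \<Rightarrow> 'b::real_normed_vector) \<Rightarrow> bool" where
  "Ck_on 0 S f \<longleftrightarrow> continuous_on S f"
| "Ck_on (Suc k) S f \<longleftrightarrow>
     (\<forall>x\<in>S. f differentiable (at x)) \<and>
     (\<forall>v. Ck_on k S (\<lambda>x. frechet_derivative f (at x) v))"

definition smooth_on :: "'a::real_normed_vector set \<Rightarrow> ('a \<Rightarrow> 'b::real_normed_vector) \<Rightarrow> bool" where
  "smooth_on S f \<longleftrightarrow> (\<forall>k. Ck_on k S f)"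


section \<open>Smooth manifolds\<close>

text \<open>A manifold is given by an atlas. A chart is a domain together with a coordinate map; values
  of the coordinate map outside the domain are irrelevant. The model space is a normed space that
  is required to be finite-dimensional in \<open>smooth_manifold\<close>, rather than a type of class
  \<open>euclidean_space\<close>: the latter class excludes dimension zero, hence discrete Lie groups.\<close>

type_synonym ('q, 'e) chart = "'q set \<times> ('q \<Rightarrow> 'e)"
type_synonym ('q, 'e) atlas = "('q, 'e) chart set"

abbreviation dom_chart :: "('q, 'e) chart \<Rightarrow> 'q set" where
  "dom_chart c \<equiv> fst c"

abbreviation chart_inv :: "('q, 'e) chart \<Rightarrow> 'e \<Rightarrow> 'q" where
  "chart_inv c \<equiv> inv_into (fst c) (snd c)"

definition points :: "('q, 'e) atlas \<Rightarrow> 'q set" where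
  "points M = (\<Union>c\<in>M. dom_chart c)"

definition atlas_topology :: "('q, 'e::real_normed_vector) atlas \<Rightarrow> 'q topology" where
  "atlas_topology M =
     topology (\<lambda>U. U \<subseteq> points M \<and> (\<forall>c\<in>M. open (snd c ` (U \<inter> dom_chart c))))"

definition smooth_manifold :: "('q, 'e::real_normed_vector) atlas \<Rightarrow> bool" where
  "smooth_manifold M \<longleftrightarrow>
     (\<exists>B::'e set. finite B \<and> span B = UNIV) \<and>
     (\<forall>c\<in>M. inj_on (snd c) (dom_chart c) \<and> open (snd c ` dom_chart c)) \<and>
     (\<forall>c\<in>M. \<forall>d\<in>M. open (snd c ` (dom_chart c \<inter> dom_chart d)) \<and>
        smooth_on (snd c ` (dom_chart c \<inter> dom_chart d)) (snd d \<circ> chart_inv c)) \<and>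
     Hausdorff_space (atlas_topology M) \<and>
     second_countable (atlas_topology M)"

definition smooth_map ::
    "('p, 'd::real_normed_vector) atlas \<Rightarrow> ('q, 'e::real_normed_vector) atlas \<Rightarrow> ('p \<Rightarrow> 'q) \<Rightarrow> bool" where
  "smooth_map M N f \<longleftrightarrow>
     continuous_map (atlas_topology M) (atlas_topology N) f \<and>
     (\<forall>c\<in>M. \<forall>d\<in>N. smooth_on (snd c ` (dom_chart c \<inter> f -` dom_chart d)) (snd d \<circ> f \<circ> chart_inv c))"

definition prod_atlas :: "('p, 'd) atlas \<Rightarrow> ('q, 'e) atlas \<Rightarrow> ('p \<times> 'q, 'd \<times> 'e) atlas" where
  "prod_atlas M N = {(dom_chart c \<times> dom_chart d, map_prod (snd c) (snd d)) |c d. c \<in> M \<and> d \<in> N}"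


section \<open>Tangent vectors and tangent maps\<close>

text \<open>A tangent vector at \<open>q\<close> is a class of pairs (chart around \<open>q\<close>, coordinate vector), where
  pairs are identified through the derivatives of the coordinate changes. Such a class contains
  exactly one coordinate vector for each chart around \<open>q\<close>, so it is encoded as a function on
  charts (zero on all other charts). Linear operations are pointwise.\<close>

type_synonym ('q, 'e) tangent = "('q, 'e) chart \<Rightarrow> 'e"

definition tangent_space ::
    "('q, 'e::real_normed_vector) atlas \<Rightarrow> 'q \<Rightarrow> ('q, 'e) tangent set" where
  "tangent_space M q =
     {v. (\<forall>c. \<not> (c \<in> M \<and> q \<in> dom_chart c) \<longrightarrow> v c = 0) \<and>
         (\<forall>c\<in>M. \<forall>d\<in>M. q \<in> dom_chart c \<and> q \<in> dom_chart d \<longrightarrow>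
            v d = frechet_derivative (snd d \<circ> chart_inv c) (at (snd c q)) (v c))}"

definition coord_vector ::
    "('q, 'e::real_normed_vector) atlas \<Rightarrow> ('q, 'e) chart \<Rightarrow> 'q \<Rightarrow> 'e \<Rightarrow> ('q, 'e) tangent" where
  "coord_vector M c q e =
     (\<lambda>d. if d \<in> M \<and> q \<in> dom_chart d
          then frechet_derivative (snd d \<circ> chart_inv c) (at (snd c q)) e else 0)"

definition chart_at :: "('q, 'e) atlas \<Rightarrow> 'q \<Rightarrow> ('q, 'e) chart" where
  "chart_at M q = (SOME c. c \<in> M \<and> q \<in> dom_chart c)"

text \<open>On tangent vectors, the result does not depend on the chart chosen by \<open>chart_at\<close>.\<close>

definition tangent_map ::
    "('p, 'd::real_normed_vector) atlas \<Rightarrow> ('q, 'e::real_normed_vector) atlas \<Rightarrow> ('p \<Rightarrow> 'q) \<Rightarrow>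
     'p \<Rightarrow> ('p, 'd) tangent \<Rightarrow> ('q, 'e) tangent" where
  "tangent_map M N f p v =
     (let c = chart_at M p in
      (\<lambda>d. if d \<in> N \<and> f p \<in> dom_chart d
           then frechet_derivative (snd d \<circ> f \<circ> chart_inv c) (at (snd c p)) (v c) else 0))"


section \<open>The cotangent bundle\<close>

text \<open>Covectors at \<open>q\<close> are the linear functionals on the tangent space; as HOL functions are
  total, they are made unique by being zero outside the tangent space. Elements of the cotangent
  bundle are pairs (base point, covector), so the bundle projection is \<open>fst\<close>.\<close>

type_synonym ('q, 'e) covector = "('q, 'e) tangent \<Rightarrow> real"

definition cotangent_space ::
    "('q, 'e::real_normed_vector) atlas \<Rightarrow> 'q \<Rightarrow> ('q, 'e) covector set" where
  "cotangent_space M q =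
     {\<alpha>. (\<forall>v\<in>tangent_space M q. \<forall>w\<in>tangent_space M q. \<alpha> (\<lambda>c. v c + w c) = \<alpha> v + \<alpha> w) \<and>
         (\<forall>r. \<forall>v\<in>tangent_space M q. \<alpha> (\<lambda>c. r *\<^sub>R v c) = r * \<alpha> v) \<and>
         (\<forall>v. v \<notin> tangent_space M q \<longrightarrow> \<alpha> v = 0)}"

text \<open>A chart of \<open>M\<close> with coordinates \<open>x\<close> induces the bundle chart \<open>(q, \<alpha>) \<mapsto> (x, p)\<close>, where \<open>p\<close> is
  the coordinate expression of \<open>\<alpha>\<close>, a functional on the model space (automatically bounded in
  finite dimension).\<close>

definition cotangent_chart ::
    "('q, 'e::real_normed_vector) atlas \<Rightarrow> ('q, 'e) chart \<Rightarrow>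
     ('q \<times> ('q, 'e) covector, 'e \<times> ('e \<Rightarrow>\<^sub>L real)) chart" where
  "cotangent_chart M c =
     (SIGMA q : dom_chart c. cotangent_space M q,
      \<lambda>(q, \<alpha>). (snd c q, Blinfun (\<lambda>e. \<alpha> (coord_vector M c q e))))"

definition cotangent_bundle ::
    "('q, 'e::real_normed_vector) atlas \<Rightarrow>
     ('q \<times> ('q, 'e) covector, 'e \<times> ('e \<Rightarrow>\<^sub>L real)) atlas" where
  "cotangent_bundle M = cotangent_chart M ` M"


section \<open>Differential forms\<close>

text \<open>The coordinate formula \<open>(d\<alpha>)(v, w) = D\<^sub>v \<alpha>(w) - D\<^sub>w \<alpha>(v)\<close>, where \<open>v\<close> and \<open>w\<close> are extended
  to vector fields with constant coordinates.\<close>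

definition ext_deriv ::
    "('q, 'e::real_normed_vector) atlas \<Rightarrow> ('q \<Rightarrow> ('q, 'e) tangent \<Rightarrow> real) \<Rightarrow>
     'q \<Rightarrow> ('q, 'e) tangent \<Rightarrow> ('q, 'e) tangent \<Rightarrow> real" where
  "ext_deriv M \<alpha> q v w =
     (let c = chart_at M q;
          a = (\<lambda>e x. \<alpha> (chart_inv c x) (coord_vector M c (chart_inv c x) e))
      in frechet_derivative (a (w c)) (at (snd c q)) (v c)
       - frechet_derivative (a (v c)) (at (snd c q)) (w c))"

definition one_form ::
    "('q, 'e::real_normed_vector) atlas \<Rightarrow> ('q \<Rightarrow> ('q, 'e) covector) \<Rightarrow> bool" where
  "one_form M \<alpha> \<longleftrightarrow> smooth_map M (cotangent_bundle M) (\<lambda>q. (q, \<alpha> q))"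

definition closed_one_form ::
    "('q, 'e::real_normed_vector) atlas \<Rightarrow> ('q \<Rightarrow> ('q, 'e) covector) \<Rightarrow> bool" where
  "closed_one_form M \<alpha> \<longleftrightarrow>
     one_form M \<alpha> \<and>
     (\<forall>q\<in>points M. \<forall>v\<in>tangent_space M q. \<forall>w\<in>tangent_space M q. ext_deriv M \<alpha> q v w = 0)"

definition liouville_form ::
    "('q, 'e::real_normed_vector) atlas \<Rightarrow> 'q \<times> ('q, 'e) covector \<Rightarrow>
     ('q \<times> ('q, 'e) covector, 'e \<times> ('e \<Rightarrow>\<^sub>L real)) tangent \<Rightarrow> real" where
  "liouville_form Q p X = snd p (tangent_map (cotangent_bundle Q) Q fst p X)"

definition canonical_symplectic_form ::
    "('q, 'e::real_normed_vector) atlas \<Rightarrow> 'q \<times> ('q, 'e) covector \<Rightarrow>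
     ('q \<times> ('q, 'e) covector, 'e \<times> ('e \<Rightarrow>\<^sub>L real)) tangent \<Rightarrow>
     ('q \<times> ('q, 'e) covector, 'e \<times> ('e \<Rightarrow>\<^sub>L real)) tangent \<Rightarrow> real" where
  "canonical_symplectic_form Q p X Y = - ext_deriv (cotangent_bundle Q) (liouville_form Q) p X Y"

definition pullback2 ::
    "('p, 'd::real_normed_vector) atlas \<Rightarrow> ('q, 'e::real_normed_vector) atlas \<Rightarrow> ('p \<Rightarrow> 'q) \<Rightarrow>
     ('q \<Rightarrow> ('q, 'e) tangent \<Rightarrow> ('q, 'e) tangent \<Rightarrow> real) \<Rightarrow>
     'p \<Rightarrow> ('p, 'd) tangent \<Rightarrow> ('p, 'd) tangent \<Rightarrow> real" where
  "pullback2 M N f \<omega> p v w = \<omega> (f p) (tangent_map M N f p v) (tangent_map M N f p w)"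


section \<open>Lie groups and actions\<close>

definition lie_group ::
    "('g, 'm) monoid_scheme \<Rightarrow> ('g, 'd::real_normed_vector) atlas \<Rightarrow> bool" where
  "lie_group G MG \<longleftrightarrow>
     group G \<and> smooth_manifold MG \<and> carrier G = points MG \<and>
     smooth_map (prod_atlas MG MG) MG (\<lambda>(g, h). g \<otimes>\<^bsub>G\<^esub> h) \<and>
     smooth_map MG MG (\<lambda>g. inv\<^bsub>G\<^esub> g)"

definition smooth_left_action ::
    "('g, 'm) monoid_scheme \<Rightarrow> ('g, 'd::real_normed_vector) atlas \<Rightarrow>
     ('q, 'e::real_normed_vector) atlas \<Rightarrow> ('g \<times> 'q \<Rightarrow> 'q) \<Rightarrow> bool" where
  "smooth_left_action G MG M \<phi> \<longleftrightarrow>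
     smooth_map (prod_atlas MG M) M \<phi> \<and>
     (\<forall>x\<in>points M. \<phi> (\<one>\<^bsub>G\<^esub>, x) = x) \<and>
     (\<forall>g\<in>carrier G. \<forall>h\<in>carrier G. \<forall>x\<in>points M. \<phi> (g \<otimes>\<^bsub>G\<^esub> h, x) = \<phi> (g, \<phi> (h, x)))"

definition symplectic_action ::
    "('g, 'm) monoid_scheme \<Rightarrow> ('g, 'd::real_normed_vector) atlas \<Rightarrow>
     ('q, 'e::real_normed_vector) atlas \<Rightarrow>
     ('g \<times> ('q \<times> ('q, 'e) covector) \<Rightarrow> 'q \<times> ('q, 'e) covector) \<Rightarrow> bool" where
  "symplectic_action G MG Q \<Phi> \<longleftrightarrow>
     smooth_left_action G MG (cotangent_bundle Q) \<Phi> \<and>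
     (\<forall>g\<in>carrier G. \<forall>p\<in>points (cotangent_bundle Q).
        \<forall>X\<in>tangent_space (cotangent_bundle Q) p. \<forall>Y\<in>tangent_space (cotangent_bundle Q) p.
          pullback2 (cotangent_bundle Q) (cotangent_bundle Q) (\<lambda>x. \<Phi> (g, x))
            (canonical_symplectic_form Q) p X Y = canonical_symplectic_form Q p X Y)"

definition cotangent_lift ::
    "('g, 'm) monoid_scheme \<Rightarrow> ('q, 'e::real_normed_vector) atlas \<Rightarrow> ('g \<times> 'q \<Rightarrow> 'q) \<Rightarrow>
     'g \<times> ('q \<times> ('q, 'e) covector) \<Rightarrow> 'q \<times> ('q, 'e) covector" where
  "cotangent_lift G Q \<phi> = (\<lambda>(g, (q, \<alpha>)).
     (\<phi> (g, q),
      \<lambda>w. if w \<in> tangent_space Q (\<phi> (g, q))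
          then \<alpha> (tangent_map Q Q (\<lambda>x. \<phi> (inv\<^bsub>G\<^esub> g, x)) (\<phi> (g, q)) w) else 0))"

definition fiber_translation ::
    "('q \<Rightarrow> ('q, 'e) covector) \<Rightarrow> 'q \<times> ('q, 'e) covector \<Rightarrow> 'q \<times> ('q, 'e) covector" where
  "fiber_translation \<alpha> = (\<lambda>(q, \<gamma>). (q, \<lambda>v. \<gamma> v + \<alpha> q v))"


section \<open>Fiberwise linear and affine actions\<close>

definition linear_between ::
    "('x \<Rightarrow> real) set \<Rightarrow> ('y \<Rightarrow> real) set \<Rightarrow> (('x \<Rightarrow> real) \<Rightarrow> ('y \<Rightarrow> real)) \<Rightarrow> bool" where
  "linear_between V W f \<longleftrightarrow>
     f ` V \<subseteq> W \<and>
     (\<forall>\<alpha>\<in>V. \<forall>\<beta>\<in>V. f (\<lambda>v. \<alpha> v + \<beta> v) = (\<lambda>w. f \<alpha> w + f \<beta> w)) \<and>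
     (\<forall>r. \<forall>\<alpha>\<in>V. f (\<lambda>v. r * \<alpha> v) = (\<lambda>w. r * f \<alpha> w))"

definition affine_between ::
    "('x \<Rightarrow> real) set \<Rightarrow> ('y \<Rightarrow> real) set \<Rightarrow> (('x \<Rightarrow> real) \<Rightarrow> ('y \<Rightarrow> real)) \<Rightarrow> bool" where
  "affine_between V W f \<longleftrightarrow>
     (\<exists>L. \<exists>b\<in>W. linear_between V W L \<and> (\<forall>\<alpha>\<in>V. f \<alpha> = (\<lambda>w. L \<alpha> w + b w)))"

definition fiberwise ::
    "(('q, 'e) covector set \<Rightarrow> ('q, 'e) covector set \<Rightarrow>
       (('q, 'e) covector \<Rightarrow> ('q, 'e) covector) \<Rightarrow> bool) \<Rightarrow>
     ('g, 'm) monoid_scheme \<Rightarrow> ('q, 'e::real_normed_vector) atlas \<Rightarrow> ('g \<times> 'q \<Rightarrow> 'q) \<Rightarrow>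
     ('g \<times> ('q \<times> ('q, 'e) covector) \<Rightarrow> 'q \<times> ('q, 'e) covector) \<Rightarrow> bool" where
  "fiberwise P G Q \<phi> \<Phi> \<longleftrightarrow>
     (\<forall>g\<in>carrier G. \<forall>q\<in>points Q.
        P (cotangent_space Q q) (cotangent_space Q (\<phi> (g, q))) (\<lambda>\<alpha>. snd (\<Phi> (g, (q, \<alpha>)))))"

abbreviation "linear_action \<equiv> fiberwise linear_between"
abbreviation "affine_action \<equiv> fiberwise affine_between"

end

(* In bundle coordinates Phi_g maps (x, p) to (f x, P (x, p)). Evaluating the canonical symplectic
   form on a vertical and a horizontal vector shows that the derivative of P (x, p) o Df x with respect
   to p is the identity, hence P (x, p) o Df x = p + a x with a x = P (x, 0) o Df x, that is,
   Phi_g = (T^* phi)_g o t_a. Evaluating it on two horizontal vectors at p = 0 gives da = 0, because the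
   second derivatives of f cancel. *)

theory Submission
  imports Defs
begin

section \<open>Finite-dimensional normed spaces\<close>

text \<open>The model space is a normed space with a finite spanning set, possibly of dimension
  zero. Boundedness of linear maps, smoothness of compositions and smoothness of covector components
  all rest on bounded coordinate functionals built from such a set.

  The choice of charts shapes the symplectic computation. \<open>ext_deriv\<close>, and with it the
  symplectic form, is evaluated in the chart that \<open>chart_at\<close> picks on the cotangent
  bundle, which may differ from the one induced by \<open>chart_at\<close> on the base. The
  symplectic identity is therefore read in the charts picked at a covector and at its image; they
  depend on the base points alone, so one pair of charts serves a whole fibre. Closedness is then
  moved to the base chart picked by \<open>chart_at\<close> through the same fact that proves it: d
  commutes with pullback.

  The form a is the pullback along f of the values of Phi_g on the zero section. In this shape it
  involves g only through Phi on zero covectors and the first derivative of phi, so joint smoothness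
  in g and q follows from that of the two actions. The invertibility of phi_g enters afterwards,
  when the affine law is rewritten as a cotangent lift.\<close>

definition fin_dim :: "'a::real_normed_vector itself \<Rightarrow> bool" where
  "fin_dim _ \<longleftrightarrow> (\<exists>B::'a set. finite B \<and> span B = UNIV)"

text \<open>A subspace with bounded coordinates is closed: if vectors of \<open>span B\<close>
  approached \<open>- a\<close>, their coordinates would be Cauchy sequences of reals, and the
  limits would express \<open>- a\<close> through \<open>B\<close>. The bound \<open>C\<close> is
  what the induction in \<open>representation_bound\<close> supplies.\<close>

lemma norm_add_span_lower_bound:
  fixes B :: "'a::real_normed_vector set"
  assumes B: "finite B" "independent (insert a B)" "a \<notin> B"
    and C: "\<And>x b. x \<in> span B \<Longrightarrow> b \<in> B \<Longrightarrow> \<bar>representation B x b\<bar> \<le> C * norm x"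
  obtains d where "d > 0" "\<And>y. y \<in> span B \<Longrightarrow> d \<le> norm (a + y)"
proof -
  have indB: "independent B"
    using B(2) by (metis independent_insert B(3))
  have anot: "a \<notin> span B"
    using B(2,3) by (metis independent_insert)
  have "\<exists>d>0. \<forall>y\<in>span B. d \<le> norm (a + y)"
  proof (rule ccontr)
    assume "\<not> ?thesis"
    then have "\<exists>y\<in>span B. norm (a + y) < inverse (real (Suc n))" for n
      by (metis inverse_positive_iff_positive not_le of_nat_0_less_iff zero_less_Suc)
    then obtain y where y: "\<And>n. y n \<in> span B" "\<And>n. norm (a + y n) < inverse (real (Suc n))"
      by metis
    have "(\<lambda>n. a + y n) \<longlonglongrightarrow> 0"
      by (rule Lim_null_comparison[OF _ LIMSEQ_inverse_real_of_nat])
        (use y(2) less_imp_le in \<open>auto intro!: always_eventually\<close>)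
    then have "(\<lambda>n. (a + y n) - a) \<longlonglongrightarrow> 0 - a"
      by (intro tendsto_intros)
    then have lim: "y \<longlonglongrightarrow> - a" by simp
    have "\<exists>l. (\<lambda>n. representation B (y n) b) \<longlonglongrightarrow> l" if b: "b \<in> B" for b
    proof -
      have "Cauchy (\<lambda>n. representation B (y n) b)"
      proof (rule metric_CauchyI)
        fix e :: real assume e: "e > 0"
        have "Cauchy y" using lim by (auto intro: LIMSEQ_imp_Cauchy)
        \<comment> \<open>The sign of \<open>C\<close> is unknown; \<open>\<bar>C\<bar> + 1\<close>
          is a positive bound that can be divided by.\<close>
        then obtain N where N: "\<And>m n. m \<ge> N \<Longrightarrow> n \<ge> N \<Longrightarrow> dist (y m) (y n) < e / (\<bar>C\<bar> + 1)"
          using e by (metis Cauchy_def abs_ge_zero add_nonneg_pos divide_pos_pos zero_less_one)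
        have "dist (representation B (y m) b) (representation B (y n) b) < e" if "m \<ge> N" "n \<ge> N" for m n
        proof -
          have "\<bar>representation B (y m) b - representation B (y n) b\<bar>
                = \<bar>representation B (y m - y n) b\<bar>"
            by (simp add: representation_diff[OF indB] y)
          also have "\<dots> \<le> C * norm (y m - y n)"
            by (intro C span_diff y b)
          also have "\<dots> \<le> (\<bar>C\<bar> + 1) * norm (y m - y n)"
            by (intro mult_right_mono) auto
          also have "\<dots> < e"
            using N[OF that] by (simp add: dist_norm field_simps)
          finally show ?thesis by (simp add: dist_real_def)
        qed
        then show "\<exists>M. \<forall>m\<ge>M. \<forall>n\<ge>M. dist (representation B (y m) b) (representation B (y n) b) < e"
          by blast
      qed
      then show ?thesis by (metis Cauchy_convergent convergent_def)
    qed
    then obtain l where l: "\<And>b. b \<in> B \<Longrightarrow> (\<lambda>n. representation B (y n) b) \<longlonglongrightarrow> l b"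
      by metis
    have "y n = (\<Sum>b\<in>B. representation B (y n) b *\<^sub>R b)" for n
      by (rule sum_representation_eq[OF indB y(1) B(1), symmetric]) simp
    moreover have "(\<lambda>n. \<Sum>b\<in>B. representation B (y n) b *\<^sub>R b) \<longlonglongrightarrow> (\<Sum>b\<in>B. l b *\<^sub>R b)"
      by (intro tendsto_intros l)
    ultimately have "y \<longlonglongrightarrow> (\<Sum>b\<in>B. l b *\<^sub>R b)"
      by presburger
    with lim have "- a = (\<Sum>b\<in>B. l b *\<^sub>R b)"
      using LIMSEQ_unique by blast
    then have "- a \<in> span B"
      by (simp add: span_sum span_scale span_base)
    then have "a \<in> span B"
      using span_neg by fastforce
    with anot show False by simp
  qed
  then show ?thesis using that by blast
qed

text \<open>Induction on \<open>B\<close>. The coordinate \<open>t\<close> along the new vector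
  \<open>a\<close> is controlled by the distance from \<open>a\<close> to \<open>span B\<close>,
  because dividing \<open>x\<close> by \<open>t\<close> gives \<open>a\<close> plus an element of
  \<open>span B\<close>. The other coordinates are those of \<open>x - t *\<^sub>R a\<close>, to
  which the induction hypothesis applies.\<close>

lemma representation_bound:
  fixes B :: "'a::real_normed_vector set"
  assumes "finite B" "independent B"
  shows "\<exists>C. \<forall>x\<in>span B. \<forall>b\<in>B. \<bar>representation B x b\<bar> \<le> C * norm x"
  using assms
proof (induction B rule: finite_induct)
  case empty
  then show ?case by simp
next
  case (insert a B)
  have indB: "independent B" and anot: "a \<notin> span B"
    using insert.prems insert.hyps by (metis independent_insert)+
  obtain C where C: "\<And>x b. x \<in> span B \<Longrightarrow> b \<in> B \<Longrightarrow> \<bar>representation B x b\<bar> \<le> C * norm x"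
    using insert.IH[OF indB] by blast
  obtain d where d: "d > 0" "\<And>y. y \<in> span B \<Longrightarrow> d \<le> norm (a + y)"
    using norm_add_span_lower_bound[OF insert.hyps(1) insert.prems insert.hyps(2) C] by blast
  \<comment> \<open>\<open>1 / d\<close> bounds the coordinate along \<open>a\<close>; the second
    summand comes from \<open>norm y \<le> norm x + \<bar>t\<bar> * norm a\<close> together with
    that bound on the coordinate.\<close>
  define K where "K = (1 / d) + \<bar>C\<bar> * (1 + norm a / d)"
  have "\<bar>representation (insert a B) x b\<bar> \<le> K * norm x"
    if x: "x \<in> span (insert a B)" and b: "b \<in> insert a B" for x b
  proof -
    define t where "t = representation (insert a B) x a"
    define y where "y = x - t *\<^sub>R a"
    have aS: "a \<in> span (insert a B)" by (simp add: span_base)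
    have yS: "y \<in> span B"
    proof -
      have "x = (\<Sum>b\<in>insert a B. representation (insert a B) x b *\<^sub>R b)"
        using sum_representation_eq[OF insert.prems x, of "insert a B"] insert.hyps by simp
      then have "y = (\<Sum>b\<in>B. representation (insert a B) x b *\<^sub>R b)"
        unfolding y_def t_def using insert.hyps by (simp add: algebra_simps)
      then show ?thesis by (simp add: span_sum span_scale span_base)
    qed
    have t: "\<bar>t\<bar> \<le> (1 / d) * norm x"
    proof (cases "t = 0")
      case False
      have "d \<le> norm (a + (1 / t) *\<^sub>R y)"
        by (intro d span_scale yS)
      also have "a + (1 / t) *\<^sub>R y = (1 / t) *\<^sub>R x"
        using False by (simp add: y_def algebra_simps)
      finally have "d \<le> norm x / \<bar>t\<bar>" by simp
      then show ?thesis using False d(1) by (simp add: field_simps)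
    qed (use d(1) in simp)
    show ?thesis
    proof (cases "b = a")
      case True
      have "(1 / d) * norm x \<le> K * norm x"
        unfolding K_def using d(1) by (intro mult_right_mono) auto
      with t True show ?thesis by (simp add: t_def)
    next
      case False
      with b have bB: "b \<in> B" by simp
      have "representation (insert a B) y b = representation (insert a B) x b - t * representation (insert a B) a b"
        unfolding y_def using x aS
        by (simp add: representation_diff[OF insert.prems] representation_scale[OF insert.prems] span_scale)
      also have "representation (insert a B) a b = 0"
        using False by (simp add: representation_basis[OF insert.prems])
      finally have "representation (insert a B) x b = representation (insert a B) y b" by simp
      also have "\<dots> = representation B y b"
        using representation_extend[OF insert.prems yS subset_insertI] by simp
      finally have "\<bar>representation (insert a B) x b\<bar> \<le> C * norm y"
        using C[OF yS bB] by simp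
      also have "\<dots> \<le> \<bar>C\<bar> * norm y" by (intro mult_right_mono) auto
      also have "\<dots> \<le> \<bar>C\<bar> * (norm x + \<bar>t\<bar> * norm a)"
        unfolding y_def by (intro mult_left_mono order_trans[OF norm_triangle_ineq4]) auto
      also have "\<dots> \<le> \<bar>C\<bar> * (norm x + ((1 / d) * norm x) * norm a)"
        by (intro mult_left_mono add_mono mult_right_mono t) auto
      also have "\<dots> = (\<bar>C\<bar> * (1 + norm a / d)) * norm x"
        by (simp add: field_simps)
      also have "\<dots> \<le> K * norm x"
        unfolding K_def using d(1) by (intro mult_right_mono) auto
      finally show ?thesis .
    qed
  qed
  then show ?case by blast
qed

text \<open>The later finite-dimensional arguments all go through these functionals.
  \<open>r b\<close> is bounded for every \<open>b\<close>, being zero outside the chosen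
  independent set, so no membership condition has to be carried along.\<close>

lemma fin_dim_coordinates:
  assumes "fin_dim TYPE('a::real_normed_vector)"
  obtains B :: "'a::real_normed_vector set" and r :: "'a \<Rightarrow> 'a \<Rightarrow> real"
  where "finite B" "\<And>b. bounded_linear (r b)" "\<And>x. (\<Sum>b\<in>B. r b x *\<^sub>R b) = x"
proof -
  obtain S :: "'a set" where S: "finite S" "span S = UNIV"
    using assms by (auto simp: fin_dim_def)
  obtain B where B: "B \<subseteq> S" "independent B" "S \<subseteq> span B"
    using maximal_independent_subset[of S] by blast
  then have spanB: "span B = UNIV"
    using S(2) span_minimal[OF B(3)] by auto
  have fin: "finite B" using B(1) S(1) finite_subset by blast
  obtain C where C: "\<And>x b. b \<in> B \<Longrightarrow> \<bar>representation B x b\<bar> \<le> C * norm x"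
    using representation_bound[OF fin B(2)] spanB by auto
  have lin: "linear (\<lambda>x. representation B x b)" for b
    using B(2) spanB by (auto intro!: linearI simp: representation_add representation_scale)
  have "bounded_linear (\<lambda>x. representation B x b)" for b
  proof (cases "b \<in> B")
    case True
    then show ?thesis using C[OF True] lin[of b]
      by (intro bounded_linear_intro[where K = C]) (simp_all add: linear_iff mult.commute)
  next
    case False
    then have "(\<lambda>x. representation B x b) = (\<lambda>x. 0)"
      using representation_ne_zero[of B _ b] by auto
    then show ?thesis by (simp add: bounded_linear_zero)
  qed
  moreover have "(\<Sum>b\<in>B. representation B x b *\<^sub>R b) = x" for x
    using sum_representation_eq[OF B(2) _ fin] spanB by auto
  ultimately show ?thesis using that[OF fin, of "\<lambda>b x. representation B x b"] by blast
qed

lemma fin_dim_bounded_linear: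
  fixes f :: "'a::real_normed_vector \<Rightarrow> 'b::real_normed_vector"
  assumes "fin_dim TYPE('a)" "linear f"
  shows "bounded_linear f"
proof -
  obtain B :: "'a set" and r where
    B: "finite B" "\<And>b. bounded_linear (r b)" "\<And>x. (\<Sum>b\<in>B. r b x *\<^sub>R b) = x"
    using fin_dim_coordinates[OF assms(1)] by metis
  have "f x = (\<Sum>b\<in>B. r b x *\<^sub>R f b)" for x
    by (subst B(3)[of x, symmetric]) (simp add: linear_sum[OF assms(2)] linear_scale[OF assms(2)])
  then have "f = (\<lambda>x. \<Sum>b\<in>B. r b x *\<^sub>R f b)" by blast
  moreover have "bounded_linear (\<lambda>x. \<Sum>b\<in>B. r b x *\<^sub>R f b)"
    by (intro bounded_linear_sum bounded_linear_scaleR_const B)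
  ultimately show ?thesis by simp
qed

lemma fin_dim_prod:
  assumes "fin_dim TYPE('a::real_normed_vector)" "fin_dim TYPE('b::real_normed_vector)"
  shows "fin_dim TYPE('a::real_normed_vector \<times> 'b::real_normed_vector)"
proof -
  obtain A :: "'a set" and r where
    A: "finite A" "\<And>b. bounded_linear (r b)" "\<And>x. (\<Sum>b\<in>A. r b x *\<^sub>R b) = x"
    using fin_dim_coordinates[OF assms(1)] by metis
  obtain B :: "'b set" and s where
    B: "finite B" "\<And>b. bounded_linear (s b)" "\<And>x. (\<Sum>b\<in>B. s b x *\<^sub>R b) = x"
    using fin_dim_coordinates[OF assms(2)] by metis
  define S where "S = (\<lambda>a. (a, 0 :: 'b)) ` A \<union> (\<lambda>b. (0 :: 'a, b)) ` B"
  have "z \<in> span S" for z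
  proof -
    obtain x y where z: "z = (x, y)" by (cases z)
    have "z = (\<Sum>b\<in>A. r b x *\<^sub>R (b, 0)) + (\<Sum>b\<in>B. s b y *\<^sub>R (0, b))"
      unfolding z using A(3)[of x] B(3)[of y] by (intro prod_eqI) (simp_all add: fst_sum snd_sum)
    also have "\<dots> \<in> span S"
      by (intro span_add span_sum span_scale span_base) (auto simp: S_def)
    finally show ?thesis .
  qed
  then show ?thesis unfolding fin_dim_def using A(1) B(1)
    by (intro exI[of _ S]) (auto simp: S_def)
qed

text \<open>With the functionals \<open>r b\<close> fixed, an operator is determined by its values
  \<open>f b\<close>. This yields a spanning set of the dual space and reduces smoothness of
  operator-valued maps to smoothness of values.\<close>

lemma Blinfun_expansion:
  fixes f :: "'a::real_normed_vector \<Rightarrow> 'b::real_normed_vector"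
  assumes "\<And>b. bounded_linear (r b)" "\<And>x. (\<Sum>b\<in>B. r b x *\<^sub>R b) = x" "bounded_linear f"
  shows "Blinfun f = (\<Sum>b\<in>B. Blinfun (\<lambda>x. r b x *\<^sub>R f b))"
proof (rule blinfun_eqI)
  fix x
  have "f x = (\<Sum>b\<in>B. r b x *\<^sub>R f b)"
    by (subst assms(2)[of x, symmetric])
      (simp add: linear_sum[OF bounded_linear.linear[OF assms(3)]] linear_scale[OF bounded_linear.linear[OF assms(3)]])
  then show "blinfun_apply (Blinfun f) x = blinfun_apply (\<Sum>b\<in>B. Blinfun (\<lambda>x. r b x *\<^sub>R f b)) x"
    by (simp add: bounded_linear_Blinfun_apply assms blinfun.sum_left bounded_linear_scaleR_const)
qed

lemma fin_dim_dual:
  assumes "fin_dim TYPE('a::real_normed_vector)"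
  shows "fin_dim TYPE('a::real_normed_vector \<Rightarrow>\<^sub>L real)"
proof -
  obtain B :: "'a set" and r where
    B: "finite B" "\<And>b. bounded_linear (r b)" "\<And>x. (\<Sum>b\<in>B. r b x *\<^sub>R b) = x"
    using fin_dim_coordinates[OF assms] by metis
  define S where "S = (\<lambda>b. Blinfun (r b)) ` B"
  have "p \<in> span S" for p :: "'a \<Rightarrow>\<^sub>L real"
  proof -
    have "p = Blinfun (blinfun_apply p)"
      by (simp add: blinfun_apply_inverse)
    also have "\<dots> = (\<Sum>b\<in>B. Blinfun (\<lambda>x. r b x *\<^sub>R p b))"
      by (rule Blinfun_expansion[OF B(2,3) blinfun.bounded_linear_right])
    also have "\<dots> = (\<Sum>b\<in>B. p b *\<^sub>R Blinfun (r b))"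
      by (intro sum.cong refl blinfun_eqI)
        (simp add: bounded_linear_Blinfun_apply bounded_linear_mult_const B scaleR_blinfun.rep_eq)
    also have "\<dots> \<in> span S"
      by (intro span_sum span_scale span_base) (auto simp: S_def)
    finally show ?thesis .
  qed
  then show ?thesis unfolding fin_dim_def using B(1)
    by (intro exI[of _ S]) (auto simp: S_def)
qed

section \<open>Calculus of smooth maps\<close>

text \<open>Openness of \<open>S\<close> turns agreement on \<open>S\<close> into agreement near
  each point, so the derivatives agree as well.\<close>

lemma Ck_on_cong:
  assumes "open S" "\<And>x. x \<in> S \<Longrightarrow> f x = g x" "Ck_on k S f"
  shows "Ck_on k S g"
  using assms(2,3)
proof (induction k arbitrary: f g)
  case 0
  then show ?case using continuous_on_cong by (metis Ck_on.simps(1))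
next
  case (Suc k)
  have der: "(g has_derivative frechet_derivative f (at x)) (at x)" if "x \<in> S" for x
    using Suc.prems that has_derivative_transform_within_open[OF _ assms(1) that, of f _ UNIV g]
    by (simp add: frechet_derivative_works)
  have "Ck_on k S (\<lambda>x. frechet_derivative g (at x) v)" for v
  proof (rule Suc.IH)
    show "frechet_derivative f (at x) v = frechet_derivative g (at x) v" if "x \<in> S" for x
      using frechet_derivative_at[OF der[OF that]] by simp
    show "Ck_on k S (\<lambda>x. frechet_derivative f (at x) v)" using Suc.prems(2) by simp
  qed
  then show ?case using der by (auto simp: differentiable_def)
qed

text \<open>The closure rules below compute derivatives by explicit formulas; this rule accepts such
  a formula in place of \<open>frechet_derivative\<close>.\<close>

lemma Ck_on_derivativeI:
  assumes "open S" "\<And>x. x \<in> S \<Longrightarrow> (f has_derivative f' x) (at x)" "\<And>v. Ck_on k S (\<lambda>x. f' x v)"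
  shows "Ck_on (Suc k) S f"
proof -
  have "Ck_on k S (\<lambda>x. frechet_derivative f (at x) v)" for v
  proof (rule Ck_on_cong[OF assms(1) _ assms(3)])
    show "f' x v = frechet_derivative f (at x) v" if "x \<in> S" for x
      using frechet_derivative_at[OF assms(2)[OF that]] by simp
  qed
  then show ?thesis using assms(2) by (auto simp: differentiable_def)
qed

lemma Ck_on_Suc_imp: "Ck_on (Suc k) S f \<Longrightarrow> Ck_on k S f"
proof (induction k arbitrary: f)
  case 0
  then show ?case
    by (auto intro!: continuous_at_imp_continuous_on differentiable_imp_continuous_within)
next
  case (Suc k)
  then show ?case by (metis Ck_on.simps(2))
qed

lemma Ck_on_subset: "Ck_on k S f \<Longrightarrow> T \<subseteq> S \<Longrightarrow> Ck_on k T f"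
  by (induction k arbitrary: f) (auto intro: continuous_on_subset)

lemma Ck_on_local:
  assumes "\<And>x. x \<in> S \<Longrightarrow> \<exists>T. open T \<and> x \<in> T \<and> Ck_on k T f"
  shows "Ck_on k S f"
  using assms
proof (induction k arbitrary: f)
  case 0
  then have "isCont f x" if "x \<in> S" for x
    by (metis Ck_on.simps(1) continuous_on_eq_continuous_at that)
  then show ?case by (simp add: continuous_at_imp_continuous_on)
next
  case (Suc k)
  have "Ck_on k S (\<lambda>x. frechet_derivative f (at x) v)" for v
    by (rule Suc.IH) (use Suc.prems in fastforce)
  then show ?case using Suc.prems by fastforce
qed

lemma Ck_on_const: "Ck_on k S (\<lambda>x. c)"
  by (induction k arbitrary: c) auto

lemma Ck_on_bounded_linear_compose:
  assumes "bounded_linear h" "open S" "Ck_on k S f"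
  shows "Ck_on k S (\<lambda>x. h (f x))"
  using assms(3)
proof (induction k arbitrary: f)
  case 0
  then show ?case by (simp add: bounded_linear.continuous_on[OF assms(1)])
next
  case (Suc k)
  have "((\<lambda>x. h (f x)) has_derivative (\<lambda>v. h (frechet_derivative f (at x) v))) (at x)" if "x \<in> S" for x
    using Suc.prems that
    by (intro bounded_linear.has_derivative[OF assms(1)]) (simp add: frechet_derivative_works)
  then show ?case
    by (rule Ck_on_derivativeI[OF assms(2)]) (use Suc in auto)
qed

lemma Ck_on_bounded_linear: "bounded_linear h \<Longrightarrow> Ck_on k S h"
proof (cases k)
  case 0
  assume "bounded_linear h"
  then show ?thesis using 0 by (simp add: linear_continuous_on)
next
  case (Suc n)
  assume h: "bounded_linear h"
  have "frechet_derivative h (at x) = h" for x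
    using h bounded_linear_imp_has_derivative frechet_derivative_at by metis
  then show ?thesis
    using Suc h by (auto simp: Ck_on_const bounded_linear_imp_differentiable)
qed

lemma Ck_on_add:
  assumes "open S" "Ck_on k S f" "Ck_on k S g"
  shows "Ck_on k S (\<lambda>x. f x + g x)"
  using assms(2,3)
proof (induction k arbitrary: f g)
  case 0
  then show ?case by (simp add: continuous_on_add)
next
  case (Suc k)
  have "((\<lambda>x. f x + g x) has_derivative
      (\<lambda>v. frechet_derivative f (at x) v + frechet_derivative g (at x) v)) (at x)" if "x \<in> S" for x
    using Suc.prems that by (intro has_derivative_add) (simp_all add: frechet_derivative_works)
  then show ?case
    by (rule Ck_on_derivativeI[OF assms(1)]) (use Suc in auto)
qed

lemma Ck_on_sum:
  assumes "open S" "\<And>i. i \<in> I \<Longrightarrow> Ck_on k S (f i)"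
  shows "Ck_on k S (\<lambda>x. \<Sum>i\<in>I. f i x)"
  using assms(2)
  by (induction I rule: infinite_finite_induct) (auto simp: Ck_on_const intro: Ck_on_add[OF assms(1)])

lemma Ck_on_bilinear:
  assumes "bounded_bilinear m" "open S" "Ck_on k S f" "Ck_on k S g"
  shows "Ck_on k S (\<lambda>x. m (f x) (g x))"
  using assms(3,4)
proof (induction k arbitrary: f g)
  case 0
  then show ?case by (simp add: bounded_bilinear.continuous_on[OF assms(1)])
next
  case (Suc k)
  have "((\<lambda>x. m (f x) (g x)) has_derivative
      (\<lambda>v. m (f x) (frechet_derivative g (at x) v) + m (frechet_derivative f (at x) v) (g x))) (at x)" 
    if "x \<in> S" for x
    using Suc.prems that
    by (intro bounded_bilinear.FDERIV[OF assms(1)]) (simp_all add: frechet_derivative_works)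
  then show ?case
    by (rule Ck_on_derivativeI[OF assms(2)])
      (use Suc.prems Suc.prems[THEN Ck_on_Suc_imp] in \<open>auto intro!: Ck_on_add[OF assms(2)] Suc.IH\<close>)
qed

lemma Ck_on_Pair:
  assumes "open S" "Ck_on k S f" "Ck_on k S g"
  shows "Ck_on k S (\<lambda>x. (f x, g x))"
  using assms(2,3)
proof (induction k arbitrary: f g)
  case 0
  then show ?case by (simp add: continuous_on_Pair)
next
  case (Suc k)
  have "((\<lambda>x. (f x, g x)) has_derivative
      (\<lambda>v. (frechet_derivative f (at x) v, frechet_derivative g (at x) v))) (at x)" if "x \<in> S" for x
    using Suc.prems that by (intro has_derivative_Pair) (simp_all add: frechet_derivative_works)
  then show ?case
    by (rule Ck_on_derivativeI[OF assms(1)]) (use Suc in auto)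
qed

text \<open>\<open>Ck_on\<close> controls derivatives in fixed directions only, whereas the chain
  rule differentiates \<open>g\<close> in the moving direction given by the derivative of
  \<open>f\<close>. Expanding that direction in coordinates leaves derivatives of \<open>g\<close>
  in the fixed directions \<open>b\<close>, multiplied by scalar coefficients; this is where finite
  dimension of the middle space enters.\<close>

lemma Ck_on_compose:
  fixes f :: "'a::real_normed_vector \<Rightarrow> 'b::real_normed_vector" and g :: "'b \<Rightarrow> 'c::real_normed_vector"
  assumes "fin_dim TYPE('b)" "open S" "open T" "f ` S \<subseteq> T" "Ck_on k S f" "Ck_on k T g"
  shows "Ck_on k S (\<lambda>x. g (f x))"
  using assms(5,6)
proof (induction k arbitrary: g)
  case 0
  then show ?case using assms(4)
    by (auto intro!: continuous_on_compose2[of T g S f])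
next
  case (Suc k)
  obtain B :: "'b set" and r where
    B: "finite B" "\<And>b. bounded_linear (r b)" "\<And>x. (\<Sum>b\<in>B. r b x *\<^sub>R b) = x"
    using fin_dim_coordinates[OF assms(1)] by metis
  have der: "((\<lambda>x. g (f x)) has_derivative
      (\<lambda>v. \<Sum>b\<in>B. r b (frechet_derivative f (at x) v) *\<^sub>R frechet_derivative g (at (f x)) b)) (at x)"
    if x: "x \<in> S" for x
  proof -
    have g: "(g has_derivative frechet_derivative g (at (f x))) (at (f x))"
      using Suc.prems x assms(4) by (auto simp flip: frechet_derivative_works)
    have f: "(f has_derivative frechet_derivative f (at x)) (at x)"
      using Suc.prems x by (auto simp flip: frechet_derivative_works)
    have lin: "linear (frechet_derivative g (at (f x)))"
      using g by (rule has_derivative_linear)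
    have expand: "frechet_derivative g (at (f x)) w = (\<Sum>b\<in>B. r b w *\<^sub>R frechet_derivative g (at (f x)) b)" for w
      by (subst B(3)[of w, symmetric]) (simp add: linear_sum[OF lin] linear_scale[OF lin])
    show ?thesis
      by (rule has_derivative_eq_rhs[OF has_derivative_compose[OF f g]]) (rule ext, rule expand)
  qed
  have "Ck_on k S (\<lambda>x. \<Sum>b\<in>B. r b (frechet_derivative f (at x) v) *\<^sub>R frechet_derivative g (at (f x)) b)" for v
    using Suc.prems Ck_on_Suc_imp[OF Suc.prems(1)]
    by (intro Ck_on_sum Ck_on_bilinear[OF bounded_bilinear_scaleR]
        Ck_on_bounded_linear_compose[OF B(2)] Suc.IH assms(2)) auto
  with der show ?case by (rule Ck_on_derivativeI[OF assms(2)])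
qed

section \<open>Closure rules for smooth maps\<close>

lemma smooth_on_subset: "smooth_on S f \<Longrightarrow> T \<subseteq> S \<Longrightarrow> smooth_on T f"
  unfolding smooth_on_def using Ck_on_subset by blast

lemma smooth_on_cong: "open S \<Longrightarrow> (\<And>x. x \<in> S \<Longrightarrow> f x = g x) \<Longrightarrow> smooth_on S f \<Longrightarrow> smooth_on S g"
  unfolding smooth_on_def using Ck_on_cong by blast

lemma smooth_on_local:
  assumes "\<And>x. x \<in> S \<Longrightarrow> \<exists>T. open T \<and> x \<in> T \<and> smooth_on T f"
  shows "smooth_on S f"
  unfolding smooth_on_def using assms Ck_on_local unfolding smooth_on_def by metis

lemma smooth_on_const: "smooth_on S (\<lambda>x. c)"
  unfolding smooth_on_def using Ck_on_const by blast

lemma smooth_on_bounded_linear: "bounded_linear h \<Longrightarrow> smooth_on S h"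
  unfolding smooth_on_def using Ck_on_bounded_linear by blast

lemma smooth_on_bounded_linear_compose:
  "bounded_linear h \<Longrightarrow> open S \<Longrightarrow> smooth_on S f \<Longrightarrow> smooth_on S (\<lambda>x. h (f x))"
  unfolding smooth_on_def using Ck_on_bounded_linear_compose by blast

lemma smooth_on_sum:
  "open S \<Longrightarrow> (\<And>i. i \<in> I \<Longrightarrow> smooth_on S (f i)) \<Longrightarrow> smooth_on S (\<lambda>x. \<Sum>i\<in>I. f i x)"
  unfolding smooth_on_def using Ck_on_sum[of S I] by metis

lemma smooth_on_bilinear:
  "bounded_bilinear m \<Longrightarrow> open S \<Longrightarrow> smooth_on S f \<Longrightarrow> smooth_on S g \<Longrightarrow> smooth_on S (\<lambda>x. m (f x) (g x))"
  unfolding smooth_on_def using Ck_on_bilinear by blast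

lemma smooth_on_Pair:
  "open S \<Longrightarrow> smooth_on S f \<Longrightarrow> smooth_on S g \<Longrightarrow> smooth_on S (\<lambda>x. (f x, g x))"
  unfolding smooth_on_def using Ck_on_Pair by blast

lemma smooth_on_compose:
  fixes f :: "'a::real_normed_vector \<Rightarrow> 'b::real_normed_vector" and g :: "'b \<Rightarrow> 'c::real_normed_vector"
  assumes "fin_dim TYPE('b)" "open S" "open T" "f ` S \<subseteq> T" "smooth_on S f" "smooth_on T g"
  shows "smooth_on S (\<lambda>x. g (f x))"
  using assms Ck_on_compose unfolding smooth_on_def by blast

lemma smooth_on_has_derivative:
  "smooth_on S f \<Longrightarrow> x \<in> S \<Longrightarrow> (f has_derivative frechet_derivative f (at x)) (at x)"
  unfolding smooth_on_def by (metis Ck_on.simps(2) frechet_derivative_works)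

lemma smooth_on_frechet_derivative:
  "smooth_on S f \<Longrightarrow> smooth_on S (\<lambda>x. frechet_derivative f (at x) v)"
  unfolding smooth_on_def by (metis Ck_on.simps(2))

lemma smooth_on_continuous_on: "smooth_on S f \<Longrightarrow> continuous_on S f"
  unfolding smooth_on_def by (metis Ck_on.simps(1))

text \<open>The functional is a sum of fixed functionals with the smooth coefficients
  \<open>F x b\<close>. Covector components are shown smooth in this way, from their values on
  single vectors.\<close>

lemma smooth_on_Blinfun:
  fixes F :: "'x::real_normed_vector \<Rightarrow> 'a::real_normed_vector \<Rightarrow> real"
  assumes "fin_dim TYPE('a)" "open S" "\<And>x. x \<in> S \<Longrightarrow> linear (F x)" "\<And>e. smooth_on S (\<lambda>x. F x e)"
  shows "smooth_on S (\<lambda>x. Blinfun (F x))"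
proof -
  obtain B :: "'a set" and r where
    B: "finite B" "\<And>b. bounded_linear (r b)" "\<And>x. (\<Sum>b\<in>B. r b x *\<^sub>R b) = x"
    using fin_dim_coordinates[OF assms(1)] by metis
  have "Blinfun (F x) = (\<Sum>b\<in>B. F x b *\<^sub>R Blinfun (r b))" if "x \<in> S" for x
  proof -
    have "Blinfun (F x) = (\<Sum>b\<in>B. Blinfun (\<lambda>y. r b y *\<^sub>R F x b))"
      using assms that by (intro Blinfun_expansion[OF B(2,3)] fin_dim_bounded_linear) auto
    also have "\<dots> = (\<Sum>b\<in>B. F x b *\<^sub>R Blinfun (r b))"
      by (intro sum.cong refl blinfun_eqI)
        (simp add: bounded_linear_Blinfun_apply bounded_linear_mult_const B scaleR_blinfun.rep_eq)
    finally show ?thesis .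
  qed
  moreover have "smooth_on S (\<lambda>x. \<Sum>b\<in>B. F x b *\<^sub>R Blinfun (r b))"
    by (intro smooth_on_sum smooth_on_bilinear[OF bounded_bilinear_scaleR] assms smooth_on_const)
  ultimately show ?thesis by (metis (no_types, lifting) assms(2) smooth_on_cong)
qed

section \<open>Symmetry of second derivatives\<close>

text \<open>The mean value theorem along \<open>v\<close> writes the second difference as
  \<open>t\<close> times a difference of values of \<open>F y v\<close>. Differentiability of
  \<open>F y v\<close> at the single point \<open>x\<close> then replaces this difference by
  \<open>t * A w\<close>, with an error proportional to \<open>t\<close>.\<close>

lemma mixed_difference_estimate:
  fixes f :: "'a::real_normed_vector \<Rightarrow> real"
  assumes S: "open S" "x \<in> S" and f: "\<forall>y\<in>S. (f has_derivative F y) (at y)"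
    and A: "((\<lambda>y. F y v) has_derivative A) (at x)" and "e > 0"
  shows "\<exists>d>0. \<forall>t. 0 < t \<longrightarrow> t < d \<longrightarrow>
    \<bar>f (x + t *\<^sub>R v + t *\<^sub>R w) - f (x + t *\<^sub>R v) - f (x + t *\<^sub>R w) + f x - t\<^sup>2 * A w\<bar> \<le> e * t\<^sup>2"
proof -
  \<comment> \<open>The linear approximation is used at two points, at distance at most
    \<open>t * (norm v + norm w)\<close> and \<open>t * norm v\<close> from \<open>x\<close>. These
    bounds add up to \<open>t * (K - 1)\<close>; the extra 1 makes \<open>K\<close>
    positive.\<close>
  define K where "K = 2 * norm v + norm w + 1"
  have K: "K > 0" unfolding K_def using norm_ge_zero[of v] norm_ge_zero[of w] by linarith
  obtain r where r: "r > 0" "ball x r \<subseteq> S"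
    using S open_contains_ball by blast
  obtain \<delta> where \<delta>: "\<delta> > 0"
    "\<And>y. norm (y - x) < \<delta> \<Longrightarrow> norm (F y v - F x v - A (y - x)) \<le> (e / K) * norm (y - x)"
    using A divide_pos_pos[OF \<open>e > 0\<close> K] unfolding has_derivative_at_alt by blast
  have linA: "linear A" using A by (rule has_derivative_linear)
  define d where "d = min \<delta> r / K"
  have "d > 0" unfolding d_def using K r \<delta> by simp
  moreover have "\<bar>f (x + t *\<^sub>R v + t *\<^sub>R w) - f (x + t *\<^sub>R v) - f (x + t *\<^sub>R w) + f x - t\<^sup>2 * A w\<bar> \<le> e * t\<^sup>2"
    if t: "0 < t" "t < d" for t
  proof -
    have tK: "t * K < min \<delta> r" using t K by (simp add: d_def pos_less_divide_eq)
    have small: "norm (s *\<^sub>R v + u *\<^sub>R w) \<le> t * (norm v + norm w)"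
      if "0 \<le> s" "s \<le> t" "0 \<le> u" "u \<le> t" for s u
    proof -
      have "norm (s *\<^sub>R v + u *\<^sub>R w) \<le> s * norm v + u * norm w"
        using that norm_triangle_ineq[of "s *\<^sub>R v" "u *\<^sub>R w"] by simp
      also have "\<dots> \<le> t * norm v + t * norm w"
        using that by (intro add_mono mult_right_mono) auto
      finally show ?thesis by (simp add: algebra_simps)
    qed
    have "t * (norm v + norm w) \<le> t * K"
      using t by (intro mult_left_mono) (auto simp: K_def)
    then have near: "norm (s *\<^sub>R v + u *\<^sub>R w) < min \<delta> r"
      if "0 \<le> s" "s \<le> t" "0 \<le> u" "u \<le> t" for s u
      using small[OF that] tK by linarith
    have inS: "x + s *\<^sub>R v + u *\<^sub>R w \<in> S" if "0 \<le> s" "s \<le> t" "0 \<le> u" "u \<le> t" for s u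
    proof -
      have "dist x (x + s *\<^sub>R v + u *\<^sub>R w) = norm (s *\<^sub>R v + u *\<^sub>R w)"
        using norm_minus_cancel[of "s *\<^sub>R v + u *\<^sub>R w"] by (simp add: dist_norm)
      then show ?thesis using near[OF that] r(2) by auto
    qed
    \<comment> \<open>The second difference is \<open>h t - h 0\<close>, an increment of a function
      of one real variable.\<close>
    define h where "h s = f (x + s *\<^sub>R v + t *\<^sub>R w) - f (x + s *\<^sub>R v)" for s
    define h' where "h' s = F (x + s *\<^sub>R v + t *\<^sub>R w) v - F (x + s *\<^sub>R v) v" for s
    have der: "(h has_real_derivative h' s) (at s)" if s: "0 \<le> s" "s \<le> t" for s
    proof -
      have lin: "linear (F (x + s *\<^sub>R v + t *\<^sub>R w))" "linear (F (x + s *\<^sub>R v))"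
        using inS[OF s, of t] inS[OF s, of 0] t f has_derivative_linear by auto
      have "((\<lambda>s. f (x + s *\<^sub>R v + t *\<^sub>R w)) has_derivative (\<lambda>y. F (x + s *\<^sub>R v + t *\<^sub>R w) (y *\<^sub>R v))) (at s)"
        using inS[OF s, of t] t
        by (intro has_derivative_compose[OF _ f[rule_format]]) (auto intro!: derivative_eq_intros)
      moreover have "((\<lambda>s. f (x + s *\<^sub>R v)) has_derivative (\<lambda>y. F (x + s *\<^sub>R v) (y *\<^sub>R v))) (at s)"
        using inS[OF s, of 0] t
        by (intro has_derivative_compose[OF _ f[rule_format]]) (auto intro!: derivative_eq_intros)
      ultimately have "(h has_derivative (\<lambda>y. F (x + s *\<^sub>R v + t *\<^sub>R w) (y *\<^sub>R v) - F (x + s *\<^sub>R v) (y *\<^sub>R v))) (at s)"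
        unfolding h_def by (rule has_derivative_diff)
      then show ?thesis
        unfolding has_field_derivative_def h'_def
        by (rule has_derivative_eq_rhs) (simp add: fun_eq_iff linear_scale[OF lin(1)] linear_scale[OF lin(2)] right_diff_distrib mult.commute)
    qed
    obtain z where z: "0 < z" "z < t" "h t - h 0 = (t - 0) * h' z"
      using MVT2[of 0 t h h'] t der by auto
    have e1: "\<bar>F (x + s *\<^sub>R v + u *\<^sub>R w) v - F x v - A (s *\<^sub>R v + u *\<^sub>R w)\<bar> \<le> (e / K) * norm (s *\<^sub>R v + u *\<^sub>R w)"
      if "0 \<le> s" "s \<le> t" "0 \<le> u" "u \<le> t" for s u
      using \<delta>(2)[of "x + s *\<^sub>R v + u *\<^sub>R w"] near[OF that] by (simp add: add.assoc)
    have "\<bar>h' z - t * A w\<bar> \<le> (e / K) * norm (z *\<^sub>R v + t *\<^sub>R w) + (e / K) * norm (z *\<^sub>R v)"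
      using e1[of z t] e1[of z 0] z t
      by (simp add: h'_def linear_add[OF linA] linear_scale[OF linA])
    also have "\<dots> \<le> (e / K) * (t * (norm v + norm w)) + (e / K) * (t * norm v)"
      using small[of z t] z t K \<open>e > 0\<close> by (intro add_mono mult_left_mono) (auto intro: mult_right_mono)
    also have "\<dots> = (e / K) * (t * (K - 1))"
      unfolding distrib_left[symmetric] by (simp add: K_def algebra_simps)
    also have "\<dots> \<le> (e / K) * (t * K)"
      using t K \<open>e > 0\<close> by (intro mult_left_mono) auto
    also have "\<dots> = e * t" using K by simp
    finally have "\<bar>h' z - t * A w\<bar> \<le> e * t" .
    then have "t * \<bar>h' z - t * A w\<bar> \<le> t * (e * t)"
      using t by (intro mult_left_mono) auto
    moreover have "t * \<bar>h' z - t * A w\<bar> = \<bar>t * h' z - t\<^sup>2 * A w\<bar>"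
    proof -
      have "t * h' z - t\<^sup>2 * A w = t * (h' z - t * A w)"
        by (simp add: power2_eq_square algebra_simps)
      then show ?thesis using t by (simp add: abs_mult)
    qed
    moreover have "f (x + t *\<^sub>R v + t *\<^sub>R w) - f (x + t *\<^sub>R v) - f (x + t *\<^sub>R w) + f x = t * h' z"
      using z(3) by (simp add: h_def)
    ultimately show ?thesis by (simp add: power2_eq_square mult_ac)
  qed
  ultimately show ?thesis by blast
qed

text \<open>The second difference is unchanged when \<open>v\<close> and \<open>w\<close> are
  exchanged, and after division by \<open>t\<^sup>2\<close> it tends to both sides.\<close>

lemma second_derivative_symmetric:
  fixes f :: "'a::real_normed_vector \<Rightarrow> real"
  assumes S: "open S" "x \<in> S" and f: "\<forall>y\<in>S. (f has_derivative F y) (at y)"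
    and A: "((\<lambda>y. F y v) has_derivative A) (at x)" and B: "((\<lambda>y. F y w) has_derivative B) (at x)"
  shows "A w = B v"
proof -
  have small: "\<bar>A w - B v\<bar> \<le> e" if "e > 0" for e
  proof -
    have e2: "e / 2 > 0" using that by simp
    obtain d1 where d1: "d1 > 0" "\<forall>t. 0 < t \<longrightarrow> t < d1 \<longrightarrow>
      \<bar>f (x + t *\<^sub>R v + t *\<^sub>R w) - f (x + t *\<^sub>R v) - f (x + t *\<^sub>R w) + f x - t\<^sup>2 * A w\<bar> \<le> (e/2) * t\<^sup>2"
      using mixed_difference_estimate[OF S f A e2, where w = w] by blast
    obtain d2 where d2: "d2 > 0" "\<forall>t. 0 < t \<longrightarrow> t < d2 \<longrightarrow>
      \<bar>f (x + t *\<^sub>R w + t *\<^sub>R v) - f (x + t *\<^sub>R w) - f (x + t *\<^sub>R v) + f x - t\<^sup>2 * B v\<bar> \<le> (e/2) * t\<^sup>2"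
      using mixed_difference_estimate[OF S f B e2, where w = v] by blast
    define t where "t = min d1 d2 / 2"
    have t: "0 < t" "t < d1" "t < d2" using d1(1) d2(1) by (auto simp: t_def)
    have swap: "x + t *\<^sub>R w + t *\<^sub>R v = x + t *\<^sub>R v + t *\<^sub>R w" by (simp add: algebra_simps)
    have "\<bar>a - b\<bar> \<le> c + c" if "\<bar>z - a\<bar> \<le> c" "\<bar>z - b\<bar> \<le> c" for a b c z :: real
      using that abs_triangle_ineq4[of "z - b" "z - a"] by simp
    moreover have "y - f (x + t *\<^sub>R w) - f (x + t *\<^sub>R v) = y - f (x + t *\<^sub>R v) - f (x + t *\<^sub>R w)" for y
      by simp
    ultimately have "\<bar>t\<^sup>2 * A w - t\<^sup>2 * B v\<bar> \<le> (e/2) * t\<^sup>2 + (e/2) * t\<^sup>2"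
      using d1(2)[rule_format, OF t(1,2)] d2(2)[rule_format, OF t(1,3), unfolded swap] by metis
    then have "\<bar>t\<^sup>2 * A w - t\<^sup>2 * B v\<bar> \<le> e * t\<^sup>2" by simp
    moreover have "\<bar>t\<^sup>2 * A w - t\<^sup>2 * B v\<bar> = \<bar>A w - B v\<bar> * t\<^sup>2"
    proof -
      have "t\<^sup>2 * A w - t\<^sup>2 * B v = (A w - B v) * t\<^sup>2" by (simp add: algebra_simps)
      then show ?thesis by (simp add: abs_mult)
    qed
    ultimately show ?thesis using t(1) by simp
  qed
  have "\<bar>A w - B v\<bar> \<le> 0"
  proof (rule field_le_epsilon)
    show "\<bar>A w - B v\<bar> \<le> 0 + e" if "0 < e" for e
      using small[OF that] by simp
  qed
  then show ?thesis by simp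
qed

text \<open>The coordinate form of \<open>d (f\<^sup>* P) = f\<^sup>* (d P)\<close>: the second derivatives of \<open>f\<close> cancel.\<close>

lemma pullback_derivative_antisym:
  fixes f :: "'a::real_normed_vector \<Rightarrow> 'b::real_normed_vector"
    and P :: "'a \<Rightarrow> 'b \<Rightarrow>\<^sub>L real"
  assumes S: "open S" "x \<in> S" and f: "smooth_on S f" and P: "(P has_derivative P') (at x)"
  shows "frechet_derivative (\<lambda>y. P y (frechet_derivative f (at y) w)) (at x) v
       - frechet_derivative (\<lambda>y. P y (frechet_derivative f (at y) v)) (at x) w
       = P' v (frechet_derivative f (at x) w) - P' w (frechet_derivative f (at x) v)"
proof -
  define F where "F y = frechet_derivative f (at y)" for y
  define H where "H w = frechet_derivative (\<lambda>y. F y w) (at x)" for w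
  have F: "(f has_derivative F y) (at y)" if "y \<in> S" for y
    unfolding F_def by (rule smooth_on_has_derivative[OF f that])
  have H: "((\<lambda>y. F y w) has_derivative H w) (at x)" for w
    unfolding H_def F_def by (rule smooth_on_has_derivative[OF smooth_on_frechet_derivative[OF f] S(2)])
  have "((\<lambda>y. P y (F y w)) has_derivative (\<lambda>v. P x (H w v) + P' v (F x w))) (at x)" for w
    by (rule bounded_bilinear.FDERIV[OF bounded_bilinear_blinfun_apply P H])
  then have D: "frechet_derivative (\<lambda>y. P y (F y w)) (at x) = (\<lambda>v. P x (H w v) + P' v (F x w))" for w
    by (rule frechet_derivative_at[symmetric])
  \<comment> \<open>The covector \<open>P x\<close> is frozen, so that symmetry is applied to the
    real-valued function \<open>P x (f y)\<close> of \<open>y\<close>.\<close>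
  have "P x (H v w) = P x (H w v)"
  proof (rule second_derivative_symmetric[OF S])
    show "\<forall>y\<in>S. ((\<lambda>y. P x (f y)) has_derivative (\<lambda>v. P x (F y v))) (at y)"
      using F bounded_linear.has_derivative[OF blinfun.bounded_linear_right] by blast
    show "((\<lambda>y. P x (F y v)) has_derivative (\<lambda>w. P x (H v w))) (at x)"
      using bounded_linear.has_derivative[OF blinfun.bounded_linear_right H] .
    show "((\<lambda>y. P x (F y w)) has_derivative (\<lambda>v. P x (H w v))) (at x)"
      using bounded_linear.has_derivative[OF blinfun.bounded_linear_right H] .
  qed
  then show ?thesis unfolding F_def[symmetric] D by simp
qed

section \<open>Atlases\<close>

text \<open>The part of \<open>smooth_manifold\<close> without the global topological axioms, so that it can be
  verified for the cotangent bundle by computing in charts alone.\<close>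

definition smooth_atlas :: "('q, 'e::real_normed_vector) atlas \<Rightarrow> bool" where
  "smooth_atlas M \<longleftrightarrow> fin_dim TYPE('e) \<and>
     (\<forall>c\<in>M. inj_on (snd c) (dom_chart c) \<and> open (snd c ` dom_chart c)) \<and>
     (\<forall>c\<in>M. \<forall>d\<in>M. open (snd c ` (dom_chart c \<inter> dom_chart d)) \<and>
        smooth_on (snd c ` (dom_chart c \<inter> dom_chart d)) (snd d \<circ> chart_inv c))"

lemma smooth_manifold_imp_smooth_atlas: "smooth_manifold M \<Longrightarrow> smooth_atlas M"
  by (simp add: smooth_manifold_def smooth_atlas_def fin_dim_def)

lemma dom_chart_points: "c \<in> M \<Longrightarrow> q \<in> dom_chart c \<Longrightarrow> q \<in> points M"
  by (auto simp: points_def)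

lemma pointsE:
  assumes "q \<in> points M"
  obtains c where "c \<in> M" "q \<in> dom_chart c"
  using assms by (auto simp: points_def)

context
  fixes M :: "('q, 'e::real_normed_vector) atlas"
  assumes M: "smooth_atlas M"
begin

lemma smooth_atlas_fin_dim: "fin_dim TYPE('e)"
  using M by (simp add: smooth_atlas_def)

lemma chart_inv_chart: "c \<in> M \<Longrightarrow> q \<in> dom_chart c \<Longrightarrow> chart_inv c (snd c q) = q"
  using M by (simp add: smooth_atlas_def)

lemma chart_imageD:
  assumes "c \<in> M" "q \<in> dom_chart c" "snd c q \<in> U" "(f \<circ> chart_inv c) ` U \<subseteq> V"
  shows "f q \<in> V"
proof -
  have "(f \<circ> chart_inv c) (snd c q) \<in> V" using assms(3,4) by blast
  then show ?thesis by (simp add: chart_inv_chart[OF assms(1,2)])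
qed

lemma chart_inj: "c \<in> M \<Longrightarrow> inj_on (snd c) (dom_chart c)"
  using M by (simp add: smooth_atlas_def)

lemma open_chart_image: "c \<in> M \<Longrightarrow> open (snd c ` dom_chart c)"
  using M by (simp add: smooth_atlas_def)

lemma open_chart_overlap: "c \<in> M \<Longrightarrow> d \<in> M \<Longrightarrow> open (snd c ` (dom_chart c \<inter> dom_chart d))"
  using M by (simp add: smooth_atlas_def)

lemma smooth_on_transition:
  "c \<in> M \<Longrightarrow> d \<in> M \<Longrightarrow> smooth_on (snd c ` (dom_chart c \<inter> dom_chart d)) (snd d \<circ> chart_inv c)"
  using M by (simp add: smooth_atlas_def)

text \<open>\<open>topology\<close> is characterised only for predicates satisfying
  \<open>istopology\<close>. Closure under intersections rests on injectivity of the charts, which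
  makes images commute with intersections.\<close>

lemma openin_atlas_topology:
  "openin (atlas_topology M) U \<longleftrightarrow> U \<subseteq> points M \<and> (\<forall>c\<in>M. open (snd c ` (U \<inter> dom_chart c)))"
proof -
  have "istopology (\<lambda>U. U \<subseteq> points M \<and> (\<forall>c\<in>M. open (snd c ` (U \<inter> dom_chart c))))"
    unfolding istopology_def
  proof (intro conjI allI impI)
    fix S T assume S: "S \<subseteq> points M \<and> (\<forall>c\<in>M. open (snd c ` (S \<inter> dom_chart c)))"
      and T: "T \<subseteq> points M \<and> (\<forall>c\<in>M. open (snd c ` (T \<inter> dom_chart c)))"
    show "S \<inter> T \<subseteq> points M" using S by blast
    have "snd c ` (S \<inter> T \<inter> dom_chart c) = snd c ` (S \<inter> dom_chart c) \<inter> snd c ` (T \<inter> dom_chart c)"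
      if "c \<in> M" for c
      using inj_on_image_Int[OF chart_inj[OF that], of "S \<inter> dom_chart c" "T \<inter> dom_chart c"]
      by (simp add: Int_ac)
    then show "\<forall>c\<in>M. open (snd c ` (S \<inter> T \<inter> dom_chart c))"
      using S T by auto
  next
    fix K assume K: "\<forall>S\<in>K. S \<subseteq> points M \<and> (\<forall>c\<in>M. open (snd c ` (S \<inter> dom_chart c)))"
    show "\<Union>K \<subseteq> points M" using K by blast
    have "snd c ` (\<Union>K \<inter> dom_chart c) = (\<Union>S\<in>K. snd c ` (S \<inter> dom_chart c))" for c :: "('q, 'e) chart"
      by blast
    then show "\<forall>c\<in>M. open (snd c ` (\<Union>K \<inter> dom_chart c))" using K
      by (metis (no_types, lifting) open_UN)
  qed
  then show ?thesis unfolding atlas_topology_def by simp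
qed

lemma openin_dom_chart: "c \<in> M \<Longrightarrow> openin (atlas_topology M) (dom_chart c)"
  unfolding openin_atlas_topology
  using open_chart_overlap by (auto simp: points_def Int_commute)

lemma topspace_atlas_topology: "topspace (atlas_topology M) = points M"
proof
  show "topspace (atlas_topology M) \<subseteq> points M"
    using openin_topspace[of "atlas_topology M"] unfolding openin_atlas_topology by blast
  show "points M \<subseteq> topspace (atlas_topology M)"
    using openin_dom_chart openin_subset by (fastforce simp: points_def)
qed

text \<open>Read in another chart \<open>d\<close>, the set is the preimage of \<open>W\<close>
  under a transition map, which is continuous on an open set.\<close>

lemma openin_chart_preimage:
  assumes c: "c \<in> M" and W: "open W"
  shows "openin (atlas_topology M) {q \<in> dom_chart c. snd c q \<in> W}"
  unfolding openin_atlas_topology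
proof (intro conjI ballI)
  show "{q \<in> dom_chart c. snd c q \<in> W} \<subseteq> points M"
    using c by (auto simp: points_def)
  fix d assume d: "d \<in> M"
  have "snd d ` ({q \<in> dom_chart c. snd c q \<in> W} \<inter> dom_chart d)
      = snd d ` (dom_chart d \<inter> dom_chart c) \<inter> (snd c \<circ> chart_inv d) -` W"
    using d by (auto simp: chart_inv_chart)
  also have "open \<dots>"
    by (intro continuous_open_preimage smooth_on_continuous_on smooth_on_transition open_chart_overlap c d W)
  finally show "open (snd d ` ({q \<in> dom_chart c. snd c q \<in> W} \<inter> dom_chart d))" .
qed

end

text \<open>\<open>smooth_map\<close> asks for continuity and for every pair of charts. One pair
  near each point settles both: transition maps carry smoothness to the other pairs, and continuity
  follows because the image of \<open>U\<close> stays inside \<open>dom_chart d\<close>.\<close>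

lemma smooth_mapI:
  assumes M: "smooth_atlas M" and N: "smooth_atlas N"
    and loc: "\<And>p. p \<in> points M \<Longrightarrow> \<exists>c\<in>M. \<exists>d\<in>N. \<exists>U. p \<in> dom_chart c \<and> open U \<and> snd c p \<in> U \<and>
      U \<subseteq> snd c ` dom_chart c \<and> (f \<circ> chart_inv c) ` U \<subseteq> dom_chart d \<and>
      smooth_on U (snd d \<circ> f \<circ> chart_inv c)"
  shows "smooth_map M N f"
  unfolding smooth_map_def
proof (intro conjI ballI)
  have maps: "f p \<in> points N" if p: "p \<in> points M" for p
  proof -
    obtain c d U where "c \<in> M" "d \<in> N" "p \<in> dom_chart c" "snd c p \<in> U" "(f \<circ> chart_inv c) ` U \<subseteq> dom_chart d"
      using loc[OF p] by blast
    then show ?thesis using chart_imageD[OF M] dom_chart_points by metis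
  qed
  show "continuous_map (atlas_topology M) (atlas_topology N) f"
    unfolding continuous_map topspace_atlas_topology[OF M] topspace_atlas_topology[OF N]
  proof (intro conjI allI impI)
    show "f ` points M \<subseteq> points N" using maps by blast
    fix V assume V: "openin (atlas_topology N) V"
    show "openin (atlas_topology M) {p \<in> points M. f p \<in> V}"
    proof (subst openin_subopen, intro ballI)
      fix p assume p: "p \<in> {p \<in> points M. f p \<in> V}"
      then obtain c d U where c: "c \<in> M" and d: "d \<in> N" and pc: "p \<in> dom_chart c" and U: "open U" "snd c p \<in> U"
        "U \<subseteq> snd c ` dom_chart c" "(f \<circ> chart_inv c) ` U \<subseteq> dom_chart d" "smooth_on U (snd d \<circ> f \<circ> chart_inv c)"
        using loc[of p] by blast
      \<comment> \<open>The coordinates of the points near \<open>p\<close> that \<open>f\<close>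
        sends into \<open>V\<close>.\<close>
      define W where "W = U \<inter> (snd d \<circ> f \<circ> chart_inv c) -` (snd d ` (V \<inter> dom_chart d))"
      have "open W"
        unfolding W_def using V d openin_atlas_topology[OF N]
        by (intro continuous_open_preimage smooth_on_continuous_on U) auto
      then have "openin (atlas_topology M) {q \<in> dom_chart c. snd c q \<in> W}"
        by (rule openin_chart_preimage[OF M c])
      moreover have "f p \<in> dom_chart d" 
        by (rule chart_imageD[OF M c pc U(2,4)])
      then have "p \<in> {q \<in> dom_chart c. snd c q \<in> W}"
        using p pc U(2) chart_inv_chart[OF M c pc] by (auto simp: W_def)
      moreover have "{q \<in> dom_chart c. snd c q \<in> W} \<subseteq> {p \<in> points M. f p \<in> V}"
      proof clarify
        fix q assume q: "q \<in> dom_chart c" "snd c q \<in> W"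
        then have "f q \<in> dom_chart d" 
          using chart_imageD[OF M c q(1) _ U(4)] by (simp add: W_def)
        moreover have "snd d (f q) \<in> snd d ` (V \<inter> dom_chart d)"
          using q chart_inv_chart[OF M c q(1)] by (simp add: W_def)
        ultimately have "f q \<in> V"
          using inj_on_image_mem_iff[OF chart_inj[OF N d], of "f q" "V \<inter> dom_chart d"] by simp
        then show "q \<in> points M \<and> f q \<in> V" using c q by (auto simp: points_def)
      qed
      ultimately show "\<exists>T. openin (atlas_topology M) T \<and> p \<in> T \<and> T \<subseteq> {p \<in> points M. f p \<in> V}"
        by blast
    qed
  qed
next
  fix c' d' assume c': "c' \<in> M" and d': "d' \<in> N"
  show "smooth_on (snd c' ` (dom_chart c' \<inter> f -` dom_chart d')) (snd d' \<circ> f \<circ> chart_inv c')"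
  proof (rule smooth_on_local)
    fix x assume "x \<in> snd c' ` (dom_chart c' \<inter> f -` dom_chart d')"
    then obtain p where p: "p \<in> dom_chart c'" "f p \<in> dom_chart d'" and x: "x = snd c' p" by blast
    then have "p \<in> points M" using c' by (auto simp: points_def)
    then obtain c d U where c: "c \<in> M" and d: "d \<in> N" and pc: "p \<in> dom_chart c" and U: "open U" "snd c p \<in> U"
        "U \<subseteq> snd c ` dom_chart c" "(f \<circ> chart_inv c) ` U \<subseteq> dom_chart d" "smooth_on U (snd d \<circ> f \<circ> chart_inv c)"
      using loc[of p] by blast
    \<comment> \<open>In the charts \<open>c'\<close> and \<open>d'\<close> the map factors into a
      transition map, the given local expression and another transition map; \<open>X\<close>,
      \<open>Y\<close>, \<open>W\<close> and \<open>T\<close> are the domains on which the factors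
      compose.\<close>
    define X where "X = snd c' ` (dom_chart c' \<inter> dom_chart c)"
    define Y where "Y = snd d ` (dom_chart d \<inter> dom_chart d')"
    define W where "W = U \<inter> (snd d \<circ> f \<circ> chart_inv c) -` Y"
    define T where "T = X \<inter> (snd c \<circ> chart_inv c') -` W"
    have oX: "open X" and oY: "open Y"
      unfolding X_def Y_def by (intro open_chart_overlap[OF M] open_chart_overlap[OF N] c c' d d')+
    have oW: "open W"
      unfolding W_def by (intro continuous_open_preimage smooth_on_continuous_on U oY)
    have oT: "open T"
      unfolding T_def X_def
      by (intro continuous_open_preimage smooth_on_continuous_on smooth_on_transition[OF M] oX[unfolded X_def] oW c c')
    have fp: "f p \<in> dom_chart d"
      by (rule chart_imageD[OF M c pc U(2,4)])
    have xT: "x \<in> T"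
      using p pc fp U(2) by (auto simp: T_def X_def W_def Y_def x chart_inv_chart[OF M c] chart_inv_chart[OF M c'])
    have sW: "smooth_on W (snd d \<circ> f \<circ> chart_inv c)"
      using U(5) by (rule smooth_on_subset) (simp add: W_def)
    have sY: "smooth_on Y (snd d' \<circ> chart_inv d)"
      unfolding Y_def by (rule smooth_on_transition[OF N d d'])
    have sT: "smooth_on T (snd c \<circ> chart_inv c')"
      by (rule smooth_on_subset[OF smooth_on_transition[OF M c' c]]) (auto simp: T_def X_def)
    have "smooth_on W (\<lambda>y. (snd d' \<circ> chart_inv d) ((snd d \<circ> f \<circ> chart_inv c) y))"
      by (rule smooth_on_compose[OF smooth_atlas_fin_dim[OF N] oW oY _ sW sY]) (auto simp: W_def)
    then have "smooth_on T (\<lambda>y. (snd d' \<circ> chart_inv d) ((snd d \<circ> f \<circ> chart_inv c) ((snd c \<circ> chart_inv c') y)))"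
      by (rule smooth_on_compose[OF smooth_atlas_fin_dim[OF M] oT oW _ sT, rotated]) (auto simp: T_def)
    then have "smooth_on T (snd d' \<circ> f \<circ> chart_inv c')"
    proof (rule smooth_on_cong[OF oT, rotated])
      fix y assume y: "y \<in> T"
      then obtain q where q: "q \<in> dom_chart c'" "q \<in> dom_chart c" "y = snd c' q" "snd c q \<in> W"
        by (auto simp: T_def X_def chart_inv_chart[OF M c'])
      moreover have "f q \<in> dom_chart d"
        using q chart_imageD[OF M c q(2) _ U(4)] by (simp add: W_def)
      ultimately show "(snd d' \<circ> chart_inv d) ((snd d \<circ> f \<circ> chart_inv c) ((snd c \<circ> chart_inv c') y))
        = (snd d' \<circ> f \<circ> chart_inv c') y"
        by (simp add: chart_inv_chart[OF M c'] chart_inv_chart[OF M c] chart_inv_chart[OF N d])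
    qed
    then show "\<exists>T. open T \<and> x \<in> T \<and> smooth_on T (snd d' \<circ> f \<circ> chart_inv c')"
      using oT xT by blast
  qed
qed

section \<open>Domains and composition of smooth maps\<close>

lemma smooth_map_points:
  assumes "smooth_atlas M" "smooth_atlas N" "smooth_map M N f" "p \<in> points M"
  shows "f p \<in> points N"
  using assms unfolding smooth_map_def continuous_map
  by (auto simp: topspace_atlas_topology)

lemma open_smooth_map_overlap:
  assumes M: "smooth_atlas M" and N: "smooth_atlas N" and f: "smooth_map M N f" and c: "c \<in> M"
    and V: "openin (atlas_topology N) V"
  shows "open (snd c ` (dom_chart c \<inter> f -` V))"
proof -
  have "openin (atlas_topology M) {p \<in> points M. f p \<in> V}"
    using f V topspace_atlas_topology[OF M] unfolding smooth_map_def continuous_map by metis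
  moreover have "{p \<in> points M. f p \<in> V} \<inter> dom_chart c = dom_chart c \<inter> f -` V"
    using c by (auto simp: points_def)
  ultimately show ?thesis using c unfolding openin_atlas_topology[OF M] by metis
qed

lemma open_smooth_map_dom:
  assumes "smooth_atlas M" "smooth_atlas N" "smooth_map M N f" "c \<in> M" "d \<in> N"
  shows "open (snd c ` (dom_chart c \<inter> f -` dom_chart d))"
  by (intro open_smooth_map_overlap[OF assms(1,2,3,4)] openin_dom_chart[OF assms(2)] assms(5))

lemma smooth_map_smooth_on:
  "smooth_map M N f \<Longrightarrow> c \<in> M \<Longrightarrow> d \<in> N \<Longrightarrow>
    smooth_on (snd c ` (dom_chart c \<inter> f -` dom_chart d)) (snd d \<circ> f \<circ> chart_inv c)"
  by (simp add: smooth_map_def)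

lemma smooth_map_compose:
  assumes M: "smooth_atlas M" and N: "smooth_atlas N" and P: "smooth_atlas P"
    and f: "smooth_map M N f" and g: "smooth_map N P g"
  shows "smooth_map M P (\<lambda>p. g (f p))"
proof (rule smooth_mapI[OF M P])
  fix p assume p: "p \<in> points M"
  then obtain c where c: "c \<in> M" "p \<in> dom_chart c" by (rule pointsE)
  obtain d where d: "d \<in> N" "f p \<in> dom_chart d"
    using smooth_map_points[OF M N f p] by (rule pointsE)
  obtain e where e: "e \<in> P" "g (f p) \<in> dom_chart e"
    using smooth_map_points[OF N P g] smooth_map_points[OF M N f p] pointsE by metis
  define Y where "Y = snd d ` (dom_chart d \<inter> g -` dom_chart e)"
  define X where "X = snd c ` (dom_chart c \<inter> f -` dom_chart d)"
  define U where "U = X \<inter> (snd d \<circ> f \<circ> chart_inv c) -` Y"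
  have oX: "open X" unfolding X_def by (rule open_smooth_map_dom[OF M N f c(1) d(1)])
  have oY: "open Y" unfolding Y_def by (rule open_smooth_map_dom[OF N P g d(1) e(1)])
  have sX: "smooth_on X (snd d \<circ> f \<circ> chart_inv c)"
    unfolding X_def by (rule smooth_map_smooth_on[OF f c(1) d(1)])
  have sY: "smooth_on Y (snd e \<circ> g \<circ> chart_inv d)"
    unfolding Y_def by (rule smooth_map_smooth_on[OF g d(1) e(1)])
  have oU: "open U"
    unfolding U_def by (intro continuous_open_preimage smooth_on_continuous_on sX oX oY)
  have elem: "\<exists>q. q \<in> dom_chart c \<and> f q \<in> dom_chart d \<and> g (f q) \<in> dom_chart e \<and> x = snd c q" if "x \<in> U" for x
  proof -
    have "x \<in> X" using that by (simp add: U_def)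
    then obtain q where q: "q \<in> dom_chart c" "f q \<in> dom_chart d" "x = snd c q"
      by (auto simp: X_def)
    have "snd d (f q) \<in> Y"
      using that q by (simp add: U_def chart_inv_chart[OF M c(1)])
    then obtain r where "r \<in> dom_chart d" "g r \<in> dom_chart e" "snd d (f q) = snd d r"
      by (auto simp: Y_def)
    then have "f q = r" using q chart_inj[OF N d(1)] by (metis inj_onD)
    then show ?thesis using q \<open>g r \<in> dom_chart e\<close> by blast
  qed
  have "smooth_on U (\<lambda>x. (snd e \<circ> g \<circ> chart_inv d) ((snd d \<circ> f \<circ> chart_inv c) x))"
  proof (rule smooth_on_compose[OF smooth_atlas_fin_dim[OF N] oU oY _ _ sY])
    show "(snd d \<circ> f \<circ> chart_inv c) ` U \<subseteq> Y" by (auto simp: U_def)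
    show "smooth_on U (snd d \<circ> f \<circ> chart_inv c)"
      by (rule smooth_on_subset[OF sX]) (simp add: U_def)
  qed
  then have "smooth_on U (snd e \<circ> (\<lambda>p. g (f p)) \<circ> chart_inv c)"
    by (rule smooth_on_cong[OF oU, rotated])
      (auto dest!: elem simp: chart_inv_chart[OF M c(1)] chart_inv_chart[OF N d(1)])
  moreover have "snd c p \<in> U"
    using c d e by (auto simp: U_def X_def Y_def chart_inv_chart[OF M c(1)])
  moreover have "U \<subseteq> snd c ` dom_chart c" by (auto simp: U_def X_def)
  moreover have "((\<lambda>p. g (f p)) \<circ> chart_inv c) ` U \<subseteq> dom_chart e"
    by (auto dest!: elem simp: chart_inv_chart[OF M c(1)])
  ultimately show "\<exists>c\<in>M. \<exists>d\<in>P. \<exists>U. p \<in> dom_chart c \<and> open U \<and> snd c p \<in> U \<and>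
      U \<subseteq> snd c ` dom_chart c \<and> ((\<lambda>p. g (f p)) \<circ> chart_inv c) ` U \<subseteq> dom_chart d \<and>
      smooth_on U (snd d \<circ> (\<lambda>p. g (f p)) \<circ> chart_inv c)"
    using c e oU by blast
qed

section \<open>Products\<close>

abbreviation prod_chart :: "('p, 'd) chart \<Rightarrow> ('q, 'e) chart \<Rightarrow> ('p \<times> 'q, 'd \<times> 'e) chart" where
  "prod_chart c d \<equiv> (dom_chart c \<times> dom_chart d, map_prod (snd c) (snd d))"

lemma prod_chart_in: "c \<in> M \<Longrightarrow> d \<in> N \<Longrightarrow> prod_chart c d \<in> prod_atlas M N"
  unfolding prod_atlas_def by blast

lemma prod_atlasE:
  assumes "e \<in> prod_atlas M N"
  obtains c d where "c \<in> M" "d \<in> N" "e = prod_chart c d"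
  using assms by (auto simp: prod_atlas_def)

lemma points_prod_atlas: "points (prod_atlas M N) = points M \<times> points N"
proof (intro equalityI subsetI)
  fix x assume "x \<in> points (prod_atlas M N)"
  then obtain e where e: "e \<in> prod_atlas M N" and x: "x \<in> dom_chart e" by (rule pointsE)
  from e obtain c d where "c \<in> M" "d \<in> N" "e = prod_chart c d" by (rule prod_atlasE)
  with x show "x \<in> points M \<times> points N"
    by (auto intro: dom_chart_points[of c M] dom_chart_points[of d N])
next
  fix x assume x: "x \<in> points M \<times> points N"
  obtain c where c: "c \<in> M" "fst x \<in> dom_chart c"
    using x by (metis mem_Times_iff pointsE)
  obtain d where d: "d \<in> N" "snd x \<in> dom_chart d"
    using x by (metis mem_Times_iff pointsE)
  have "x \<in> dom_chart (prod_chart c d)" using c d by (simp add: mem_Times_iff)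
  then show "x \<in> points (prod_atlas M N)" by (rule dom_chart_points[OF prod_chart_in[OF c(1) d(1)]])
qed

lemma image_map_prod_Times: "map_prod f g ` (A \<times> B) = f ` A \<times> g ` B"
  by force

lemma chart_inv_prod:
  assumes "inj_on (snd c) (dom_chart c)" "inj_on (snd d) (dom_chart d)"
    and "x \<in> snd c ` dom_chart c" "y \<in> snd d ` dom_chart d"
  shows "chart_inv (prod_chart c d) (x, y) = (chart_inv c x, chart_inv d y)"
proof -
  have "inj_on (map_prod (snd c) (snd d)) (dom_chart c \<times> dom_chart d)"
    using assms(1,2) by (rule map_prod_inj_on)
  then show ?thesis
    using assms(3,4) by (auto intro!: inv_into_f_eq simp: assms(1,2))
qed

lemma smooth_atlas_prod:
  fixes M :: "('p, 'd::real_normed_vector) atlas" and N :: "('q, 'e::real_normed_vector) atlas"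
  assumes M: "smooth_atlas M" and N: "smooth_atlas N"
  shows "smooth_atlas (prod_atlas M N)"
  unfolding smooth_atlas_def
proof (intro conjI ballI)
  show "fin_dim TYPE('d \<times> 'e)"
    by (intro fin_dim_prod smooth_atlas_fin_dim[OF M] smooth_atlas_fin_dim[OF N])
next
  fix e assume "e \<in> prod_atlas M N"
  then obtain c d where e: "c \<in> M" "d \<in> N" "e = prod_chart c d" by (rule prod_atlasE)
  show "inj_on (snd e) (dom_chart e)"
    unfolding e by (simp add: map_prod_inj_on chart_inj[OF M e(1)] chart_inj[OF N e(2)])
  show "open (snd e ` dom_chart e)"
    unfolding e by (simp add: image_map_prod_Times open_Times open_chart_image[OF M e(1)] open_chart_image[OF N e(2)])
next
  fix e e' assume ee': "e \<in> prod_atlas M N" "e' \<in> prod_atlas M N"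
  obtain c d where e: "c \<in> M" "d \<in> N" "e = prod_chart c d"
    using ee'(1) by (rule prod_atlasE)
  obtain c' d' where e': "c' \<in> M" "d' \<in> N" "e' = prod_chart c' d'"
    using ee'(2) by (rule prod_atlasE)
  define X where "X = snd c ` (dom_chart c \<inter> dom_chart c')"
  define Y where "Y = snd d ` (dom_chart d \<inter> dom_chart d')"
  have im: "snd e ` (dom_chart e \<inter> dom_chart e') = X \<times> Y"
    unfolding e e' X_def Y_def fst_conv snd_conv Times_Int_Times by (rule image_map_prod_Times)
  have oX: "open X" and oY: "open Y"
    unfolding X_def Y_def by (intro open_chart_overlap[OF M] open_chart_overlap[OF N] e e')+
  then have oXY: "open (X \<times> Y)" by (rule open_Times)
  then show "open (snd e ` (dom_chart e \<inter> dom_chart e'))" by (simp only: im)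
  have sX: "smooth_on X (snd c' \<circ> chart_inv c)" and sY: "smooth_on Y (snd d' \<circ> chart_inv d)"
    unfolding X_def Y_def by (intro smooth_on_transition[OF M] smooth_on_transition[OF N] e e')+
  have "smooth_on (X \<times> Y) (\<lambda>z. (snd c' \<circ> chart_inv c) (fst z))"
    by (rule smooth_on_compose[OF smooth_atlas_fin_dim[OF M] oXY oX _ smooth_on_bounded_linear[OF bounded_linear_fst] sX]) auto
  moreover have "smooth_on (X \<times> Y) (\<lambda>z. (snd d' \<circ> chart_inv d) (snd z))"
    by (rule smooth_on_compose[OF smooth_atlas_fin_dim[OF N] oXY oY _ smooth_on_bounded_linear[OF bounded_linear_snd] sY]) auto
  ultimately have "smooth_on (X \<times> Y) (\<lambda>z. ((snd c' \<circ> chart_inv c) (fst z), (snd d' \<circ> chart_inv d) (snd z)))"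
    by (rule smooth_on_Pair[OF oXY])
  then show "smooth_on (snd e ` (dom_chart e \<inter> dom_chart e')) (snd e' \<circ> chart_inv e)"
    unfolding im
  proof (rule smooth_on_cong[OF oXY, rotated])
    fix z assume "z \<in> X \<times> Y"
    then have "fst z \<in> snd c ` dom_chart c" "snd z \<in> snd d ` dom_chart d" by (auto simp: X_def Y_def)
    then have "chart_inv e (fst z, snd z) = (chart_inv c (fst z), chart_inv d (snd z))"
      unfolding e(3) by (rule chart_inv_prod[OF chart_inj[OF M e(1)] chart_inj[OF N e(2)]])
    then show "((snd c' \<circ> chart_inv c) (fst z), (snd d' \<circ> chart_inv d) (snd z)) = (snd e' \<circ> chart_inv e) z"
      by (simp add: e'(3))
  qed
qed

text \<open>Composition with this inclusion turns a jointly smooth action into the smooth maps of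
  its single group elements.\<close>

lemma smooth_map_Pair_const:
  assumes M: "smooth_atlas M" and N: "smooth_atlas N" and g: "g \<in> points M"
  shows "smooth_map N (prod_atlas M N) (\<lambda>q. (g, q))"
proof (rule smooth_mapI[OF N smooth_atlas_prod[OF M N]])
  fix q assume "q \<in> points N"
  then obtain d where d: "d \<in> N" "q \<in> dom_chart d" by (rule pointsE)
  obtain c where c: "c \<in> M" "g \<in> dom_chart c" using g by (rule pointsE)
  have "smooth_on (snd d ` dom_chart d) (\<lambda>x. (snd c g, x))"
    by (intro smooth_on_Pair open_chart_image[OF N] d smooth_on_const smooth_on_bounded_linear bounded_linear_ident)
  then have "smooth_on (snd d ` dom_chart d) (snd (prod_chart c d) \<circ> (\<lambda>q. (g, q)) \<circ> chart_inv d)"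
    by (rule smooth_on_cong[OF open_chart_image[OF N d(1)], rotated]) (auto simp: chart_inv_chart[OF N d(1)])
  then show "\<exists>c\<in>N. \<exists>e\<in>prod_atlas M N. \<exists>U. q \<in> dom_chart c \<and> open U \<and> snd c q \<in> U \<and>
      U \<subseteq> snd c ` dom_chart c \<and> ((\<lambda>q. (g, q)) \<circ> chart_inv c) ` U \<subseteq> dom_chart e \<and>
      smooth_on U (snd e \<circ> (\<lambda>q. (g, q)) \<circ> chart_inv c)"
    using c d prod_chart_in[OF c(1) d(1)]
    by (intro bexI[of _ d] bexI[of _ "prod_chart c d"] exI[of _ "snd d ` dom_chart d"])
      (auto simp: chart_inv_chart[OF N d(1)] intro: open_chart_image[OF N])
qed

section \<open>Derivatives in charts and tangent vectors\<close>

text \<open>The Jacobian of \<open>f\<close> in explicitly given charts, in contrast to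
  \<open>tangent_map\<close>, which goes through \<open>chart_at\<close>. With \<open>f = id\<close>
  it is the derivative of a transition map.\<close>

definition local_deriv ::
    "('p \<Rightarrow> 'q) \<Rightarrow> ('p, 'd::real_normed_vector) chart \<Rightarrow> ('q, 'e::real_normed_vector) chart \<Rightarrow> 'p \<Rightarrow> 'd \<Rightarrow> 'e" where
  "local_deriv f c d p = frechet_derivative (snd d \<circ> f \<circ> chart_inv c) (at (snd c p))"

lemma local_deriv_id: "local_deriv id c d p = frechet_derivative (snd d \<circ> chart_inv c) (at (snd c p))"
  by (simp add: local_deriv_def)

lemma smooth_map_id:
  assumes M: "smooth_atlas M"
  shows "smooth_map M M id"
proof (rule smooth_mapI[OF M M])
  fix p assume "p \<in> points M"
  then obtain c where c: "c \<in> M" "p \<in> dom_chart c" by (rule pointsE)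
  have "smooth_on (snd c ` dom_chart c) (snd c \<circ> id \<circ> chart_inv c)"
    using smooth_on_transition[OF M c(1) c(1)] by simp
  then show "\<exists>c\<in>M. \<exists>d\<in>M. \<exists>U. p \<in> dom_chart c \<and> open U \<and> snd c p \<in> U \<and>
      U \<subseteq> snd c ` dom_chart c \<and> (id \<circ> chart_inv c) ` U \<subseteq> dom_chart d \<and>
      smooth_on U (snd d \<circ> id \<circ> chart_inv c)"
    using c open_chart_image[OF M c(1)]
    by (intro bexI[of _ c] exI[of _ "snd c ` dom_chart c"]) (auto simp: chart_inv_chart[OF M c(1)])
qed

context
  fixes M :: "('p, 'd::real_normed_vector) atlas" and N :: "('q, 'e::real_normed_vector) atlas"
    and f :: "'p \<Rightarrow> 'q" and c d p
  assumes M: "smooth_atlas M" and N: "smooth_atlas N" and f: "smooth_map M N f"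
    and c: "c \<in> M" "p \<in> dom_chart c" and d: "d \<in> N" "f p \<in> dom_chart d"
begin

lemma has_derivative_local_deriv:
  "((snd d \<circ> f \<circ> chart_inv c) has_derivative local_deriv f c d p) (at (snd c p))"
  unfolding local_deriv_def
  by (rule smooth_on_has_derivative[OF smooth_map_smooth_on[OF f c(1) d(1)]]) (use c d in auto)

lemma linear_local_deriv: "linear (local_deriv f c d p)"
  using has_derivative_local_deriv by (rule has_derivative_linear)

text \<open>Maps are total functions but are controlled only on the manifold; as chart images are
  open, that fixes the derivative.\<close>

lemma local_deriv_cong:
  assumes "\<And>p. p \<in> points M \<Longrightarrow> f p = g p"
  shows "local_deriv g c d p = local_deriv f c d p"
proof -
  have eq: "f q = g q" if "q \<in> dom_chart c" for q
    by (rule assms, rule dom_chart_points[OF c(1) that])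
  have "((snd d \<circ> g \<circ> chart_inv c) has_derivative local_deriv f c d p) (at (snd c p))"
    by (rule has_derivative_transform_within_open[OF has_derivative_local_deriv open_chart_image[OF M c(1)]])
      (use c eq in \<open>auto simp: chart_inv_chart[OF M c(1)]\<close>)
  then show ?thesis
    unfolding local_deriv_def[of g] by (rule frechet_derivative_at[symmetric])
qed

lemma local_deriv_compose:
  fixes P :: "('r, 'f::real_normed_vector) atlas"
  assumes P: "smooth_atlas P" and g: "smooth_map N P g" and e: "e \<in> P" "g (f p) \<in> dom_chart e"
  shows "local_deriv (\<lambda>p. g (f p)) c e p v = local_deriv g d e (f p) (local_deriv f c d p v)"
proof -
  have "((snd e \<circ> g \<circ> chart_inv d) has_derivative local_deriv g d e (f p)) (at (snd d (f p)))"
    unfolding local_deriv_def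
    by (rule smooth_on_has_derivative[OF smooth_map_smooth_on[OF g d(1) e(1)]]) (use d e in auto)
  then have "((snd e \<circ> g \<circ> chart_inv d) has_derivative local_deriv g d e (f p))
      (at ((snd d \<circ> f \<circ> chart_inv c) (snd c p)))"
    by (simp add: chart_inv_chart[OF M c])
  from has_derivative_compose[OF has_derivative_local_deriv this]
  have "((snd e \<circ> (\<lambda>p. g (f p)) \<circ> chart_inv c) has_derivative
      (\<lambda>v. local_deriv g d e (f p) (local_deriv f c d p v))) (at (snd c p))"
  proof (rule has_derivative_transform_within_open[OF _ open_smooth_map_dom[OF M N f c(1) d(1)]])
    show "snd c p \<in> snd c ` (dom_chart c \<inter> f -` dom_chart d)" using c d by auto
    show "(snd e \<circ> g \<circ> chart_inv d) ((snd d \<circ> f \<circ> chart_inv c) x) = (snd e \<circ> (\<lambda>p. g (f p)) \<circ> chart_inv c) x"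
      if "x \<in> snd c ` (dom_chart c \<inter> f -` dom_chart d)" for x
      using that by (auto simp: chart_inv_chart[OF M c(1)] chart_inv_chart[OF N d(1)])
  qed
  then show ?thesis
    unfolding local_deriv_def[of "\<lambda>p. g (f p)"] by (metis frechet_derivative_at)
qed

end

section \<open>Tangent vectors in coordinates\<close>

context
  fixes M :: "('q, 'e::real_normed_vector) atlas"
  assumes M: "smooth_atlas M"
begin

text \<open>The cocycle rule for transition derivatives, as the chain rule for \<open>id\<close>
  composed with itself.\<close>

lemma local_deriv_id_compose:
  assumes "c \<in> M" "d \<in> M" "e \<in> M" "q \<in> dom_chart c" "q \<in> dom_chart d" "q \<in> dom_chart e"
  shows "local_deriv id d e q (local_deriv id c d q v) = local_deriv id c e q v"
  using local_deriv_compose[OF M M smooth_map_id[OF M], of c q d M id e v] assms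
  by (simp add: M smooth_map_id flip: id_def)

lemma local_deriv_id_self:
  assumes c: "c \<in> M" "q \<in> dom_chart c"
  shows "local_deriv id c c q v = v"
proof -
  have "((snd c \<circ> id \<circ> chart_inv c) has_derivative (\<lambda>x. x)) (at (snd c q))"
    by (rule has_derivative_transform_within_open[OF has_derivative_ident open_chart_image[OF M c(1)]])
      (use c in \<open>auto simp: chart_inv_chart[OF M c(1)]\<close>)
  then show ?thesis unfolding local_deriv_def by (metis frechet_derivative_at)
qed

lemma linear_local_deriv_id:
  assumes "c \<in> M" "d \<in> M" "q \<in> dom_chart c" "q \<in> dom_chart d"
  shows "linear (local_deriv id c d q)"
  using linear_local_deriv[OF M M smooth_map_id[OF M]] assms by simp

lemma tangent_spaceD:
  assumes "v \<in> tangent_space M q" "c \<in> M" "d \<in> M" "q \<in> dom_chart c" "q \<in> dom_chart d"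
  shows "v d = local_deriv id c d q (v c)"
  using assms unfolding tangent_space_def local_deriv_id by blast

lemma coord_vector_apply:
  assumes "d \<in> M" "q \<in> dom_chart d"
  shows "coord_vector M c q e d = local_deriv id c d q e"
  using assms by (simp add: coord_vector_def local_deriv_id)

lemma coord_vector_in_tangent_space:
  assumes "c \<in> M" "q \<in> dom_chart c"
  shows "coord_vector M c q e \<in> tangent_space M q"
proof -
  have *: "coord_vector M c q e b = local_deriv id a b q (coord_vector M c q e a)"
    if "a \<in> M" "b \<in> M" "q \<in> dom_chart a" "q \<in> dom_chart b" for a b
    using that by (simp add: coord_vector_apply local_deriv_id_compose assms)
  show ?thesis
    unfolding tangent_space_def local_deriv_id[symmetric]
  proof (rule CollectI, intro conjI allI impI ballI)
    show "coord_vector M c q e d = 0" if "\<not> (d \<in> M \<and> q \<in> dom_chart d)" for d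
      using that by (auto simp: coord_vector_def)
    show "coord_vector M c q e b = local_deriv id a b q (coord_vector M c q e a)"
      if "a \<in> M" "b \<in> M" "q \<in> dom_chart a \<and> q \<in> dom_chart b" for a b
      using * that by blast
  qed
qed

lemma coord_vector_self:
  assumes "c \<in> M" "q \<in> dom_chart c"
  shows "coord_vector M c q e c = e"
  using assms by (simp add: coord_vector_apply local_deriv_id_self)

text \<open>Together with \<open>coord_vector_self\<close>, evaluation at \<open>c\<close> becomes a
  bijection from the tangent space onto the model space, so a tangent vector can be handled through
  a single component.\<close>

lemma coord_vector_of_tangent:
  assumes "v \<in> tangent_space M q" "c \<in> M" "q \<in> dom_chart c"
  shows "coord_vector M c q (v c) = v"
proof
  fix d
  show "coord_vector M c q (v c) d = v d"
  proof (cases "d \<in> M \<and> q \<in> dom_chart d")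
    case True
    then show ?thesis using tangent_spaceD[OF assms(1,2), of d] assms by (simp add: coord_vector_apply)
  next
    case False
    then have "v d = 0" using assms(1) unfolding tangent_space_def by blast
    then show ?thesis using False by (auto simp: coord_vector_def)
  qed
qed

lemma coord_vector_change:
  assumes "c \<in> M" "d \<in> M" "q \<in> dom_chart c" "q \<in> dom_chart d"
  shows "coord_vector M c q e = coord_vector M d q (local_deriv id c d q e)"
  using coord_vector_of_tangent[OF coord_vector_in_tangent_space[OF assms(1,3)] assms(2,4), of e] assms
  by (simp add: coord_vector_apply)

lemma coord_vector_add:
  assumes "c \<in> M" "q \<in> dom_chart c"
  shows "coord_vector M c q (e + e') = (\<lambda>d. coord_vector M c q e d + coord_vector M c q e' d)"
  unfolding coord_vector_def local_deriv_id[symmetric]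
  using assms by (auto simp: linear_add[OF linear_local_deriv_id])

lemma coord_vector_scale:
  assumes "c \<in> M" "q \<in> dom_chart c"
  shows "coord_vector M c q (r *\<^sub>R e) = (\<lambda>d. r *\<^sub>R coord_vector M c q e d)"
  unfolding coord_vector_def local_deriv_id[symmetric]
  using assms by (auto simp: linear_scale[OF linear_local_deriv_id])

lemma tangent_space_add:
  assumes "q \<in> points M" "v \<in> tangent_space M q" "w \<in> tangent_space M q"
  shows "(\<lambda>d. v d + w d) \<in> tangent_space M q"
proof -
  obtain c where c: "c \<in> M" "q \<in> dom_chart c" using assms(1) by (rule pointsE)
  have "(\<lambda>d. v d + w d) = coord_vector M c q (v c + w c)"
    using assms c by (simp add: coord_vector_add coord_vector_of_tangent)
  then show ?thesis using coord_vector_in_tangent_space[OF c] by simp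
qed

lemma tangent_space_scale:
  assumes "q \<in> points M" "v \<in> tangent_space M q"
  shows "(\<lambda>d. r *\<^sub>R v d) \<in> tangent_space M q"
proof -
  obtain c where c: "c \<in> M" "q \<in> dom_chart c" using assms(1) by (rule pointsE)
  have "(\<lambda>d. r *\<^sub>R v d) = coord_vector M c q (r *\<^sub>R v c)"
    using assms c by (simp add: coord_vector_scale coord_vector_of_tangent)
  then show ?thesis using coord_vector_in_tangent_space[OF c] by simp
qed

lemma chart_at:
  assumes "q \<in> points M"
  shows "chart_at M q \<in> M" "q \<in> dom_chart (chart_at M q)"
proof -
  have "\<exists>c. c \<in> M \<and> q \<in> dom_chart c" using assms by (auto simp: points_def)
  from someI_ex[OF this] show "chart_at M q \<in> M" "q \<in> dom_chart (chart_at M q)"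
    by (auto simp: chart_at_def)
qed

end

section \<open>Tangent maps in arbitrary charts\<close>

context
  fixes M :: "('p, 'd::real_normed_vector) atlas" and N :: "('q, 'e::real_normed_vector) atlas"
    and f :: "'p \<Rightarrow> 'q" and p
  assumes M: "smooth_atlas M" and N: "smooth_atlas N" and f: "smooth_map M N f"
    and p: "p \<in> points M"
begin

text \<open>Frees \<open>tangent_map\<close> from the chart \<open>chart_at M p\<close> in its
  definition: the chain rule with \<open>id\<close> on the source and with \<open>id\<close> on the
  target moves the derivative to any pair of charts.\<close>

lemma tangent_map_eq_coord_vector:
  assumes v: "v \<in> tangent_space M p" and c: "c \<in> M" "p \<in> dom_chart c" and d: "d \<in> N" "f p \<in> dom_chart d"
  shows "tangent_map M N f p v = coord_vector N d (f p) (local_deriv f c d p (v c))"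
proof
  fix e
  show "tangent_map M N f p v e = coord_vector N d (f p) (local_deriv f c d p (v c)) e"
  proof (cases "e \<in> N \<and> f p \<in> dom_chart e")
    case True
    define b where "b = chart_at M p"
    have b: "b \<in> M" "p \<in> dom_chart b" unfolding b_def by (rule chart_at[OF M p])+
    have "tangent_map M N f p v e = local_deriv f b e p (v b)"
      using True by (simp add: tangent_map_def local_deriv_def b_def Let_def)
    also have "\<dots> = local_deriv f b e p (local_deriv id c b p (v c))"
      using tangent_spaceD[OF M v c(1) b(1) c(2) b(2)] by simp
    also have "\<dots> = local_deriv f c e p (v c)"
      using local_deriv_compose[OF M M smooth_map_id[OF M] c b(1) _ N f, of e "v c"] b True by simp
    also have "\<dots> = local_deriv id d e (f p) (local_deriv f c d p (v c))"
      using local_deriv_compose[OF M N f c d N smooth_map_id[OF N], of e "v c"] True by simp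
    also have "\<dots> = coord_vector N d (f p) (local_deriv f c d p (v c)) e"
      using True by (simp add: coord_vector_apply[OF N])
    finally show ?thesis .
  next
    case False
    then show ?thesis by (auto simp: tangent_map_def coord_vector_def Let_def)
  qed
qed

lemma tangent_map_in_tangent_space:
  assumes v: "v \<in> tangent_space M p"
  shows "tangent_map M N f p v \<in> tangent_space N (f p)"
proof -
  obtain c where c: "c \<in> M" "p \<in> dom_chart c" using p by (rule pointsE)
  obtain d where d: "d \<in> N" "f p \<in> dom_chart d"
    using smooth_map_points[OF M N f p] by (rule pointsE)
  show ?thesis
    unfolding tangent_map_eq_coord_vector[OF v c d] by (rule coord_vector_in_tangent_space[OF N d])
qed

lemma tangent_map_apply:
  assumes v: "v \<in> tangent_space M p" and c: "c \<in> M" "p \<in> dom_chart c" and d: "d \<in> N" "f p \<in> dom_chart d"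
  shows "tangent_map M N f p v d = local_deriv f c d p (v c)"
  unfolding tangent_map_eq_coord_vector[OF assms] by (rule coord_vector_self[OF N d])

lemma tangent_map_add:
  assumes "v \<in> tangent_space M p" "w \<in> tangent_space M p"
  shows "tangent_map M N f p (\<lambda>c. v c + w c) = (\<lambda>d. tangent_map M N f p v d + tangent_map M N f p w d)"
proof -
  obtain c where c: "c \<in> M" "p \<in> dom_chart c" using p by (rule pointsE)
  obtain d where d: "d \<in> N" "f p \<in> dom_chart d"
    using smooth_map_points[OF M N f p] by (rule pointsE)
  show ?thesis
    using assms tangent_space_add[OF M p assms]
    by (simp add: tangent_map_eq_coord_vector[OF _ c d] linear_add[OF linear_local_deriv[OF M N f c d]]
        coord_vector_add[OF N d])
qed

lemma tangent_map_scale: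
  assumes "v \<in> tangent_space M p"
  shows "tangent_map M N f p (\<lambda>c. r *\<^sub>R v c) = (\<lambda>d. r *\<^sub>R tangent_map M N f p v d)"
proof -
  obtain c where c: "c \<in> M" "p \<in> dom_chart c" using p by (rule pointsE)
  obtain d where d: "d \<in> N" "f p \<in> dom_chart d"
    using smooth_map_points[OF M N f p] by (rule pointsE)
  show ?thesis
    using assms tangent_space_scale[OF M p assms]
    by (simp add: tangent_map_eq_coord_vector[OF _ c d] linear_scale[OF linear_local_deriv[OF M N f c d]]
        coord_vector_scale[OF N d])
qed

end

text \<open>For a group element and its inverse this makes the tangent maps at corresponding points
  inverse to each other.\<close>

lemma tangent_map_left_inverse:
  assumes M: "smooth_atlas M" and N: "smooth_atlas N" and f: "smooth_map M N f" and g: "smooth_map N M g"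
    and p: "p \<in> points M" and gf: "\<And>p. p \<in> points M \<Longrightarrow> g (f p) = p"
    and v: "v \<in> tangent_space M p"
  shows "tangent_map N M g (f p) (tangent_map M N f p v) = v"
proof -
  obtain c where c: "c \<in> M" "p \<in> dom_chart c" using p by (rule pointsE)
  have fp: "f p \<in> points N" by (rule smooth_map_points[OF M N f p])
  then obtain d where d: "d \<in> N" "f p \<in> dom_chart d" by (rule pointsE)
  have gfp: "g (f p) \<in> dom_chart c" using gf[OF p] c by simp
  have "local_deriv g d c (f p) (tangent_map M N f p v d) = local_deriv (\<lambda>p. g (f p)) c c p (v c)"
    using local_deriv_compose[OF M N f c d M g c(1) gfp] by (simp add: tangent_map_apply[OF M N f p v c d])
  also have "\<dots> = local_deriv id c c p (v c)"
    using local_deriv_cong[OF M M smooth_map_id[OF M] c c(1), of "\<lambda>p. g (f p)"] c gf by simp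
  also have "\<dots> = v c" by (rule local_deriv_id_self[OF M c])
  finally show ?thesis
    using tangent_map_eq_coord_vector[OF N M g fp tangent_map_in_tangent_space[OF M N f p v] d c(1) gfp]
      coord_vector_of_tangent[OF M v c] by (simp add: gf[OF p])
qed

section \<open>The cotangent bundle in charts\<close>

definition covec_coord ::
    "('q, 'e::real_normed_vector) atlas \<Rightarrow> ('q, 'e) chart \<Rightarrow> 'q \<Rightarrow> ('q, 'e) covector \<Rightarrow> 'e \<Rightarrow>\<^sub>L real" where
  "covec_coord M c q \<alpha> = Blinfun (\<lambda>e. \<alpha> (coord_vector M c q e))"

text \<open>The inverse of \<open>covec_coord\<close> on a fibre. The value zero outside the tangent
  space is the normalisation that \<open>cotangent_space\<close> prescribes.\<close>

definition covec_of ::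
    "('q, 'e::real_normed_vector) atlas \<Rightarrow> ('q, 'e) chart \<Rightarrow> 'q \<Rightarrow> ('e \<Rightarrow>\<^sub>L real) \<Rightarrow> ('q, 'e) covector" where
  "covec_of M c q p = (\<lambda>v. if v \<in> tangent_space M q then p (v c) else 0)"

lemma dom_cotangent_chart: "dom_chart (cotangent_chart M c) = (SIGMA q : dom_chart c. cotangent_space M q)"
  by (simp add: cotangent_chart_def)

lemma cotangent_chart_apply: "snd (cotangent_chart M c) (q, \<alpha>) = (snd c q, covec_coord M c q \<alpha>)"
  by (simp add: cotangent_chart_def covec_coord_def)

lemma cotangent_chart_in: "c \<in> M \<Longrightarrow> cotangent_chart M c \<in> cotangent_bundle M"
  by (simp add: cotangent_bundle_def)

lemma points_cotangent_bundle: "points (cotangent_bundle M) = (SIGMA q : points M. cotangent_space M q)"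
  by (auto simp: points_def cotangent_bundle_def dom_cotangent_chart)

context
  fixes M :: "('q, 'e::real_normed_vector) atlas"
  assumes M: "smooth_atlas M"
begin

lemma zero_in_cotangent_space: "(\<lambda>_. 0) \<in> cotangent_space M q"
  by (simp add: cotangent_space_def)

lemma linear_covector:
  assumes "c \<in> M" "q \<in> dom_chart c" "\<alpha> \<in> cotangent_space M q"
  shows "linear (\<lambda>e. \<alpha> (coord_vector M c q e))"
  using assms(3) coord_vector_in_tangent_space[OF M assms(1,2)]
  by (intro linearI) (auto simp: coord_vector_add[OF M assms(1,2)] coord_vector_scale[OF M assms(1,2)] cotangent_space_def)

text \<open>Finite dimension makes the functional bounded, so \<open>Blinfun\<close> really
  represents it.\<close>

lemma covec_coord_apply:
  assumes "c \<in> M" "q \<in> dom_chart c" "\<alpha> \<in> cotangent_space M q"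
  shows "covec_coord M c q \<alpha> e = \<alpha> (coord_vector M c q e)"
  unfolding covec_coord_def
  by (simp add: bounded_linear_Blinfun_apply fin_dim_bounded_linear[OF smooth_atlas_fin_dim[OF M] linear_covector[OF assms]])

lemma covector_eq_coord:
  assumes "c \<in> M" "q \<in> dom_chart c" "\<alpha> \<in> cotangent_space M q" "v \<in> tangent_space M q"
  shows "\<alpha> v = covec_coord M c q \<alpha> (v c)"
  by (simp add: covec_coord_apply[OF assms(1-3)] coord_vector_of_tangent[OF M assms(4,1,2)])

lemma covec_of_in_cotangent_space:
  assumes "c \<in> M" "q \<in> dom_chart c"
  shows "covec_of M c q p \<in> cotangent_space M q"
  using tangent_space_add[OF M dom_chart_points[OF assms]] tangent_space_scale[OF M dom_chart_points[OF assms]]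
  by (auto simp: cotangent_space_def covec_of_def blinfun.add_right blinfun.scaleR_right)

lemma covec_of_coord_vector:
  assumes "c \<in> M" "d \<in> M" "q \<in> dom_chart c" "q \<in> dom_chart d"
  shows "covec_of M c q p (coord_vector M d q e) = p (local_deriv id d c q e)"
  using assms by (simp add: covec_of_def coord_vector_in_tangent_space[OF M] coord_vector_apply[OF M])

lemma covec_coord_of:
  assumes "c \<in> M" "q \<in> dom_chart c"
  shows "covec_coord M c q (covec_of M c q p) = p"
  using assms
  by (intro blinfun_eqI)
    (simp add: covec_coord_apply covec_of_in_cotangent_space covec_of_coord_vector local_deriv_id_self[OF M])

lemma covec_of_coord:
  assumes "c \<in> M" "q \<in> dom_chart c" "\<alpha> \<in> cotangent_space M q"
  shows "covec_of M c q (covec_coord M c q \<alpha>) = \<alpha>"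
proof
  fix v
  show "covec_of M c q (covec_coord M c q \<alpha>) v = \<alpha> v"
  proof (cases "v \<in> tangent_space M q")
    case True
    then show ?thesis using covector_eq_coord[OF assms True] by (simp add: covec_of_def)
  next
    case False
    then have "\<alpha> v = 0" using assms(3) unfolding cotangent_space_def by blast
    then show ?thesis using False by (simp add: covec_of_def)
  qed
qed

lemma covec_coord_inj:
  assumes "c \<in> M" "q \<in> dom_chart c" "\<alpha> \<in> cotangent_space M q" "\<beta> \<in> cotangent_space M q"
    and "covec_coord M c q \<alpha> = covec_coord M c q \<beta>"
  shows "\<alpha> = \<beta>"
  using covec_of_coord[OF assms(1-3)] covec_of_coord[OF assms(1,2,4)] assms(5) by metis

lemma inj_on_cotangent_chart:
  assumes "c \<in> M"
  shows "inj_on (snd (cotangent_chart M c)) (dom_chart (cotangent_chart M c))"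
proof (rule inj_onI)
  fix s t assume s: "s \<in> dom_chart (cotangent_chart M c)" and t: "t \<in> dom_chart (cotangent_chart M c)"
    and eq: "snd (cotangent_chart M c) s = snd (cotangent_chart M c) t"
  obtain q \<alpha> r \<beta> where st: "s = (q, \<alpha>)" "t = (r, \<beta>)" by (metis surj_pair)
  have q: "q \<in> dom_chart c" "\<alpha> \<in> cotangent_space M q" and r: "r \<in> dom_chart c" "\<beta> \<in> cotangent_space M r"
    using s t by (auto simp: st dom_cotangent_chart)
  have "snd c q = snd c r" and p: "covec_coord M c q \<alpha> = covec_coord M c r \<beta>"
    using eq by (simp_all add: st cotangent_chart_apply)
  then have "q = r" using inj_onD[OF chart_inj[OF M assms]] q r by blast
  then show "s = t" using covec_coord_inj[OF assms, of q \<alpha> \<beta>] q r p by (simp add: st)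
qed

text \<open>Every functional on the model space is the coordinate of some \<open>covec_of\<close>.
  Images under bundle charts are therefore full cylinders, open whenever their base is.\<close>

lemma cotangent_chart_image:
  assumes "c \<in> M" "S \<subseteq> dom_chart c"
  shows "snd (cotangent_chart M c) ` (SIGMA q : S. cotangent_space M q) = (snd c ` S) \<times> UNIV"
proof (intro equalityI subsetI)
  fix y assume "y \<in> (snd c ` S) \<times> (UNIV :: ('e \<Rightarrow>\<^sub>L real) set)"
  then obtain q p where q: "q \<in> S" "y = (snd c q, p)" by auto
  then have "q \<in> dom_chart c" using assms(2) by blast
  then have "y = snd (cotangent_chart M c) (q, covec_of M c q p)" "covec_of M c q p \<in> cotangent_space M q"
    using assms(1) by (simp_all add: q cotangent_chart_apply covec_coord_of covec_of_in_cotangent_space)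
  then show "y \<in> snd (cotangent_chart M c) ` (SIGMA q : S. cotangent_space M q)"
    using q by blast
qed (auto simp: cotangent_chart_apply)

lemma chart_inv_cotangent_chart:
  assumes "c \<in> M" "q \<in> dom_chart c"
  shows "chart_inv (cotangent_chart M c) (snd c q, p) = (q, covec_of M c q p)"
proof (rule inv_into_f_eq[OF inj_on_cotangent_chart[OF assms(1)]])
  show "(q, covec_of M c q p) \<in> dom_chart (cotangent_chart M c)"
    using assms by (simp add: dom_cotangent_chart covec_of_in_cotangent_space)
  show "snd (cotangent_chart M c) (q, covec_of M c q p) = (snd c q, p)"
    using assms by (simp add: cotangent_chart_apply covec_coord_of)
qed

lemma cotangent_chart_imageE:
  assumes "c \<in> M" "x \<in> snd (cotangent_chart M c) ` dom_chart (cotangent_chart M c)"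
  obtains q \<alpha> where "q \<in> dom_chart c" "\<alpha> \<in> cotangent_space M q" "x = (snd c q, covec_coord M c q \<alpha>)"
    "chart_inv (cotangent_chart M c) x = (q, \<alpha>)"
proof -
  from assms(2) obtain s where s: "s \<in> dom_chart (cotangent_chart M c)" "x = snd (cotangent_chart M c) s" by blast
  obtain q \<alpha> where "s = (q, \<alpha>)" by (metis surj_pair)
  then have "q \<in> dom_chart c" "\<alpha> \<in> cotangent_space M q" "x = (snd c q, covec_coord M c q \<alpha>)"
    using s by (simp_all add: dom_cotangent_chart cotangent_chart_apply)
  moreover from this have "chart_inv (cotangent_chart M c) x = (q, \<alpha>)"
    using chart_inv_cotangent_chart[OF assms(1)] covec_of_coord[OF assms(1)] by simp
  ultimately show ?thesis by (rule that)
qed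

lemma cotangent_overlap_image:
  assumes "c \<in> M" "d \<in> M"
  shows "snd (cotangent_chart M c) ` (dom_chart (cotangent_chart M c) \<inter> dom_chart (cotangent_chart M d))
    = snd c ` (dom_chart c \<inter> dom_chart d) \<times> UNIV"
proof -
  have "dom_chart (cotangent_chart M c) \<inter> dom_chart (cotangent_chart M d)
      = (SIGMA q : dom_chart c \<inter> dom_chart d. cotangent_space M q)"
    by (auto simp: dom_cotangent_chart)
  then show ?thesis using cotangent_chart_image[OF assms(1), of "dom_chart c \<inter> dom_chart d"] by simp
qed

lemma open_cotangent_chart_image:
  assumes "c \<in> M"
  shows "open (snd (cotangent_chart M c) ` dom_chart (cotangent_chart M c))"
  using cotangent_overlap_image[OF assms assms] open_chart_image[OF M assms] by (simp add: open_Times)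

text \<open>The fibre coordinate \<open>p\<close> becomes \<open>p\<close> composed with the
  derivative of the inverse transition \<open>\<sigma>\<close>, taken at \<open>\<tau> x\<close>. On
  a fixed vector this is a bilinear expression in smooth data, and \<open>smooth_on_Blinfun\<close>
  passes from these values to the functional.\<close>

lemma smooth_on_cotangent_transition:
  assumes c: "c \<in> M" and d: "d \<in> M"
  shows "smooth_on (snd c ` (dom_chart c \<inter> dom_chart d) \<times> UNIV)
    (snd (cotangent_chart M d) \<circ> chart_inv (cotangent_chart M c))"
proof -
  define X where "X = snd c ` (dom_chart c \<inter> dom_chart d)"
  define Y where "Y = snd d ` (dom_chart d \<inter> dom_chart c)"
  define \<tau> where "\<tau> = snd d \<circ> chart_inv c"
  define \<sigma> where "\<sigma> = snd c \<circ> chart_inv d"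
  let ?W = "X \<times> (UNIV :: ('e \<Rightarrow>\<^sub>L real) set)"
  have oX: "open X" and oY: "open Y"
    unfolding X_def Y_def by (intro open_chart_overlap[OF M] c d)+
  then have oW: "open ?W" by (simp add: open_Times)
  have s\<tau>: "smooth_on X \<tau>" unfolding X_def \<tau>_def by (rule smooth_on_transition[OF M c d])
  have s\<sigma>: "smooth_on Y \<sigma>" unfolding Y_def \<sigma>_def by (rule smooth_on_transition[OF M d c])
  have \<tau>XY: "\<tau> ` X \<subseteq> Y" by (auto simp: \<tau>_def X_def Y_def chart_inv_chart[OF M c])
  note fd = smooth_atlas_fin_dim[OF M]
  have sfst: "smooth_on ?W fst" and ssnd: "smooth_on ?W snd"
    by (intro smooth_on_bounded_linear bounded_linear_fst bounded_linear_snd)+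
  have s\<tau>': "smooth_on ?W (\<lambda>z. \<tau> (fst z))"
    by (rule smooth_on_compose[OF fd oW oX _ sfst s\<tau>]) auto
  have der: "smooth_on ?W (\<lambda>z. frechet_derivative \<sigma> (at (\<tau> (fst z))) e)" for e
    by (rule smooth_on_compose[OF fd oW oY _ s\<tau>' smooth_on_frechet_derivative[OF s\<sigma>]])
      (use \<tau>XY in auto)
  have "smooth_on ?W (\<lambda>z. Blinfun (\<lambda>e. blinfun_apply (snd z) (frechet_derivative \<sigma> (at (\<tau> (fst z))) e)))"
  proof (rule smooth_on_Blinfun[OF fd oW])
    show "linear (\<lambda>e. blinfun_apply (snd z) (frechet_derivative \<sigma> (at (\<tau> (fst z))) e))" if "z \<in> ?W" for z
    proof -
      have "\<tau> (fst z) \<in> Y" using that \<tau>XY by auto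
      then have "linear (frechet_derivative \<sigma> (at (\<tau> (fst z))))"
        by (rule has_derivative_linear[OF smooth_on_has_derivative[OF s\<sigma>]])
      then show ?thesis
        by (intro linearI) (simp_all add: linear_add linear_scale blinfun.add_right blinfun.scaleR_right)
    qed
    show "smooth_on ?W (\<lambda>z. blinfun_apply (snd z) (frechet_derivative \<sigma> (at (\<tau> (fst z))) e))" for e
      by (rule smooth_on_bilinear[OF bounded_bilinear_blinfun_apply oW ssnd der])
  qed
  with s\<tau>' have "smooth_on ?W (\<lambda>z. (\<tau> (fst z), Blinfun (\<lambda>e. blinfun_apply (snd z) (frechet_derivative \<sigma> (at (\<tau> (fst z))) e))))"
    by (rule smooth_on_Pair[OF oW])
  then have "smooth_on ?W (snd (cotangent_chart M d) \<circ> chart_inv (cotangent_chart M c))"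
  proof (rule smooth_on_cong[OF oW, rotated])
    fix z assume "z \<in> ?W"
    then obtain q p where q: "q \<in> dom_chart c" "q \<in> dom_chart d" and z: "z = (snd c q, p)"
      by (auto simp: X_def)
    have "\<tau> (snd c q) = snd d q" by (simp add: \<tau>_def chart_inv_chart[OF M c q(1)])
    then show "(\<tau> (fst z), Blinfun (\<lambda>e. blinfun_apply (snd z) (frechet_derivative \<sigma> (at (\<tau> (fst z))) e)))
        = (snd (cotangent_chart M d) \<circ> chart_inv (cotangent_chart M c)) z"
      by (simp add: z chart_inv_cotangent_chart[OF c q(1)] cotangent_chart_apply covec_coord_def
          covec_of_coord_vector[OF c d q] local_deriv_id \<sigma>_def)
  qed
  then show ?thesis by (simp only: X_def)
qed

lemma smooth_atlas_cotangent_bundle: "smooth_atlas (cotangent_bundle M)"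
  unfolding smooth_atlas_def
proof (intro conjI ballI)
  show "fin_dim TYPE('e \<times> ('e \<Rightarrow>\<^sub>L real))"
    by (intro fin_dim_prod fin_dim_dual smooth_atlas_fin_dim[OF M])
  fix C assume "C \<in> cotangent_bundle M"
  then obtain c where c: "c \<in> M" "C = cotangent_chart M c" by (auto simp: cotangent_bundle_def)
  show "inj_on (snd C) (dom_chart C)" "open (snd C ` dom_chart C)"
    unfolding c by (rule inj_on_cotangent_chart[OF c(1)], rule open_cotangent_chart_image[OF c(1)])
  fix D assume "D \<in> cotangent_bundle M"
  then obtain d where d: "d \<in> M" "D = cotangent_chart M d" by (auto simp: cotangent_bundle_def)
  show "open (snd C ` (dom_chart C \<inter> dom_chart D))"
    unfolding c d cotangent_overlap_image[OF c(1) d(1)]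
    by (intro open_Times open_chart_overlap[OF M] c d open_UNIV)
  show "smooth_on (snd C ` (dom_chart C \<inter> dom_chart D)) (snd D \<circ> chart_inv C)"
    unfolding c d cotangent_overlap_image[OF c(1) d(1)] by (rule smooth_on_cotangent_transition[OF c(1) d(1)])
qed

lemma smooth_map_fst_cotangent_bundle: "smooth_map (cotangent_bundle M) M fst"
proof (rule smooth_mapI[OF smooth_atlas_cotangent_bundle M])
  fix p assume "p \<in> points (cotangent_bundle M)"
  then have "fst p \<in> points M" and p: "snd p \<in> cotangent_space M (fst p)"
    by (auto simp: points_cotangent_bundle)
  then obtain c where c: "c \<in> M" "fst p \<in> dom_chart c" by (auto elim: pointsE)
  let ?C = "cotangent_chart M c"
  let ?U = "snd ?C ` dom_chart ?C"
  have "smooth_on ?U (fst :: 'e \<times> ('e \<Rightarrow>\<^sub>L real) \<Rightarrow> 'e)"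
    by (rule smooth_on_bounded_linear[OF bounded_linear_fst])
  then have "smooth_on ?U (snd c \<circ> fst \<circ> chart_inv ?C)"
    by (rule smooth_on_cong[OF open_cotangent_chart_image[OF c(1)], rotated])
      (elim cotangent_chart_imageE[OF c(1)], simp)
  moreover have "p \<in> dom_chart ?C" using c p by (cases p) (simp add: dom_cotangent_chart)
  moreover have "(fst \<circ> chart_inv ?C) ` ?U \<subseteq> dom_chart c"
  proof
    fix y assume "y \<in> (fst \<circ> chart_inv ?C) ` ?U"
    then obtain x where "x \<in> ?U" and y: "y = fst (chart_inv ?C x)" by auto
    from this(1) show "y \<in> dom_chart c" by (rule cotangent_chart_imageE[OF c(1)]) (simp add: y)
  qed
  ultimately show "\<exists>C\<in>cotangent_bundle M. \<exists>d\<in>M. \<exists>U. p \<in> dom_chart C \<and> open U \<and> snd C p \<in> U \<and>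
      U \<subseteq> snd C ` dom_chart C \<and> (fst \<circ> chart_inv C) ` U \<subseteq> dom_chart d \<and>
      smooth_on U (snd d \<circ> fst \<circ> chart_inv C)"
    using c cotangent_chart_in[OF c(1)] open_cotangent_chart_image[OF c(1)] by blast
qed

section \<open>The Liouville and symplectic forms in bundle coordinates\<close>

lemma local_deriv_fst:
  assumes c: "c \<in> M" "fst p \<in> dom_chart c" "snd p \<in> cotangent_space M (fst p)"
  shows "local_deriv fst (cotangent_chart M c) c p E = fst E"
proof -
  let ?C = "cotangent_chart M c"
  have p: "p \<in> dom_chart ?C" using c by (cases p) (simp add: dom_cotangent_chart)
  have "((snd c \<circ> fst \<circ> chart_inv ?C) has_derivative fst) (at (snd ?C p))"
  proof (rule has_derivative_transform_within_open[OF _ open_cotangent_chart_image[OF c(1)]])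
    show "(fst has_derivative fst) (at (snd ?C p))" by (intro derivative_intros)
    show "snd ?C p \<in> snd ?C ` dom_chart ?C" using p by blast
    show "fst x = (snd c \<circ> fst \<circ> chart_inv ?C) x" if "x \<in> snd ?C ` dom_chart ?C" for x
      using that by (elim cotangent_chart_imageE[OF c(1)]) simp
  qed
  then show ?thesis unfolding local_deriv_def by (metis frechet_derivative_at)
qed

text \<open>This is the classical formula p dx: in bundle coordinates the projection keeps the first
  component, and so does its derivative.\<close>

lemma liouville_form_coord:
  assumes c: "c \<in> M" "q \<in> dom_chart c" and \<alpha>: "\<alpha> \<in> cotangent_space M q"
  shows "liouville_form M (q, \<alpha>) (coord_vector (cotangent_bundle M) (cotangent_chart M c) (q, \<alpha>) E)
    = covec_coord M c q \<alpha> (fst E)"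
proof -
  let ?C = "cotangent_chart M c" and ?X = "coord_vector (cotangent_bundle M) (cotangent_chart M c) (q, \<alpha>) E"
  note T = smooth_atlas_cotangent_bundle
  have C: "?C \<in> cotangent_bundle M" "(q, \<alpha>) \<in> dom_chart ?C"
    using c \<alpha> by (auto simp: cotangent_chart_in dom_cotangent_chart)
  have "tangent_map (cotangent_bundle M) M fst (q, \<alpha>) ?X
      = coord_vector M c q (local_deriv fst ?C c (q, \<alpha>) (?X ?C))"
    using tangent_map_eq_coord_vector[OF T M smooth_map_fst_cotangent_bundle dom_chart_points[OF C]
        coord_vector_in_tangent_space[OF T C] C c(1)] c by simp
  also have "\<dots> = coord_vector M c q (fst E)"
    using c \<alpha> by (simp add: coord_vector_self[OF T C] local_deriv_fst)
  finally show ?thesis by (simp add: liouville_form_def covec_coord_apply[OF c \<alpha>])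
qed

text \<open>The coefficients of the Liouville form are linear in the fibre coordinate and
  independent of the base coordinate, so their derivatives are immediate and give the standard form
  dx wedge dp. The premise \<open>C\<close> ties \<open>c\<close> to the chart in which
  \<open>ext_deriv\<close> is evaluated.\<close>

lemma canonical_symplectic_form_coord:
  assumes c: "c \<in> M" "q \<in> dom_chart c" and \<alpha>: "\<alpha> \<in> cotangent_space M q"
    and C: "chart_at (cotangent_bundle M) (q, \<alpha>) = cotangent_chart M c"
  shows "canonical_symplectic_form M (q, \<alpha>) X Y =
    blinfun_apply (snd (Y (cotangent_chart M c))) (fst (X (cotangent_chart M c)))
    - blinfun_apply (snd (X (cotangent_chart M c))) (fst (Y (cotangent_chart M c)))"
proof -
  let ?C = "cotangent_chart M c"
  define a where "a E x = liouville_form M (chart_inv ?C x) (coord_vector (cotangent_bundle M) ?C (chart_inv ?C x) E)"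
    for E x
  have "(a E has_derivative (\<lambda>Z. blinfun_apply (snd Z) (fst E))) (at (snd ?C (q, \<alpha>)))" for E
  proof (rule has_derivative_transform_within_open[OF _ open_cotangent_chart_image[OF c(1)]])
    show "((\<lambda>x. blinfun_apply (snd x) (fst E)) has_derivative (\<lambda>Z. blinfun_apply (snd Z) (fst E))) (at (snd ?C (q, \<alpha>)))"
      by (intro bounded_linear_imp_has_derivative bounded_linear_compose[OF blinfun.bounded_linear_left bounded_linear_snd])
    show "snd ?C (q, \<alpha>) \<in> snd ?C ` dom_chart ?C" using c \<alpha> by (auto simp: dom_cotangent_chart)
    fix x assume "x \<in> snd ?C ` dom_chart ?C"
    then show "blinfun_apply (snd x) (fst E) = a E x"
      by (rule cotangent_chart_imageE[OF c(1)]) (simp add: a_def liouville_form_coord[OF c(1)])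
  qed
  then have "frechet_derivative (a E) (at (snd ?C (q, \<alpha>))) = (\<lambda>Z. blinfun_apply (snd Z) (fst E))" for E
    by (rule frechet_derivative_at[symmetric])
  then show ?thesis
    by (simp add: canonical_symplectic_form_def ext_deriv_def C Let_def flip: a_def)
qed

end

text \<open>All covectors at \<open>q\<close> lie in the same bundle charts, so \<open>chart_at\<close> selects the same chart for
  all of them. It need not be the one induced by \<open>chart_at M q\<close>.\<close>

lemma chart_at_cotangent_bundle:
  assumes "q \<in> points M"
  obtains c where "c \<in> M" "q \<in> dom_chart c"
    "\<And>\<alpha>. \<alpha> \<in> cotangent_space M q \<Longrightarrow> chart_at (cotangent_bundle M) (q, \<alpha>) = cotangent_chart M c"
proof -
  \<comment> \<open>The selection condition mentions only \<open>q\<close>, so this chart can be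
    fixed before any covector is chosen.\<close>
  define C where "C = (SOME C. C \<in> cotangent_bundle M \<and> q \<in> fst ` dom_chart C)"
  have zero: "(\<lambda>_. 0) \<in> cotangent_space M r" for r by (simp add: cotangent_space_def)
  have iff: "(q, \<alpha>) \<in> dom_chart D \<longleftrightarrow> q \<in> fst ` dom_chart D"
    if "D \<in> cotangent_bundle M" "\<alpha> \<in> cotangent_space M q" for D \<alpha>
    using that by (force simp: cotangent_bundle_def dom_cotangent_chart)
  have "chart_at (cotangent_bundle M) (q, \<alpha>) = C" if "\<alpha> \<in> cotangent_space M q" for \<alpha>
    unfolding chart_at_def C_def using iff[OF _ that] by (intro arg_cong[where f = Eps] ext) blast
  moreover have "\<exists>C. C \<in> cotangent_bundle M \<and> q \<in> fst ` dom_chart C"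
  proof -
    obtain d where d: "d \<in> M" "q \<in> dom_chart d" using assms by (rule pointsE)
    then have "(q, \<lambda>_. 0) \<in> dom_chart (cotangent_chart M d)"
      using zero by (simp add: dom_cotangent_chart)
    then show ?thesis using d cotangent_chart_in by (metis fst_conv imageI)
  qed
  then have "C \<in> cotangent_bundle M \<and> q \<in> fst ` dom_chart C" unfolding C_def by (rule someI_ex)
  then obtain c where "c \<in> M" "q \<in> dom_chart c" "C = cotangent_chart M c"
    by (auto simp: cotangent_bundle_def dom_cotangent_chart)
  ultimately show ?thesis using that by blast
qed

section \<open>Exterior derivatives of one-forms in charts\<close>

lemma one_form_in_cotangent_space:
  assumes M: "smooth_atlas M" and \<alpha>: "one_form M \<alpha>" and q: "q \<in> points M"
  shows "\<alpha> q \<in> cotangent_space M q"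
  using smooth_map_points[OF M smooth_atlas_cotangent_bundle[OF M] \<alpha>[unfolded one_form_def] q]
  by (simp add: points_cotangent_bundle)

lemma smooth_on_one_form:
  assumes M: "smooth_atlas M" and \<alpha>: "one_form M \<alpha>" and c: "c \<in> M"
  shows "smooth_on (snd c ` dom_chart c) (\<lambda>y. covec_coord M c (chart_inv c y) (\<alpha> (chart_inv c y)))"
proof -
  let ?C = "cotangent_chart M c" and ?s = "\<lambda>q. (q, \<alpha> q)"
  have "dom_chart c \<inter> ?s -` dom_chart ?C = dom_chart c"
    using one_form_in_cotangent_space[OF M \<alpha> dom_chart_points[OF c]] by (auto simp: dom_cotangent_chart)
  then have "smooth_on (snd c ` dom_chart c) (snd ?C \<circ> ?s \<circ> chart_inv c)"
    using smooth_map_smooth_on[OF \<alpha>[unfolded one_form_def] c cotangent_chart_in[OF c]] by simp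
  from smooth_on_bounded_linear_compose[OF bounded_linear_snd open_chart_image[OF M c] this]
  show ?thesis by (simp add: cotangent_chart_apply)
qed

text \<open>Chart independence of the exterior derivative: the expression in the chart picked by
  \<open>chart_at\<close> is the pullback of \<open>a\<close> along a transition map, so
  \<open>pullback_derivative_antisym\<close> applies. It is used with the base chart that underlies
  the chart picked on the cotangent bundle.\<close>

lemma ext_deriv_eq:
  fixes M :: "('q, 'e::real_normed_vector) atlas"
  assumes M: "smooth_atlas M" and \<alpha>: "one_form M \<alpha>" and c: "c \<in> M" "q \<in> dom_chart c"
    and v: "v \<in> tangent_space M q" and w: "w \<in> tangent_space M q"
  defines "a \<equiv> \<lambda>y. covec_coord M c (chart_inv c y) (\<alpha> (chart_inv c y))"
  shows "ext_deriv M \<alpha> q v w = frechet_derivative a (at (snd c q)) (v c) (w c)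
    - frechet_derivative a (at (snd c q)) (w c) (v c)"
proof -
  define b where "b = chart_at M q"
  have b: "b \<in> M" "q \<in> dom_chart b"
    unfolding b_def by (rule chart_at[OF M dom_chart_points[OF c]])+
  define X where "X = snd b ` (dom_chart b \<inter> dom_chart c)"
  define \<tau> where "\<tau> = snd c \<circ> chart_inv b"
  have oX: "open X" unfolding X_def by (rule open_chart_overlap[OF M b(1) c(1)])
  have s\<tau>: "smooth_on X \<tau>" unfolding X_def \<tau>_def by (rule smooth_on_transition[OF M b(1) c(1)])
  have sa: "smooth_on (snd c ` dom_chart c) a"
    unfolding a_def by (rule smooth_on_one_form[OF M \<alpha> c(1)])
  have x0: "snd b q \<in> X" using b c by (simp add: X_def)
  have \<tau>0: "\<tau> (snd b q) = snd c q" by (simp add: \<tau>_def chart_inv_chart[OF M b])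
  have "(a has_derivative frechet_derivative a (at (snd c q))) (at (\<tau> (snd b q)))"
    unfolding \<tau>0 by (rule smooth_on_has_derivative[OF sa]) (use c in blast)
  from has_derivative_compose[OF smooth_on_has_derivative[OF s\<tau> x0] this]
  have der: "((\<lambda>x. a (\<tau> x)) has_derivative
      (\<lambda>v. frechet_derivative a (at (snd c q)) (frechet_derivative \<tau> (at (snd b q)) v))) (at (snd b q))" .
  \<comment> \<open>Moving the coordinate vector from \<open>b\<close> to \<open>c\<close> exhibits
    the local coefficients as those of a pullback along \<open>\<tau>\<close>.\<close>
  have eq: "a (\<tau> x) (frechet_derivative \<tau> (at x) e) = \<alpha> (chart_inv b x) (coord_vector M b (chart_inv b x) e)"
    if x: "x \<in> X" for x e
  proof -
    obtain r where r: "r \<in> dom_chart b" "r \<in> dom_chart c" "x = snd b r"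
      using x by (auto simp: X_def)
    have "coord_vector M b r e = coord_vector M c r (frechet_derivative \<tau> (at x) e)"
      using coord_vector_change[OF M b(1) c(1) r(1,2)] by (simp add: local_deriv_id \<tau>_def r(3))
    moreover have "\<alpha> r \<in> cotangent_space M r"
      by (rule one_form_in_cotangent_space[OF M \<alpha> dom_chart_points[OF c(1) r(2)]])
    ultimately show ?thesis
      using r by (simp add: a_def \<tau>_def chart_inv_chart[OF M b(1)] chart_inv_chart[OF M c(1)] covec_coord_apply[OF M c(1)])
  qed
  have "frechet_derivative (\<lambda>x. \<alpha> (chart_inv b x) (coord_vector M b (chart_inv b x) e)) (at (snd b q))
      = frechet_derivative (\<lambda>x. a (\<tau> x) (frechet_derivative \<tau> (at x) e)) (at (snd b q))" for e
  proof (rule frechet_derivative_transform_within_open[symmetric, OF _ oX x0])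
    have "((\<lambda>x. a (\<tau> x) (frechet_derivative \<tau> (at x) e)) has_derivative
      (\<lambda>v. a (\<tau> (snd b q)) (frechet_derivative (\<lambda>x. frechet_derivative \<tau> (at x) e) (at (snd b q)) v)
        + frechet_derivative a (at (snd c q)) (frechet_derivative \<tau> (at (snd b q)) v) (frechet_derivative \<tau> (at (snd b q)) e)))
      (at (snd b q))"
      by (rule bounded_bilinear.FDERIV[OF bounded_bilinear_blinfun_apply der
            smooth_on_has_derivative[OF smooth_on_frechet_derivative[OF s\<tau>] x0]])
    then show "(\<lambda>x. a (\<tau> x) (frechet_derivative \<tau> (at x) e)) differentiable at (snd b q)"
      by (rule differentiableI)
  qed (rule eq)
  then have "ext_deriv M \<alpha> q v w =
      frechet_derivative (\<lambda>x. a (\<tau> x) (frechet_derivative \<tau> (at x) (w b))) (at (snd b q)) (v b)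
    - frechet_derivative (\<lambda>x. a (\<tau> x) (frechet_derivative \<tau> (at x) (v b))) (at (snd b q)) (w b)"
    by (simp add: ext_deriv_def Let_def flip: b_def)
  also have "\<dots> = frechet_derivative a (at (snd c q)) (frechet_derivative \<tau> (at (snd b q)) (v b)) (frechet_derivative \<tau> (at (snd b q)) (w b))
    - frechet_derivative a (at (snd c q)) (frechet_derivative \<tau> (at (snd b q)) (w b)) (frechet_derivative \<tau> (at (snd b q)) (v b))"
    by (rule pullback_derivative_antisym[OF oX x0 s\<tau> der])
  also have "frechet_derivative \<tau> (at (snd b q)) (v b) = v c"
    using tangent_spaceD[OF M v b(1) c(1) b(2) c(2)] by (simp add: local_deriv_id \<tau>_def)
  also have "frechet_derivative \<tau> (at (snd b q)) (w b) = w c"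
    using tangent_spaceD[OF M w b(1) c(1) b(2) c(2)] by (simp add: local_deriv_id \<tau>_def)
  finally show ?thesis .
qed

section \<open>Fibered symplectic maps of a cotangent bundle\<close>

text \<open>The image of the zero covector composed with the tangent map of \<open>f\<close>. The
  test on \<open>v\<close> restores the normalisation of covectors, as \<open>tangent_map\<close>
  accepts arguments outside the tangent space.\<close>

definition translation_form ::
    "('q, 'e::real_normed_vector) atlas \<Rightarrow> ('q \<Rightarrow> 'q) \<Rightarrow>
     ('q \<times> ('q, 'e) covector \<Rightarrow> 'q \<times> ('q, 'e) covector) \<Rightarrow> 'q \<Rightarrow> ('q, 'e) covector" where
  "translation_form M f F q =
     (\<lambda>v. if v \<in> tangent_space M q then snd (F (q, \<lambda>_. 0)) (tangent_map M M f q v) else 0)"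

context
  fixes M :: "('q, 'e::real_normed_vector) atlas" and f :: "'q \<Rightarrow> 'q"
    and F :: "'q \<times> ('q, 'e) covector \<Rightarrow> 'q \<times> ('q, 'e) covector"
  assumes M: "smooth_atlas M" and f: "smooth_map M M f"
    and F: "smooth_map (cotangent_bundle M) (cotangent_bundle M) F"
    and fib: "\<And>p. p \<in> points (cotangent_bundle M) \<Longrightarrow> fst (F p) = f (fst p)"
begin

private lemmas T = smooth_atlas_cotangent_bundle[OF M]

lemma fibered_map_snd_in:
  assumes "q \<in> points M" "\<alpha> \<in> cotangent_space M q"
  shows "snd (F (q, \<alpha>)) \<in> cotangent_space M (f q)"
proof -
  have p: "(q, \<alpha>) \<in> points (cotangent_bundle M)" using assms by (simp add: points_cotangent_bundle)
  have "F (q, \<alpha>) \<in> points (cotangent_bundle M)" by (rule smooth_map_points[OF T T F p])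
  then show ?thesis using fib[OF p] by (cases "F (q, \<alpha>)") (simp add: points_cotangent_bundle)
qed

lemma fibered_map_eq:
  assumes "q \<in> points M" "\<alpha> \<in> cotangent_space M q"
  shows "F (q, \<alpha>) = (f q, snd (F (q, \<alpha>)))"
  using fib[of "(q, \<alpha>)"] assms by (simp add: points_cotangent_bundle prod_eq_iff)

lemma fibered_map_dom:
  assumes "q \<in> points M" "\<alpha> \<in> cotangent_space M q" "f q \<in> dom_chart d"
  shows "F (q, \<alpha>) \<in> dom_chart (cotangent_chart M d)"
  using fibered_map_snd_in[OF assms(1,2)] assms(3)
  by (subst fibered_map_eq[OF assms(1,2)]) (simp add: dom_cotangent_chart)

text \<open>Obtained by differentiating \<open>fst (F p) = f (fst p)\<close>. The derivative of
  \<open>F\<close> is thus block triangular: its base component does not see the fibre part of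
  \<open>E\<close>.\<close>

lemma fst_local_deriv_fibered:
  assumes c: "c \<in> M" "q \<in> dom_chart c" and d: "d \<in> M" "f q \<in> dom_chart d" and \<alpha>: "\<alpha> \<in> cotangent_space M q"
  shows "fst (local_deriv F (cotangent_chart M c) (cotangent_chart M d) (q, \<alpha>) E) = local_deriv f c d q (fst E)"
proof -
  let ?C = "cotangent_chart M c" and ?D = "cotangent_chart M d"
  have C: "?C \<in> cotangent_bundle M" "(q, \<alpha>) \<in> dom_chart ?C"
    using c \<alpha> by (auto simp: cotangent_chart_in dom_cotangent_chart)
  note q = dom_chart_points[OF c]
  have D: "?D \<in> cotangent_bundle M" "F (q, \<alpha>) \<in> dom_chart ?D"
    using cotangent_chart_in[OF d(1)] fibered_map_dom[OF q \<alpha> d(2)] by auto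
  have Fq: "fst (F (q, \<alpha>)) = f q" "snd (F (q, \<alpha>)) \<in> cotangent_space M (f q)"
    using fibered_map_eq[OF q \<alpha>] fibered_map_snd_in[OF q \<alpha>] by (metis fst_conv, simp)
  have "fst (local_deriv F ?C ?D (q, \<alpha>) E) = local_deriv fst ?D d (F (q, \<alpha>)) (local_deriv F ?C ?D (q, \<alpha>) E)"
    using d Fq by (simp add: local_deriv_fst[OF M])
  also have "\<dots> = local_deriv (\<lambda>p. fst (F p)) ?C d (q, \<alpha>) E"
    using local_deriv_compose[OF T T F C D M smooth_map_fst_cotangent_bundle[OF M] d(1)] d Fq by simp
  also have "\<dots> = local_deriv (\<lambda>p. f (fst p)) ?C d (q, \<alpha>) E"
    using local_deriv_cong[OF T M smooth_map_compose[OF T M M smooth_map_fst_cotangent_bundle[OF M] f] C d(1), of "\<lambda>p. fst (F p)"]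
      fib d by simp
  also have "\<dots> = local_deriv f c d q (local_deriv fst ?C c (q, \<alpha>) E)"
    using local_deriv_compose[OF T M smooth_map_fst_cotangent_bundle[OF M] C c(1) _ M f d(1)] c d by simp
  also have "local_deriv fst ?C c (q, \<alpha>) E = fst E"
    using c \<alpha> by (simp add: local_deriv_fst[OF M])
  finally show ?thesis .
qed

lemma translation_form_in:
  assumes q: "q \<in> points M"
  shows "translation_form M f F q \<in> cotangent_space M q"
proof -
  have \<beta>: "snd (F (q, \<lambda>_. 0)) \<in> cotangent_space M (f q)"
    by (rule fibered_map_snd_in[OF q zero_in_cotangent_space[OF M]])
  note t = tangent_map_in_tangent_space[OF M M f q]
  show ?thesis
    unfolding cotangent_space_def translation_form_def
  proof (rule CollectI, intro conjI ballI allI impI)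
    fix v w assume v: "v \<in> tangent_space M q" and w: "w \<in> tangent_space M q"
    show "(if (\<lambda>c. v c + w c) \<in> tangent_space M q then snd (F (q, \<lambda>_. 0)) (tangent_map M M f q (\<lambda>c. v c + w c)) else 0)
      = (if v \<in> tangent_space M q then snd (F (q, \<lambda>_. 0)) (tangent_map M M f q v) else 0)
      + (if w \<in> tangent_space M q then snd (F (q, \<lambda>_. 0)) (tangent_map M M f q w) else 0)"
      using v w \<beta> t[OF v] t[OF w] tangent_space_add[OF M q v w]
      by (simp add: tangent_map_add[OF M M f q v w] cotangent_space_def)
  next
    fix r v assume v: "v \<in> tangent_space M q"
    show "(if (\<lambda>c. r *\<^sub>R v c) \<in> tangent_space M q then snd (F (q, \<lambda>_. 0)) (tangent_map M M f q (\<lambda>c. r *\<^sub>R v c)) else 0)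
      = r * (if v \<in> tangent_space M q then snd (F (q, \<lambda>_. 0)) (tangent_map M M f q v) else 0)"
      using v \<beta> t[OF v] tangent_space_scale[OF M q v]
      by (simp add: tangent_map_scale[OF M M f q v] cotangent_space_def)
  qed simp
qed

text \<open>Links the chart-free definition to local coordinates, both for closedness and for smooth
  dependence on the group element.\<close>

lemma covec_coord_translation_form:
  assumes c: "c \<in> M" "q \<in> dom_chart c" and d: "d \<in> M" "f q \<in> dom_chart d"
  shows "covec_coord M c q (translation_form M f F q) e
    = covec_coord M d (f q) (snd (F (q, \<lambda>_. 0))) (local_deriv f c d q e)"
proof -
  note q = dom_chart_points[OF c]
  have "covec_coord M c q (translation_form M f F q) e
      = snd (F (q, \<lambda>_. 0)) (tangent_map M M f q (coord_vector M c q e))"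
    unfolding covec_coord_apply[OF M c translation_form_in[OF q]]
    by (simp add: translation_form_def coord_vector_in_tangent_space[OF M c])
  also have "tangent_map M M f q (coord_vector M c q e) = coord_vector M d (f q) (local_deriv f c d q e)"
    using tangent_map_eq_coord_vector[OF M M f q coord_vector_in_tangent_space[OF M c] c d]
    by (simp add: coord_vector_self[OF M c])
  also have "snd (F (q, \<lambda>_. 0)) \<dots> = covec_coord M d (f q) (snd (F (q, \<lambda>_. 0))) (local_deriv f c d q e)"
    by (rule covec_coord_apply[OF M d fibered_map_snd_in[OF q zero_in_cotangent_space[OF M]], symmetric])
  finally show ?thesis .
qed

section \<open>Consequences of preserving the symplectic form\<close>

context
  assumes symp: "\<And>p X Y. p \<in> points (cotangent_bundle M) \<Longrightarrow> X \<in> tangent_space (cotangent_bundle M) p \<Longrightarrow>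
    Y \<in> tangent_space (cotangent_bundle M) p \<Longrightarrow>
    pullback2 (cotangent_bundle M) (cotangent_bundle M) F (canonical_symplectic_form M) p X Y
      = canonical_symplectic_form M p X Y"
begin

text \<open>Invariance of the symplectic form as an identity between coordinate vectors. The
  premises \<open>C\<close> and \<open>D\<close> range over whole fibres because the identity is
  used at varying covectors over the same base point.\<close>

lemma symplectic_coord:
  assumes c: "c \<in> M" "q \<in> dom_chart c" and d: "d \<in> M" "f q \<in> dom_chart d"
    and C: "\<And>\<alpha>. \<alpha> \<in> cotangent_space M q \<Longrightarrow> chart_at (cotangent_bundle M) (q, \<alpha>) = cotangent_chart M c"
    and D: "\<And>\<alpha>. \<alpha> \<in> cotangent_space M (f q) \<Longrightarrow> chart_at (cotangent_bundle M) (f q, \<alpha>) = cotangent_chart M d"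
    and \<alpha>: "\<alpha> \<in> cotangent_space M q"
  defines "L \<equiv> local_deriv F (cotangent_chart M c) (cotangent_chart M d) (q, \<alpha>)"
  shows "blinfun_apply (snd (L E')) (local_deriv f c d q (fst E)) - blinfun_apply (snd (L E)) (local_deriv f c d q (fst E'))
    = blinfun_apply (snd E') (fst E) - blinfun_apply (snd E) (fst E')"
proof -
  let ?C = "cotangent_chart M c" and ?D = "cotangent_chart M d"
  let ?V = "coord_vector (cotangent_bundle M) ?C (q, \<alpha>)"
  let ?t = "tangent_map (cotangent_bundle M) (cotangent_bundle M) F (q, \<alpha>)"
  note q = dom_chart_points[OF c]
  have inC: "?C \<in> cotangent_bundle M" "(q, \<alpha>) \<in> dom_chart ?C"
    using c \<alpha> by (auto simp: cotangent_chart_in dom_cotangent_chart)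
  have inD: "?D \<in> cotangent_bundle M" "F (q, \<alpha>) \<in> dom_chart ?D"
    using cotangent_chart_in[OF d(1)] fibered_map_dom[OF q \<alpha> d(2)] by auto
  note V = coord_vector_in_tangent_space[OF T inC]
  have VC: "?V E ?C = E" for E by (rule coord_vector_self[OF T inC])
  have tD: "?t (?V E) ?D = L E" for E
    using tangent_map_apply[OF T T F dom_chart_points[OF inC] V inC inD] by (simp add: VC L_def)
  have "canonical_symplectic_form M (F (q, \<alpha>)) (?t (?V E)) (?t (?V E')) = canonical_symplectic_form M (q, \<alpha>) (?V E) (?V E')"
    using symp[OF dom_chart_points[OF inC] V V] by (simp add: pullback2_def)
  also have "canonical_symplectic_form M (q, \<alpha>) (?V E) (?V E') = blinfun_apply (snd E') (fst E) - blinfun_apply (snd E) (fst E')"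
    by (simp add: canonical_symplectic_form_coord[OF M c \<alpha> C[OF \<alpha>]] VC)
  also have "canonical_symplectic_form M (F (q, \<alpha>)) (?t (?V E)) (?t (?V E'))
      = blinfun_apply (snd (L E')) (fst (L E)) - blinfun_apply (snd (L E)) (fst (L E'))"
  proof -
    obtain \<beta> where F\<beta>: "F (q, \<alpha>) = (f q, \<beta>)" and \<beta>: "\<beta> \<in> cotangent_space M (f q)"
      using fibered_map_eq[OF q \<alpha>] fibered_map_snd_in[OF q \<alpha>] by blast
    show ?thesis
      unfolding F\<beta> canonical_symplectic_form_coord[OF M d \<beta> D[OF \<beta>]] tD ..
  qed
  finally show ?thesis
    by (simp add: L_def fst_local_deriv_fibered[OF c d \<alpha>])
qed

lemma symplectic_fiber_affine:
  assumes q: "q \<in> points M" and \<alpha>: "\<alpha> \<in> cotangent_space M q" and v: "v \<in> tangent_space M q"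
  shows "snd (F (q, \<alpha>)) (tangent_map M M f q v) = \<alpha> v + translation_form M f F q v"
proof -
  obtain c where c: "c \<in> M" "q \<in> dom_chart c"
    and C: "\<And>\<alpha>. \<alpha> \<in> cotangent_space M q \<Longrightarrow> chart_at (cotangent_bundle M) (q, \<alpha>) = cotangent_chart M c"
    using chart_at_cotangent_bundle[OF q] by metis
  obtain d where d: "d \<in> M" "f q \<in> dom_chart d"
    and D: "\<And>\<alpha>. \<alpha> \<in> cotangent_space M (f q) \<Longrightarrow> chart_at (cotangent_bundle M) (f q, \<alpha>) = cotangent_chart M d"
    using chart_at_cotangent_bundle[OF smooth_map_points[OF M M f q]] by metis
  let ?C = "cotangent_chart M c" and ?D = "cotangent_chart M d"
  define w where "w = local_deriv f c d q (v c)"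
  define G where "G = snd ?D \<circ> F \<circ> chart_inv ?C"
  \<comment> \<open>For a fixed tangent vector \<open>v\<close>, \<open>h\<close> is the defect
    between the image covector pulled back along \<open>f\<close> and the original covector, as a
    function of the fibre coordinate \<open>p\<close>. The affine law says that it is
    constant.\<close>
  define h where "h p = blinfun_apply (snd (G (snd c q, p))) w - blinfun_apply p (v c)" for p
  have "(h has_derivative (\<lambda>_. 0)) (at p)" for p
  proof -
    define \<beta> where "\<beta> = covec_of M c q p"
    have \<beta>: "\<beta> \<in> cotangent_space M q" unfolding \<beta>_def by (rule covec_of_in_cotangent_space[OF M c])
    have inC: "?C \<in> cotangent_bundle M" "(q, \<beta>) \<in> dom_chart ?C"
      using c \<beta> by (auto simp: cotangent_chart_in dom_cotangent_chart)
    have inD: "?D \<in> cotangent_bundle M" "F (q, \<beta>) \<in> dom_chart ?D"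
      using cotangent_chart_in[OF d(1)] fibered_map_dom[OF q \<beta> d(2)] by auto
    define L where "L = local_deriv F ?C ?D (q, \<beta>)"
    have "(G has_derivative L) (at (snd ?C (q, \<beta>)))"
      unfolding G_def L_def by (rule has_derivative_local_deriv[OF T T F inC inD])
    then have "(G has_derivative L) (at (snd c q, p))"
      by (simp add: cotangent_chart_apply \<beta>_def covec_coord_of[OF M c])
    moreover have "((\<lambda>p. (snd c q, p)) has_derivative (\<lambda>\<eta>. (0, \<eta>))) (at p)"
      by (intro has_derivative_Pair has_derivative_const has_derivative_ident)
    ultimately have "((\<lambda>p. G (snd c q, p)) has_derivative (\<lambda>\<eta>. L (0, \<eta>))) (at p)"
      by (rule has_derivative_compose[rotated])
    then have "((\<lambda>p. blinfun_apply (snd (G (snd c q, p))) w) has_derivative (\<lambda>\<eta>. blinfun_apply (snd (L (0, \<eta>))) w)) (at p)"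
      by (intro bounded_linear.has_derivative[OF blinfun.bounded_linear_left] has_derivative_snd)
    then have "(h has_derivative (\<lambda>\<eta>. blinfun_apply (snd (L (0, \<eta>))) w - blinfun_apply \<eta> (v c))) (at p)"
      unfolding h_def
      by (intro has_derivative_diff bounded_linear_imp_has_derivative blinfun.bounded_linear_left)
    \<comment> \<open>The vertical vector \<open>(0, \<eta>)\<close> has zero base part, which the
      derivative of \<open>f\<close> keeps zero, so the second term on each side of the symplectic
      identity drops out.\<close>
    moreover have "blinfun_apply (snd (L (0, \<eta>))) w = blinfun_apply \<eta> (v c)" for \<eta>
      using symplectic_coord[OF c d C D \<beta>, of "(v c, 0)" "(0, \<eta>)"]
      by (simp add: w_def L_def linear_0[OF linear_local_deriv[OF M M f c d]] blinfun.zero_left blinfun.zero_right)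
    ultimately show ?thesis by simp
  qed
  \<comment> \<open>The fibre corresponds to the whole dual space, which is convex, so a vanishing
    derivative forces constancy. Comparison with the zero covector then produces
    \<open>translation_form\<close>.\<close>
  then have const: "h p = h 0" for p
    using has_derivative_zero_unique[of UNIV h p 0] by simp
  have G: "snd (G (snd c q, covec_coord M c q \<beta>)) = covec_coord M d (f q) (snd (F (q, \<beta>)))"
    if "\<beta> \<in> cotangent_space M q" for \<beta>
    by (simp add: G_def chart_inv_cotangent_chart[OF M c] covec_of_coord[OF M c that])
      (subst fibered_map_eq[OF q that], simp add: cotangent_chart_apply)
  have tm: "tangent_map M M f q v = coord_vector M d (f q) w"
    unfolding w_def by (rule tangent_map_eq_coord_vector[OF M M f q v c d])
  have h: "h (covec_coord M c q \<beta>) = snd (F (q, \<beta>)) (tangent_map M M f q v) - \<beta> v"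
    if "\<beta> \<in> cotangent_space M q" for \<beta>
    unfolding h_def G[OF that] tm covec_coord_apply[OF M d fibered_map_snd_in[OF q that]]
    using covector_eq_coord[OF M c that v] by simp
  show ?thesis
    using h[OF \<alpha>] h[OF zero_in_cotangent_space[OF M]] const[of "covec_coord M c q \<alpha>"]
      const[of "covec_coord M c q (\<lambda>_. 0)"] v
    by (simp add: translation_form_def)
qed

text \<open>Geometrically, the zero section is isotropic and \<open>F\<close> maps it to an
  isotropic set. The premise \<open>one\<close> supplies differentiable coefficients; for an action
  it comes from joint smoothness in the group element and the base point.\<close>

lemma translation_form_closed:
  assumes one: "one_form M (translation_form M f F)"
  shows "closed_one_form M (translation_form M f F)"
  unfolding closed_one_form_def
proof (intro conjI ballI one)
  fix q v w assume q: "q \<in> points M" and v: "v \<in> tangent_space M q" and w: "w \<in> tangent_space M q"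
  obtain c where c: "c \<in> M" "q \<in> dom_chart c"
    and C: "\<And>\<alpha>. \<alpha> \<in> cotangent_space M q \<Longrightarrow> chart_at (cotangent_bundle M) (q, \<alpha>) = cotangent_chart M c"
    using chart_at_cotangent_bundle[OF q] by metis
  obtain d where d: "d \<in> M" "f q \<in> dom_chart d"
    and D: "\<And>\<alpha>. \<alpha> \<in> cotangent_space M (f q) \<Longrightarrow> chart_at (cotangent_bundle M) (f q, \<alpha>) = cotangent_chart M d"
    using chart_at_cotangent_bundle[OF smooth_map_points[OF M M f q]] by metis
  let ?C = "cotangent_chart M c" and ?D = "cotangent_chart M d"
  define a where "a y = covec_coord M c (chart_inv c y) (translation_form M f F (chart_inv c y))" for y
  define X where "X = snd c ` (dom_chart c \<inter> f -` dom_chart d)"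
  define g where "g = snd d \<circ> f \<circ> chart_inv c"
  \<comment> \<open>The fibre coordinate of the image of the zero section, as a function of the base
    coordinate.\<close>
  define P where "P y = snd ((snd ?D \<circ> F \<circ> chart_inv ?C) (y, 0))" for y
  define L where "L = local_deriv F ?C ?D (q, \<lambda>_. 0)"
  have zero: "covec_of M c r 0 = (\<lambda>_. 0)" for r by (simp add: covec_of_def fun_eq_iff)
  have oX: "open X" unfolding X_def by (rule open_smooth_map_dom[OF M M f c(1) d(1)])
  have sg: "smooth_on X g" unfolding X_def g_def by (rule smooth_map_smooth_on[OF f c(1) d(1)])
  have x0: "snd c q \<in> X" using c d by (simp add: X_def)
  have P: "(P has_derivative (\<lambda>v. snd (L (v, 0)))) (at (snd c q))"
  proof -
    have inC: "?C \<in> cotangent_bundle M" "(q, \<lambda>_. 0) \<in> dom_chart ?C"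
      using c by (auto simp: cotangent_chart_in dom_cotangent_chart zero_in_cotangent_space[OF M])
    have inD: "?D \<in> cotangent_bundle M" "F (q, \<lambda>_. 0) \<in> dom_chart ?D"
      using cotangent_chart_in[OF d(1)] fibered_map_dom[OF q zero_in_cotangent_space[OF M] d(2)] by auto
    have "(snd ?D \<circ> F \<circ> chart_inv ?C has_derivative L) (at (snd ?C (q, \<lambda>_. 0)))"
      unfolding L_def by (rule has_derivative_local_deriv[OF T T F inC inD])
    moreover have "snd ?C (q, \<lambda>_. 0) = (snd c q, 0)"
      using covec_coord_of[OF M c, of 0] by (simp add: cotangent_chart_apply zero)
    ultimately have "(snd ?D \<circ> F \<circ> chart_inv ?C has_derivative L) (at (snd c q, 0))" by simp
    moreover have "((\<lambda>y. (y, 0 :: 'e \<Rightarrow>\<^sub>L real)) has_derivative (\<lambda>v. (v, 0))) (at (snd c q))"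
      by (intro has_derivative_Pair has_derivative_const has_derivative_ident)
    ultimately have "((\<lambda>y. (snd ?D \<circ> F \<circ> chart_inv ?C) (y, 0)) has_derivative (\<lambda>v. L (v, 0))) (at (snd c q))"
      by (rule has_derivative_compose[rotated])
    then show ?thesis unfolding P_def by (rule has_derivative_snd)
  qed
  have aP: "a y e = P y (frechet_derivative g (at y) e)" if y: "y \<in> X" for y e
  proof -
    obtain r where r: "r \<in> dom_chart c" "f r \<in> dom_chart d" "y = snd c r"
      using y by (auto simp: X_def)
    note rp = dom_chart_points[OF c(1) r(1)]
    have "P y = covec_coord M d (f r) (snd (F (r, \<lambda>_. 0)))"
      by (simp add: P_def r(3) chart_inv_cotangent_chart[OF M c(1) r(1)] zero)
        (subst fibered_map_eq[OF rp zero_in_cotangent_space[OF M]], simp add: cotangent_chart_apply)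
    then show ?thesis
      using covec_coord_translation_form[OF c(1) r(1) d(1) r(2)]
      by (simp add: a_def r(3) chart_inv_chart[OF M c(1) r(1)] local_deriv_def g_def)
  qed
  have "smooth_on (snd c ` dom_chart c) a"
    unfolding a_def by (rule smooth_on_one_form[OF M one c(1)])
  then have "(a has_derivative frechet_derivative a (at (snd c q))) (at (snd c q))"
    by (rule smooth_on_has_derivative) (use c in blast)
  then have ae: "((\<lambda>y. a y e) has_derivative (\<lambda>v. frechet_derivative a (at (snd c q)) v e)) (at (snd c q))" for e
    by (rule bounded_linear.has_derivative[OF blinfun.bounded_linear_left])
  have "((\<lambda>y. P y (frechet_derivative g (at y) e)) has_derivative (\<lambda>v. frechet_derivative a (at (snd c q)) v e)) (at (snd c q))" for e
    by (rule has_derivative_transform_within_open[OF ae oX x0]) (rule aP)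
  then have "frechet_derivative (\<lambda>y. P y (frechet_derivative g (at y) e)) (at (snd c q))
      = (\<lambda>v. frechet_derivative a (at (snd c q)) v e)" for e
    by (rule frechet_derivative_at[symmetric])
  then have "ext_deriv M (translation_form M f F) q v w
      = frechet_derivative (\<lambda>y. P y (frechet_derivative g (at y) (w c))) (at (snd c q)) (v c)
      - frechet_derivative (\<lambda>y. P y (frechet_derivative g (at y) (v c))) (at (snd c q)) (w c)"
    using ext_deriv_eq[OF M one c v w] by (simp flip: a_def)
  also have "\<dots> = snd (L (v c, 0)) (frechet_derivative g (at (snd c q)) (w c))
      - snd (L (w c, 0)) (frechet_derivative g (at (snd c q)) (v c))"
    by (rule pullback_derivative_antisym[OF oX x0 sg P])
  \<comment> \<open>Both vectors are tangent to the zero section: their fibre parts vanish, so the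
    right-hand side of the symplectic identity is zero.\<close>
  also have "\<dots> = 0"
    using symplectic_coord[OF c d C D zero_in_cotangent_space[OF M], of "(v c, 0)" "(w c, 0)"]
    by (simp add: L_def g_def local_deriv_def blinfun.zero_left)
  finally show "ext_deriv M (translation_form M f F) q v w = 0" .
qed

end

end

section \<open>Joint smoothness of the translation form in the group element and the base
  point\<close>

lemma covec_coord_zero: "covec_coord M c q (\<lambda>_. 0) = 0"
  by (intro blinfun_eqI) (simp add: covec_coord_def bounded_linear_Blinfun_apply bounded_linear_zero)

text \<open>Composition with this map restricts \<open>\<Phi>\<close> to zero covectors, smoothly in
  both arguments.\<close>

lemma smooth_map_zero_section:
  assumes N: "smooth_atlas N" and M: "smooth_atlas M"
  shows "smooth_map (prod_atlas N M) (prod_atlas N (cotangent_bundle M)) (\<lambda>z. (fst z, (snd z, \<lambda>_. 0)))"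
    (is "smooth_map _ _ ?s")
proof (rule smooth_mapI[OF smooth_atlas_prod[OF N M] smooth_atlas_prod[OF N smooth_atlas_cotangent_bundle[OF M]]])
  fix z assume "z \<in> points (prod_atlas N M)"
  then have "fst z \<in> points N" "snd z \<in> points M" by (auto simp: points_prod_atlas)
  then obtain k c where k: "k \<in> N" "fst z \<in> dom_chart k" and c: "c \<in> M" "snd z \<in> dom_chart c"
    by (metis pointsE)
  let ?K = "prod_chart k c" and ?L = "prod_chart k (cotangent_chart M c)"
  let ?U = "snd ?K ` dom_chart ?K"
  have K: "?K \<in> prod_atlas N M" and L: "?L \<in> prod_atlas N (cotangent_bundle M)"
    by (intro prod_chart_in k c cotangent_chart_in)+
  have oU: "open ?U" by (rule open_chart_image[OF smooth_atlas_prod[OF N M] K])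
  note inv = chart_inv_chart[OF smooth_atlas_prod[OF N M] K]
  have "bounded_linear (\<lambda>y. (fst y, (snd y, 0)))"
    by (intro bounded_linear_Pair bounded_linear_fst bounded_linear_snd bounded_linear_zero)
  then have "smooth_on ?U (\<lambda>y. (fst y, (snd y, 0)))" by (rule smooth_on_bounded_linear)
  then have "smooth_on ?U (snd ?L \<circ> ?s \<circ> chart_inv ?K)"
  proof (rule smooth_on_cong[OF oU, rotated])
    fix y assume "y \<in> ?U"
    then obtain w where "w \<in> dom_chart ?K" "y = snd ?K w" by blast
    then show "(fst y, (snd y, 0)) = (snd ?L \<circ> ?s \<circ> chart_inv ?K) y"
      using inv[of w] by (simp add: cotangent_chart_apply covec_coord_zero)
  qed
  moreover have "(?s \<circ> chart_inv ?K) ` ?U \<subseteq> dom_chart ?L"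
  proof
    fix y assume "y \<in> (?s \<circ> chart_inv ?K) ` ?U"
    then obtain w where "w \<in> dom_chart ?K" "y = ?s (chart_inv ?K (snd ?K w))" by auto
    then show "y \<in> dom_chart ?L"
      using inv[of w] by (auto simp: dom_cotangent_chart zero_in_cotangent_space[OF M])
  qed
  moreover have "z \<in> dom_chart ?K" using k c by (simp add: mem_Times_iff)
  ultimately show "\<exists>c\<in>prod_atlas N M. \<exists>d\<in>prod_atlas N (cotangent_bundle M). \<exists>U. z \<in> dom_chart c \<and> open U \<and>
      snd c z \<in> U \<and> U \<subseteq> snd c ` dom_chart c \<and> (?s \<circ> chart_inv c) ` U \<subseteq> dom_chart d \<and>
      smooth_on U (snd d \<circ> ?s \<circ> chart_inv c)"
    using oU by (intro bexI[OF _ K] bexI[OF _ L] exI[of _ ?U] conjI) (assumption | rule imageI subset_refl)+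
qed

text \<open>Lets a derivative with the group element held fixed be read as a derivative of the joint
  map in the direction \<open>(0, w)\<close>.\<close>

lemma local_deriv_Pair_const:
  assumes M: "smooth_atlas M" and k: "g \<in> dom_chart k" and c: "c \<in> M" "q \<in> dom_chart c"
  shows "local_deriv (\<lambda>r. (g, r)) c (prod_chart k c) q w = (0, w)"
proof -
  have "((snd (prod_chart k c) \<circ> (\<lambda>r. (g, r)) \<circ> chart_inv c) has_derivative (\<lambda>w. (0, w))) (at (snd c q))"
  proof (rule has_derivative_transform_within_open[OF _ open_chart_image[OF M c(1)]])
    show "((\<lambda>y. (snd k g, y)) has_derivative (\<lambda>w. (0, w))) (at (snd c q))"
      by (intro has_derivative_Pair has_derivative_const has_derivative_ident)
  qed (use c in \<open>auto simp: chart_inv_chart[OF M c(1)]\<close>)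
  then show ?thesis unfolding local_deriv_def by (metis frechet_derivative_at)
qed

text \<open>In coordinates the covector is the fibre part of \<open>\<Phi>\<close> on the zero
  section composed with the partial derivative of \<open>\<phi>\<close> in the base direction; both
  are smooth in the pair of coordinates. Smoothness for each single group element would be weaker
  than what the map \<open>A\<close> has to satisfy.\<close>

lemma smooth_map_translation_form:
  fixes N :: "('g, 'd::real_normed_vector) atlas" and M :: "('q, 'e::real_normed_vector) atlas"
  assumes N: "smooth_atlas N" and M: "smooth_atlas M"
    and \<phi>: "smooth_map (prod_atlas N M) M \<phi>"
    and \<Phi>: "smooth_map (prod_atlas N (cotangent_bundle M)) (cotangent_bundle M) \<Phi>"
    and fib: "\<And>g p. g \<in> points N \<Longrightarrow> p \<in> points (cotangent_bundle M) \<Longrightarrow> fst (\<Phi> (g, p)) = \<phi> (g, fst p)"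
  shows "smooth_map (prod_atlas N M) (cotangent_bundle M)
    (\<lambda>z. (snd z, translation_form M (\<lambda>q. \<phi> (fst z, q)) (\<lambda>p. \<Phi> (fst z, p)) (snd z)))"
    (is "smooth_map _ _ ?A")
proof (rule smooth_mapI[OF smooth_atlas_prod[OF N M] smooth_atlas_cotangent_bundle[OF M]])
  note T = smooth_atlas_cotangent_bundle[OF M] and NM = smooth_atlas_prod[OF N M]
  have \<phi>h: "smooth_map M M (\<lambda>q. \<phi> (h, q))" if "h \<in> points N" for h
    by (rule smooth_map_compose[OF M NM M smooth_map_Pair_const[OF N M that] \<phi>])
  have \<Phi>h: "smooth_map (cotangent_bundle M) (cotangent_bundle M) (\<lambda>p. \<Phi> (h, p))" if "h \<in> points N" for h
    by (rule smooth_map_compose[OF T smooth_atlas_prod[OF N T] T smooth_map_Pair_const[OF N T that] \<Phi>])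
  define \<Psi> where "\<Psi> z = \<Phi> (fst z, (snd z, \<lambda>_. 0))" for z
  have \<Psi>: "smooth_map (prod_atlas N M) (cotangent_bundle M) \<Psi>"
    unfolding \<Psi>_def
    by (rule smooth_map_compose[OF NM smooth_atlas_prod[OF N T] T smooth_map_zero_section[OF N M] \<Phi>])
  have \<Psi>in: "\<Psi> (h, r) = (\<phi> (h, r), snd (\<Psi> (h, r))) \<and> snd (\<Psi> (h, r)) \<in> cotangent_space M (\<phi> (h, r))"
    if "h \<in> points N" "r \<in> points M" for h r
    using fibered_map_eq[OF M \<phi>h[OF that(1)] \<Phi>h[OF that(1)] fib[OF that(1)] that(2) zero_in_cotangent_space[OF M]]
      fibered_map_snd_in[OF M \<phi>h[OF that(1)] \<Phi>h[OF that(1)] fib[OF that(1)] that(2) zero_in_cotangent_space[OF M]]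
    by (simp add: \<Psi>_def)
  fix z assume z: "z \<in> points (prod_atlas N M)"
  then have "fst z \<in> points N" "snd z \<in> points M" by (auto simp: points_prod_atlas)
  then obtain k c where k: "k \<in> N" "fst z \<in> dom_chart k" and c: "c \<in> M" "snd z \<in> dom_chart c"
    by (metis pointsE)
  obtain e where e: "e \<in> M" "\<phi> z \<in> dom_chart e"
    using smooth_map_points[OF NM M \<phi> z] by (rule pointsE)
  define K where "K = prod_chart k c"
  let ?C = "cotangent_chart M c" and ?E = "cotangent_chart M e"
  have K: "K \<in> prod_atlas N M" unfolding K_def by (rule prod_chart_in[OF k(1) c(1)])
  have C: "?C \<in> cotangent_bundle M" and E: "?E \<in> cotangent_bundle M"
    using c e by (auto intro: cotangent_chart_in)
  have Kdom: "(h, r) \<in> dom_chart K \<longleftrightarrow> h \<in> dom_chart k \<and> r \<in> dom_chart c" for h r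
    by (simp add: K_def)
  have Kapp: "snd K (h, r) = (snd k h, snd c r)" for h r by (simp add: K_def)
  define U where "U = snd K ` (dom_chart K \<inter> \<phi> -` dom_chart e)"
  define \<psi> where "\<psi> = snd e \<circ> \<phi> \<circ> chart_inv K"
  define \<rho> where "\<rho> = snd ?E \<circ> \<Psi> \<circ> chart_inv K"
  have oU: "open U" unfolding U_def by (rule open_smooth_map_dom[OF NM M \<phi> K e(1)])
  have s\<psi>: "smooth_on U \<psi>" unfolding U_def \<psi>_def by (rule smooth_map_smooth_on[OF \<phi> K e(1)])
  \<comment> \<open>\<open>\<Psi>\<close> covers \<open>\<phi>\<close>, so it lands in the bundle
    chart over \<open>e\<close> exactly where \<open>\<phi>\<close> lands in \<open>e\<close>. This
    gives the two local expressions the common domain \<open>U\<close>.\<close>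
  have dom: "dom_chart K \<inter> \<Psi> -` dom_chart ?E = dom_chart K \<inter> \<phi> -` dom_chart e"
  proof -
    have "\<Psi> (h, r) \<in> dom_chart ?E \<longleftrightarrow> \<phi> (h, r) \<in> dom_chart e" if "h \<in> dom_chart k" "r \<in> dom_chart c" for h r
    proof -
      have hr: "h \<in> points N" "r \<in> points M"
        using dom_chart_points[OF k(1) that(1)] dom_chart_points[OF c(1) that(2)] by auto
      obtain \<beta> where "\<Psi> (h, r) = (\<phi> (h, r), \<beta>)" "\<beta> \<in> cotangent_space M (\<phi> (h, r))"
        using \<Psi>in[OF hr] by blast
      then show ?thesis by (simp add: dom_cotangent_chart)
    qed
    then have "\<Psi> w \<in> dom_chart ?E \<longleftrightarrow> \<phi> w \<in> dom_chart e" if "w \<in> dom_chart K" for w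
      using that by (cases w) (simp add: K_def)
    then show ?thesis by blast
  qed
  have s\<rho>: "smooth_on U \<rho>"
    using smooth_map_smooth_on[OF \<Psi> K E] unfolding dom by (simp only: U_def \<rho>_def)
  have elem: "\<exists>h r. h \<in> dom_chart k \<and> r \<in> dom_chart c \<and> \<phi> (h, r) \<in> dom_chart e \<and> y = (snd k h, snd c r)
      \<and> chart_inv K y = (h, r)" if y: "y \<in> U" for y
  proof -
    obtain w where w: "w \<in> dom_chart K" "\<phi> w \<in> dom_chart e" "y = snd K w"
      using y unfolding U_def by blast
    moreover obtain h r where "w = (h, r)" by (cases w)
    ultimately show ?thesis using chart_inv_chart[OF NM K w(1)] Kdom Kapp by auto
  qed
  \<comment> \<open>Restricting the full derivative of \<open>\<psi>\<close> to directions
    \<open>(0, w)\<close> gives the derivative of the action with the group element held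
    fixed.\<close>
  define B where "B y = (\<lambda>w. blinfun_apply (snd (\<rho> y)) (frechet_derivative \<psi> (at y) (0, w)))" for y
  have linB: "linear (B y)" if "y \<in> U" for y
  proof -
    have lin: "linear (frechet_derivative \<psi> (at y))"
      by (rule has_derivative_linear[OF smooth_on_has_derivative[OF s\<psi> that]])
    show ?thesis unfolding B_def
      using linear_add[OF lin, of "(0, _)" "(0, _)"] linear_scale[OF lin, of _ "(0, _)"]
      by (intro linearI) (simp_all add: blinfun.add_right blinfun.scaleR_right)
  qed
  have "smooth_on U (\<lambda>y. Blinfun (B y))"
  proof (rule smooth_on_Blinfun[OF smooth_atlas_fin_dim[OF M] oU linB])
    show "smooth_on U (\<lambda>y. B y w)" for w
      unfolding B_def
      by (rule smooth_on_bilinear[OF bounded_bilinear_blinfun_apply oU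
            smooth_on_bounded_linear_compose[OF bounded_linear_snd oU s\<rho>] smooth_on_frechet_derivative[OF s\<psi>]])
  qed
  then have "smooth_on U (\<lambda>y. (snd y, Blinfun (B y)))"
    by (rule smooth_on_Pair[OF oU smooth_on_bounded_linear[OF bounded_linear_snd]])
  then have "smooth_on U (snd ?C \<circ> ?A \<circ> chart_inv K)"
  proof (rule smooth_on_cong[OF oU, rotated])
    fix y assume y: "y \<in> U"
    then obtain h r where h: "h \<in> dom_chart k" and r: "r \<in> dom_chart c" and e': "\<phi> (h, r) \<in> dom_chart e"
      and yhr: "y = (snd k h, snd c r)" and inv: "chart_inv K y = (h, r)" using elem by blast
    have hp: "h \<in> points N" and rp: "r \<in> points M"
      using dom_chart_points[OF k(1) h] dom_chart_points[OF c(1) r] by auto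
    have "Blinfun (B y) = covec_coord M c r (translation_form M (\<lambda>q. \<phi> (h, q)) (\<lambda>p. \<Phi> (h, p)) r)"
    proof (rule blinfun_eqI)
      fix w
      have "local_deriv (\<lambda>q. \<phi> (h, q)) c e r w = local_deriv \<phi> K e (h, r) (local_deriv (\<lambda>q. (h, q)) c K r w)"
        by (rule local_deriv_compose[OF M NM smooth_map_Pair_const[OF N M hp] c(1) r K _ M \<phi> e(1) e'])
          (simp add: Kdom h r)
      also have "\<dots> = frechet_derivative \<psi> (at y) (0, w)"
        unfolding K_def local_deriv_Pair_const[OF M h c(1) r]
        by (simp add: local_deriv_def \<psi>_def yhr flip: K_def) (simp add: Kapp)
      finally have ld: "local_deriv (\<lambda>q. \<phi> (h, q)) c e r w = frechet_derivative \<psi> (at y) (0, w)" .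
      obtain \<beta> where \<beta>: "\<Psi> (h, r) = (\<phi> (h, r), \<beta>)" using \<Psi>in[OF hp rp] by blast
      have "snd (\<rho> y) = covec_coord M e (\<phi> (h, r)) \<beta>"
        by (simp add: \<rho>_def inv \<beta> cotangent_chart_apply)
      then show "blinfun_apply (Blinfun (B y)) w
          = blinfun_apply (covec_coord M c r (translation_form M (\<lambda>q. \<phi> (h, q)) (\<lambda>p. \<Phi> (h, p)) r)) w"
        using covec_coord_translation_form[OF M \<phi>h[OF hp] \<Phi>h[OF hp] fib[OF hp] c(1) r e(1) e', of w] \<beta>
        unfolding bounded_linear_Blinfun_apply[OF fin_dim_bounded_linear[OF smooth_atlas_fin_dim[OF M] linB[OF y]]]
        by (simp add: B_def ld \<Psi>_def)
    qed
    then show "(snd y, Blinfun (B y)) = (snd ?C \<circ> ?A \<circ> chart_inv K) y"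
      by (simp add: inv[unfolded yhr] cotangent_chart_apply yhr)
  qed
  moreover have "(?A \<circ> chart_inv K) ` U \<subseteq> dom_chart ?C"
  proof
    fix x assume "x \<in> (?A \<circ> chart_inv K) ` U"
    then obtain y where "y \<in> U" and x: "x = ?A (chart_inv K y)" by auto
    then obtain h r where h: "h \<in> dom_chart k" and r: "r \<in> dom_chart c" and inv: "chart_inv K y = (h, r)"
      using elem by blast
    note hp = dom_chart_points[OF k(1) h]
    show "x \<in> dom_chart ?C"
      using translation_form_in[OF M \<phi>h[OF hp] \<Phi>h[OF hp] fib[OF hp] dom_chart_points[OF c(1) r]] r
      by (simp add: x inv dom_cotangent_chart)
  qed
  moreover have "z \<in> dom_chart K" using k c by (simp add: K_def mem_Times_iff)
  moreover have "snd K z \<in> U" using k c e by (auto simp: U_def K_def mem_Times_iff)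
  moreover have "U \<subseteq> snd K ` dom_chart K" by (auto simp: U_def)
  ultimately show "\<exists>c\<in>prod_atlas N M. \<exists>d\<in>cotangent_bundle M. \<exists>U. z \<in> dom_chart c \<and> open U \<and> snd c z \<in> U \<and>
      U \<subseteq> snd c ` dom_chart c \<and> (?A \<circ> chart_inv c) ` U \<subseteq> dom_chart d \<and> smooth_on U (snd d \<circ> ?A \<circ> chart_inv c)"
    using oU by (intro bexI[OF _ K] bexI[OF _ C] exI[of _ U] conjI)
qed

section \<open>Fiberwise linearity of the cotangent lift\<close>

lemma cotangent_space_add:
  "\<alpha> \<in> cotangent_space M q \<Longrightarrow> \<beta> \<in> cotangent_space M q \<Longrightarrow> (\<lambda>v. \<alpha> v + \<beta> v) \<in> cotangent_space M q"
  by (simp add: cotangent_space_def algebra_simps)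

lemma cotangent_space_scale:
  "\<alpha> \<in> cotangent_space M q \<Longrightarrow> (\<lambda>v. r * \<alpha> v) \<in> cotangent_space M q"
  by (simp add: cotangent_space_def algebra_simps)

text \<open>Covector spaces are closed under sums and multiples, so \<open>linear_between\<close>
  involves only values on the space itself.\<close>

lemma linear_between_cong:
  assumes "\<And>\<alpha>. \<alpha> \<in> cotangent_space M q \<Longrightarrow> f \<alpha> = g \<alpha>" "linear_between (cotangent_space M q) W g"
  shows "linear_between (cotangent_space M q) W f"
  using assms(2) unfolding linear_between_def
  by (simp add: assms(1) cotangent_space_add cotangent_space_scale cong: image_cong_simp)

text \<open>The fibre part of the cotangent lift has this shape, with \<open>f\<close> the action of
  the inverse element and \<open>r\<close> the image point. Linearity in the covector is pointwise;
  linearity of the tangent map keeps the result a covector.\<close>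

lemma linear_between_pullback:
  assumes M: "smooth_atlas M" and f: "smooth_map M M f" and r: "r \<in> points M" "f r = q"
  shows "linear_between (cotangent_space M q) (cotangent_space M r)
    (\<lambda>\<alpha> w. if w \<in> tangent_space M r then \<alpha> (tangent_map M M f r w) else 0)"
  unfolding linear_between_def
proof (intro conjI ballI allI)
  note t = tangent_map_in_tangent_space[OF M M f r(1), unfolded r(2)]
  show "(\<lambda>\<alpha> w. if w \<in> tangent_space M r then \<alpha> (tangent_map M M f r w) else 0) ` cotangent_space M q
      \<subseteq> cotangent_space M r"
  proof
    fix \<gamma> assume "\<gamma> \<in> (\<lambda>\<alpha> w. if w \<in> tangent_space M r then \<alpha> (tangent_map M M f r w) else 0) ` cotangent_space M q"
    then obtain \<alpha> where \<alpha>: "\<alpha> \<in> cotangent_space M q"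
      and \<gamma>: "\<gamma> = (\<lambda>w. if w \<in> tangent_space M r then \<alpha> (tangent_map M M f r w) else 0)" by blast
    have "\<gamma> (\<lambda>c. v c + w c) = \<gamma> v + \<gamma> w" if "v \<in> tangent_space M r" "w \<in> tangent_space M r" for v w
      using that \<alpha> t[OF that(1)] t[OF that(2)] tangent_space_add[OF M r(1) that]
      by (simp add: \<gamma> tangent_map_add[OF M M f r(1) that] cotangent_space_def)
    moreover have "\<gamma> (\<lambda>c. a *\<^sub>R v c) = a * \<gamma> v" if "v \<in> tangent_space M r" for a v
      using that \<alpha> t[OF that] tangent_space_scale[OF M r(1) that]
      by (simp add: \<gamma> tangent_map_scale[OF M M f r(1) that] cotangent_space_def)
    ultimately show "\<gamma> \<in> cotangent_space M r" by (simp add: cotangent_space_def) (simp add: \<gamma>)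
  qed
qed (auto simp: fun_eq_iff)

section \<open>The affine form of a fibered symplectic action\<close>

theorem proposition2p2:
  fixes G :: "('g, 'm) monoid_scheme"
    and MG :: "('g, 'd::real_normed_vector) atlas"
    and Q :: "('q, 'e::real_normed_vector) atlas"
    and \<phi> :: "'g \<times> 'q \<Rightarrow> 'q"
    and \<Phi> :: "'g \<times> ('q \<times> ('q, 'e) covector) \<Rightarrow> 'q \<times> ('q, 'e) covector"
  assumes "lie_group G MG"
    and "smooth_manifold Q"
    and "smooth_left_action G MG Q \<phi>"
    and "symplectic_action G MG Q \<Phi>"
    and "\<forall>g\<in>carrier G. \<forall>p\<in>points (cotangent_bundle Q). fst (\<Phi> (g, p)) = \<phi> (g, fst p)"
  shows "(\<exists>A :: 'g \<times> 'q \<Rightarrow> 'q \<times> ('q, 'e) covector.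
            smooth_map (prod_atlas MG Q) (cotangent_bundle Q) A \<and>
            (\<forall>g\<in>carrier G. \<forall>q\<in>points Q. fst (A (g, q)) = q) \<and>
            (\<forall>g\<in>carrier G. closed_one_form Q (\<lambda>q. snd (A (g, q)))) \<and>
            (\<forall>g\<in>carrier G. \<forall>p\<in>points (cotangent_bundle Q).
               \<Phi> (g, p) = cotangent_lift G Q \<phi> (g, fiber_translation (\<lambda>q. snd (A (g, q))) p)))
       \<and> affine_action G Q \<phi> \<Phi>
       \<and> (linear_action G Q \<phi> \<Phi> \<longleftrightarrow>
            (\<forall>g\<in>carrier G. \<forall>p\<in>points (cotangent_bundle Q).
               \<Phi> (g, p) = cotangent_lift G Q \<phi> (g, p)))"
proof -
  let ?T = "cotangent_bundle Q"
  interpret G: group G using assms(1) by (simp add: lie_group_def)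
  have MG: "smooth_atlas MG" and carrier: "carrier G = points MG"
    using assms(1) by (auto simp: lie_group_def intro: smooth_manifold_imp_smooth_atlas)
  have Q: "smooth_atlas Q" by (rule smooth_manifold_imp_smooth_atlas[OF assms(2)])
  note T = smooth_atlas_cotangent_bundle[OF Q]
  have s\<phi>: "smooth_map (prod_atlas MG Q) Q \<phi>" using assms(3) by (simp add: smooth_left_action_def)
  have s\<Phi>: "smooth_map (prod_atlas MG ?T) ?T \<Phi>"
    using assms(4) by (simp add: symplectic_action_def smooth_left_action_def)
  have \<phi>g: "smooth_map Q Q (\<lambda>q. \<phi> (g, q))" if "g \<in> carrier G" for g
    by (rule smooth_map_compose[OF Q smooth_atlas_prod[OF MG Q] Q smooth_map_Pair_const[OF MG Q] s\<phi>])
      (use that carrier in simp)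
  have \<Phi>g: "smooth_map ?T ?T (\<lambda>p. \<Phi> (g, p))" if "g \<in> carrier G" for g
    by (rule smooth_map_compose[OF T smooth_atlas_prod[OF MG T] T smooth_map_Pair_const[OF MG T] s\<Phi>])
      (use that carrier in simp)
  have fib: "fst (\<Phi> (g, p)) = \<phi> (g, fst p)" if "g \<in> carrier G" "p \<in> points ?T" for g p
    using assms(5) that by blast
  have symp: "pullback2 ?T ?T (\<lambda>x. \<Phi> (g, x)) (canonical_symplectic_form Q) p X Y = canonical_symplectic_form Q p X Y"
    if "g \<in> carrier G" "p \<in> points ?T" "X \<in> tangent_space ?T p" "Y \<in> tangent_space ?T p" for g p X Y
    using assms(4) that unfolding symplectic_action_def by blast
  have inv_left: "\<phi> (inv\<^bsub>G\<^esub> g, \<phi> (g, q)) = q" and inv_right: "\<phi> (g, \<phi> (inv\<^bsub>G\<^esub> g, q)) = q"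
    if "g \<in> carrier G" "q \<in> points Q" for g q
    using assms(3) that G.l_inv[OF that(1)] G.r_inv[OF that(1)] G.inv_closed[OF that(1)]
    unfolding smooth_left_action_def by metis+
  define A where "A z = (snd z, translation_form Q (\<lambda>q. \<phi> (fst z, q)) (\<lambda>p. \<Phi> (fst z, p)) (snd z))" for z
  \<comment> \<open>The fibre part of \<open>cotangent_lift\<close> over one point, isolated because
    its linearity on a fibre serves both the affine and the linear statement.\<close>
  define lift where "lift g q \<alpha> = (\<lambda>w. if w \<in> tangent_space Q (\<phi> (g, q))
    then \<alpha> (tangent_map Q Q (\<lambda>x. \<phi> (inv\<^bsub>G\<^esub> g, x)) (\<phi> (g, q)) w) else 0)" for g q and \<alpha> :: "('q, 'e) covector"
  have sA: "smooth_map (prod_atlas MG Q) ?T A"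
    unfolding A_def by (rule smooth_map_translation_form[OF MG Q s\<phi> s\<Phi>]) (simp add: fib carrier)
  have \<phi>pt: "\<phi> (g, q) \<in> points Q" if "g \<in> carrier G" "q \<in> points Q" for g q
    by (rule smooth_map_points[OF Q Q \<phi>g[OF that(1)] that(2)])
  have lift_linear: "linear_between (cotangent_space Q q) (cotangent_space Q (\<phi> (g, q))) (lift g q)"
    if g: "g \<in> carrier G" and q: "q \<in> points Q" for g q
    unfolding lift_def
    by (rule linear_between_pullback[OF Q \<phi>g[OF G.inv_closed[OF g]] \<phi>pt[OF g q] inv_left[OF g q]])
  have A_in: "snd (A (g, q)) \<in> cotangent_space Q q" if g: "g \<in> carrier G" and q: "q \<in> points Q" for g q
    using translation_form_in[OF Q \<phi>g[OF g] \<Phi>g[OF g] fib[OF g] q] by (simp add: A_def)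
  have A_closed: "closed_one_form Q (\<lambda>q. snd (A (g, q)))" if g: "g \<in> carrier G" for g
  proof -
    \<comment> \<open>Joint smoothness of \<open>A\<close> restricts to smoothness for each
      \<open>g\<close>, the premise that \<open>translation_form_closed\<close> requires.\<close>
    have "smooth_map Q ?T (\<lambda>q. A (g, q))"
      by (rule smooth_map_compose[OF Q smooth_atlas_prod[OF MG Q] T smooth_map_Pair_const[OF MG Q] sA])
        (use g carrier in simp)
    then have "one_form Q (translation_form Q (\<lambda>q. \<phi> (g, q)) (\<lambda>p. \<Phi> (g, p)))"
      by (simp add: one_form_def A_def)
    from translation_form_closed[OF Q \<phi>g[OF g] \<Phi>g[OF g] fib[OF g] symp[OF g] this]
    show ?thesis by (simp add: A_def)
  qed
  have \<Phi>_eq: "\<Phi> (g, (q, \<alpha>)) = (\<phi> (g, q), lift g q (\<lambda>v. \<alpha> v + snd (A (g, q)) v))"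
    if g: "g \<in> carrier G" and q: "q \<in> points Q" and \<alpha>: "\<alpha> \<in> cotangent_space Q q" for g q \<alpha>
  proof -
    let ?\<beta> = "snd (\<Phi> (g, (q, \<alpha>)))"
    have \<beta>: "?\<beta> \<in> cotangent_space Q (\<phi> (g, q))"
      by (rule fibered_map_snd_in[OF Q \<phi>g[OF g] \<Phi>g[OF g] fib[OF g] q \<alpha>])
    have "?\<beta> w = lift g q (\<lambda>v. \<alpha> v + snd (A (g, q)) v) w" for w
    proof (cases "w \<in> tangent_space Q (\<phi> (g, q))")
      case True
      let ?v = "tangent_map Q Q (\<lambda>x. \<phi> (inv\<^bsub>G\<^esub> g, x)) (\<phi> (g, q)) w"
      \<comment> \<open>The affine law gives the image covector only on vectors in the range of the
        tangent map of \<open>g\<close>. Since \<open>g\<close> has an inverse, every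
        \<open>w\<close> is such a vector, coming from \<open>?v\<close>.\<close>
      have "tangent_map Q Q (\<lambda>x. \<phi> (g, x)) q ?v = w"
        using tangent_map_left_inverse[OF Q Q \<phi>g[OF G.inv_closed[OF g]] \<phi>g[OF g] \<phi>pt[OF g q] inv_right[OF g] True]
        by (simp add: inv_left[OF g q])
      moreover have "?v \<in> tangent_space Q q"
        using tangent_map_in_tangent_space[OF Q Q \<phi>g[OF G.inv_closed[OF g]] \<phi>pt[OF g q] True]
        by (simp add: inv_left[OF g q])
      ultimately show ?thesis
        using symplectic_fiber_affine[OF Q \<phi>g[OF g] \<Phi>g[OF g] fib[OF g] symp[OF g] q \<alpha>, of ?v] True
        by (simp add: lift_def A_def)
    next
      case False
      \<comment> \<open>Off the tangent space both sides vanish by the normalisation of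
        covectors.\<close>
      then have "?\<beta> w = 0" using \<beta> unfolding cotangent_space_def by blast
      then show ?thesis using False by (simp add: lift_def)
    qed
    then show ?thesis
      using fibered_map_eq[OF Q \<phi>g[OF g] \<Phi>g[OF g] fib[OF g] q \<alpha>] by (simp add: fun_eq_iff prod_eq_iff)
  qed
  have lift_eq: "cotangent_lift G Q \<phi> (g, (q, \<alpha>)) = (\<phi> (g, q), lift g q \<alpha>)" for g q \<alpha>
    by (simp add: cotangent_lift_def lift_def)
  have part3: "\<Phi> (g, p) = cotangent_lift G Q \<phi> (g, fiber_translation (\<lambda>q. snd (A (g, q))) p)"
    if "g \<in> carrier G" "p \<in> points ?T" for g p
    using that \<Phi>_eq by (cases p) (simp add: fiber_translation_def lift_eq points_cotangent_bundle)
  have affine: "affine_action G Q \<phi> \<Phi>"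
    unfolding fiberwise_def affine_between_def
  proof (intro ballI)
    fix g q assume g: "g \<in> carrier G" and q: "q \<in> points Q"
    have "lift g q (snd (A (g, q))) \<in> cotangent_space Q (\<phi> (g, q))"
      using lift_linear[OF g q] A_in[OF g q] unfolding linear_between_def by blast
    \<comment> \<open>As the lift is linear, translating before it amounts to adding the fixed
      covector \<open>lift g q (snd (A (g, q)))\<close> after it.\<close>
    moreover have "snd (\<Phi> (g, (q, \<alpha>))) = (\<lambda>w. lift g q \<alpha> w + lift g q (snd (A (g, q))) w)"
      if "\<alpha> \<in> cotangent_space Q q" for \<alpha>
      by (simp add: \<Phi>_eq[OF g q that]) (simp add: lift_def fun_eq_iff)
    ultimately show "\<exists>L. \<exists>b\<in>cotangent_space Q (\<phi> (g, q)).
        linear_between (cotangent_space Q q) (cotangent_space Q (\<phi> (g, q))) L \<and>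
        (\<forall>\<alpha>\<in>cotangent_space Q q. snd (\<Phi> (g, (q, \<alpha>))) = (\<lambda>w. L \<alpha> w + b w))"
      using lift_linear[OF g q] by blast
  qed
  have "linear_action G Q \<phi> \<Phi> \<longleftrightarrow> (\<forall>g\<in>carrier G. \<forall>p\<in>points ?T. \<Phi> (g, p) = cotangent_lift G Q \<phi> (g, p))"
  proof (intro iffI ballI)
    fix g p assume lin: "linear_action G Q \<phi> \<Phi>" and g: "g \<in> carrier G" and p: "p \<in> points ?T"
    obtain q \<alpha> where p: "p = (q, \<alpha>)" and q: "q \<in> points Q" and \<alpha>: "\<alpha> \<in> cotangent_space Q q"
      using p by (auto simp: points_cotangent_bundle)
    note zero = zero_in_cotangent_space[OF Q, of q]
    have "linear_between (cotangent_space Q q) (cotangent_space Q (\<phi> (g, q))) (\<lambda>\<alpha>. snd (\<Phi> (g, (q, \<alpha>))))"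
      using lin g q by (simp add: fiberwise_def)
    then have "snd (\<Phi> (g, (q, \<lambda>v. r * \<beta> v))) = (\<lambda>w. r * snd (\<Phi> (g, (q, \<beta>))) w)"
      if "\<beta> \<in> cotangent_space Q q" for r \<beta>
      using that unfolding linear_between_def by blast
    \<comment> \<open>A fibrewise linear map sends the zero covector to zero. Since \<open>A\<close>
      is built from exactly this value, the translation vanishes and only the lift remains.\<close>
    from this[OF zero, of 0] have "snd (\<Phi> (g, (q, \<lambda>_. 0))) = (\<lambda>_. 0)" by simp
    then have "snd (A (g, q)) = (\<lambda>_. 0)" by (simp add: A_def translation_form_def fun_eq_iff)
    then show "\<Phi> (g, p) = cotangent_lift G Q \<phi> (g, p)"
      by (simp add: p \<Phi>_eq[OF g q \<alpha>] lift_eq)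
  next
    assume eq: "\<forall>g\<in>carrier G. \<forall>p\<in>points ?T. \<Phi> (g, p) = cotangent_lift G Q \<phi> (g, p)"
    show "linear_action G Q \<phi> \<Phi>"
      unfolding fiberwise_def
    proof (intro ballI)
      fix g q assume g: "g \<in> carrier G" and q: "q \<in> points Q"
      show "linear_between (cotangent_space Q q) (cotangent_space Q (\<phi> (g, q))) (\<lambda>\<alpha>. snd (\<Phi> (g, (q, \<alpha>))))"
        by (rule linear_between_cong[OF _ lift_linear[OF g q]])
          (use eq g q in \<open>simp add: points_cotangent_bundle lift_eq\<close>)
    qed
  qed
  moreover have "fst (A (g, q)) = q" for g q by (simp add: A_def)
  ultimately show ?thesis
    using sA A_closed part3 affine by blast
qed

end
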